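(* Let $\kappa\ge 1$ and $d<\infty$ (with $\kappa$ and $d\ge 1$ integers), and let $\eta\in C_0^1(\mathbb{R}^{2\kappa})$. Let $\{\pi_j: 1\le j\le 3\}$ be a collection of three surjective linear mappings from $\mathbb{R}^{2\kappa}$ to $\mathbb{R}^{\kappa}$ which lie in general position. Then $$|I(P;f_1,f_2,f_3)|\le C\,\langle \|P\|_{nd}\rangle^{-\epsilon}\prod_{j=1}^3\|f_j\|_{L^2(\mathbb{R}^\kappa)}$$ for all polynomials $P:\mathbb{R}^{2\kappa}\to\mathbb{R}$ of degree $\le d$ and for all functions $f_j\in L^2(\mathbb{R}^\kappa)$, $j=1,2,3$, with constants $C,\epsilon\in\mathbb{R}^+$ which depend only on $\kappa$, $d$ and $\eta$.
   Context: Here $$I(P;f_1,f_2,f_3)=\int_{\mathbb{R}^{2\kappa}} e^{iP(z)}\prod_{j=1}^3 f_j(\pi_j(z))\,\eta(z)\,dz,$$ where $P$ is a real-valued polynomial, the functions $f_j:\mathbb{R}^\kappa\to\mathbb{C}$ are complex-valued, and $C_0^1$ denotes the compactly supported continuously differentiable functions. The notation is $\langle t\rangle=(1+t^2)^{1/2}$, and $\mathbb{R}^+$ denotes the positive real numbers. The mappings $\pi_1,\pi_2,\pi_3$ lie in general position if for any two indices $i\ne j\in\{1,2,3\}$ the nullspace of $\pi_i$ is transverse to the nullspace of $\pi_j$. A polynomial $P:\mathbb{R}^{2\kappa}\to\mathbb{R}$ is called degenerate (with respect to $\{\pi_j\}$) if there exist polynomials $p_j:\mathbb{R}^\kappa\to\mathbb{R}$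 such that $P=\sum_{j=1}^3 p_j\circ\pi_j$. Let $\mathcal{P}(d)$ be the vector space of all polynomials $P:\mathbb{R}^{2\kappa}\to\mathbb{R}$ of degree $\le d$, and let $\mathcal{P}_{degen}$ be its subspace of all degenerate polynomials of degree $\le d$. Then $\|P\|_{nd}$ denotes the norm of the equivalence class $[P]$ of $P$ in the quotient space $\mathcal{P}(d)/\mathcal{P}_{degen}$, for some fixed choice of norm on this quotient, taken to be a Hilbert space norm.
   Formalization: The constant C may also depend on the maps π_j and on the chosen norm on the quotient (ε depends only on κ, d, η); uniformity of C in π_j is false, as P=0 with π_j replaced by tπ_j, t→0, shows. *)

theory Defs
  imports "HOL-Analysis.Analysis"
begin

text \<open>Polynomials of arbitrary degree are the library's \<^const>\<open>real_polynomial_function\<close>s. The library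
  has no degree for them, so polynomials of degree at most \<open>d\<close> are given by their coefficients.\<close>

definition multi_indices :: "nat \<Rightarrow> ('n::finite \<Rightarrow> nat) set" where
  "multi_indices d = {\<alpha>. (\<Sum>i\<in>UNIV. \<alpha> i) \<le> d}"

definition monomial :: "('n::finite \<Rightarrow> nat) \<Rightarrow> real ^ 'n \<Rightarrow> real" where
  "monomial \<alpha> x = (\<Prod>i\<in>UNIV. (x $ i) ^ \<alpha> i)"

definition polys_upto :: "nat \<Rightarrow> (real ^ 'n::finite \<Rightarrow> real) set" where
  "polys_upto d = {P. \<exists>c. P = (\<lambda>x. \<Sum>\<alpha>\<in>multi_indices d. c \<alpha> * monomial \<alpha> x)}"

lemma finite_multi_indices: "finite (multi_indices d :: ('n::finite \<Rightarrow> nat) set)"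
proof (rule finite_subset)
  show "(multi_indices d :: ('n \<Rightarrow> nat) set) \<subseteq> (UNIV \<rightarrow>\<^sub>E {..d})"
  proof (clarsimp simp: multi_indices_def PiE_def Pi_def)
    fix \<alpha> :: "'n \<Rightarrow> nat" and i :: 'n
    assume "sum \<alpha> UNIV \<le> d"
    moreover have "\<alpha> i \<le> sum \<alpha> UNIV" by (rule member_le_sum) auto
    ultimately show "\<alpha> i \<le> d" by simp
  qed
qed (intro finite_PiE; simp)

lemma polys_upto_mono:
  assumes "P \<in> polys_upto m" "m \<le> n"
  shows "P \<in> polys_upto n"
proof -
  obtain c where c: "P = (\<lambda>x. \<Sum>\<alpha>\<in>multi_indices m. c \<alpha> * monomial \<alpha> x)"
    using assms(1) by (auto simp: polys_upto_def)
  have sub: "multi_indices m \<subseteq> multi_indices n"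
    using assms(2) by (auto simp: multi_indices_def)
  have "P = (\<lambda>x. \<Sum>\<alpha>\<in>multi_indices n. (if \<alpha> \<in> multi_indices m then c \<alpha> else 0) * monomial \<alpha> x)"
    unfolding c by (rule ext, rule sum.mono_neutral_cong_left[OF finite_multi_indices sub]) auto
  then show ?thesis unfolding polys_upto_def by (intro CollectI exI)
qed

lemma polys_upto_add:
  assumes "P \<in> polys_upto m" "Q \<in> polys_upto m"
  shows "(\<lambda>x. P x + Q x) \<in> polys_upto m"
proof -
  obtain c e where c: "P = (\<lambda>x. \<Sum>\<alpha>\<in>multi_indices m. c \<alpha> * monomial \<alpha> x)"
    and e: "Q = (\<lambda>x. \<Sum>\<alpha>\<in>multi_indices m. e \<alpha> * monomial \<alpha> x)"
    using assms by (auto simp: polys_upto_def)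
  have "(\<lambda>x. P x + Q x) = (\<lambda>x. \<Sum>\<alpha>\<in>multi_indices m. (c \<alpha> + e \<alpha>) * monomial \<alpha> x)"
    by (simp add: c e sum.distrib distrib_right)
  then show ?thesis unfolding polys_upto_def by (intro CollectI exI)
qed

lemma polys_upto_cmult:
  assumes "P \<in> polys_upto m"
  shows "(\<lambda>x. a * P x) \<in> polys_upto m"
proof -
  obtain c where c: "P = (\<lambda>x. \<Sum>\<alpha>\<in>multi_indices m. c \<alpha> * monomial \<alpha> x)"
    using assms by (auto simp: polys_upto_def)
  have "(\<lambda>x. a * P x) = (\<lambda>x. \<Sum>\<alpha>\<in>multi_indices m. (a * c \<alpha>) * monomial \<alpha> x)"
    by (simp add: c sum_distrib_left mult.assoc)
  then show ?thesis unfolding polys_upto_def by (intro CollectI exI)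
qed

lemma polys_upto_const: "(\<lambda>x :: real ^ 'n::finite. a) \<in> polys_upto m"
proof -
  have "(\<lambda>x :: real ^ 'n. a) = (\<lambda>x. \<Sum>\<alpha>\<in>multi_indices m. (if \<alpha> = (\<lambda>_. 0) then a else 0) * monomial \<alpha> x)"
    (is "_ = ?g")
  proof
    fix x :: "real ^ 'n"
    have "?g x = (\<Sum>\<alpha>\<in>multi_indices m. if \<alpha> = (\<lambda>_ :: 'n. 0) then a else 0)"
      by (intro sum.cong refl) (simp add: monomial_def)
    then show "a = ?g x"
      by (simp add: finite_multi_indices) (simp add: multi_indices_def)
  qed
  then show ?thesis unfolding polys_upto_def by (intro CollectI exI)
qed

lemma polys_upto_sum:
  assumes "\<And>s. s \<in> S \<Longrightarrow> F s \<in> polys_upto m"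
  shows "(\<lambda>x. \<Sum>s\<in>S. F s x) \<in> polys_upto m"
  using assms
  by (induction S rule: infinite_finite_induct) (auto intro: polys_upto_const polys_upto_add)

lemma monomial_in_polys_upto:
  assumes "\<alpha> \<in> multi_indices m"
  shows "monomial \<alpha> \<in> polys_upto m"
proof -
  have "monomial \<alpha> = (\<lambda>x. \<Sum>\<beta>\<in>multi_indices m. (if \<beta> = \<alpha> then 1 else 0) * monomial \<beta> x)"
    (is "_ = ?g")
  proof
    fix x
    have "?g x = (\<Sum>\<beta>\<in>multi_indices m. if \<beta> = \<alpha> then monomial \<alpha> x else 0)"
      by (rule sum.cong) auto
    then show "monomial \<alpha> x = ?g x" using assms by (simp add: finite_multi_indices)
  qed
  then show ?thesis unfolding polys_upto_def by (intro CollectI exI)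
qed

lemma polys_upto_mult:
  assumes "P \<in> polys_upto m" "Q \<in> polys_upto n"
  shows "(\<lambda>x. P x * Q x) \<in> polys_upto (m + n)"
proof -
  obtain c e where c: "P = (\<lambda>x. \<Sum>\<alpha>\<in>multi_indices m. c \<alpha> * monomial \<alpha> x)"
    and e: "Q = (\<lambda>x. \<Sum>\<alpha>\<in>multi_indices n. e \<alpha> * monomial \<alpha> x)"
    using assms by (auto simp: polys_upto_def)
  have mono: "monomial \<alpha> x * monomial \<beta> x = monomial (\<lambda>i. \<alpha> i + \<beta> i) x" for \<alpha> \<beta> :: "'a \<Rightarrow> nat" and x
    by (simp add: monomial_def power_add prod.distrib)
  have "(\<lambda>x. P x * Q x) = (\<lambda>x. \<Sum>\<alpha>\<in>multi_indices m. \<Sum>\<beta>\<in>multi_indices n.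
      (c \<alpha> * e \<beta>) * monomial (\<lambda>i. \<alpha> i + \<beta> i) x)"
    by (simp add: c e sum_product mono[symmetric] mult_ac)
  also have "\<dots> \<in> polys_upto (m + n)"
    by (intro polys_upto_sum polys_upto_cmult monomial_in_polys_upto)
       (auto simp: multi_indices_def sum.distrib intro: add_mono)
  finally show ?thesis .
qed

lemma polys_upto_linear:
  fixes f :: "real ^ 'n::finite \<Rightarrow> real"
  assumes "bounded_linear f"
  shows "f \<in> polys_upto 1"
proof -
  have lin: "linear f" using assms by (rule bounded_linear.linear)
  have "f x = (\<Sum>i\<in>UNIV. f (axis i 1) * monomial (\<lambda>j. if j = i then 1 else 0) x)" for x
  proof -
    have m: "monomial (\<lambda>j. if j = i then 1 else 0) x = x $ i" for i
      by (simp add: monomial_def if_distrib[where f = "\<lambda>k. _ ^ k"] cong: if_cong)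
    have "f x = f (\<Sum>i\<in>UNIV. (x $ i) *\<^sub>R axis i 1)"
      using basis_expansion[of x] by (simp add: scalar_mult_eq_scaleR)
    also have "\<dots> = (\<Sum>i\<in>UNIV. (x $ i) * f (axis i 1))"
      by (simp add: linear_sum[OF lin] linear_scale[OF lin])
    finally show ?thesis unfolding m by (simp add: mult.commute)
  qed
  then have "f = (\<lambda>x. \<Sum>i\<in>UNIV. f (axis i 1) * monomial (\<lambda>j. if j = i then 1 else 0) x)"
    by (rule ext)
  also have "\<dots> \<in> polys_upto 1"
    by (intro polys_upto_sum polys_upto_cmult monomial_in_polys_upto)
       (auto simp: multi_indices_def)
  finally show ?thesis .
qed

lemma real_polynomial_function_iff_polys_upto:
  fixes P :: "real ^ 'n::finite \<Rightarrow> real"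
  shows "real_polynomial_function P \<longleftrightarrow> (\<exists>m. P \<in> polys_upto m)"
proof
  assume "real_polynomial_function P"
  then show "\<exists>m. P \<in> polys_upto m"
  proof (induction P rule: real_polynomial_function.induct)
    case (linear f)
    then show ?case using polys_upto_linear by blast
  next
    case (const c)
    then show ?case using polys_upto_const by blast
  next
    case (add f g)
    then obtain m n where "f \<in> polys_upto m" "g \<in> polys_upto n" by auto
    then have "f \<in> polys_upto (max m n)" "g \<in> polys_upto (max m n)"
      using polys_upto_mono by (meson max.cobounded1 max.cobounded2)+
    then show ?case using polys_upto_add by blast
  next
    case (mult f g)
    then show ?case using polys_upto_mult by blast
  qed
next
  assume "\<exists>m. P \<in> polys_upto m"
  then obtain m c where c: "P = (\<lambda>x. \<Sum>\<alpha>\<in>multi_indices m. c \<alpha> * monomial \<alpha> x)"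
    by (auto simp: polys_upto_def)
  have "real_polynomial_function (\<lambda>x :: real ^ 'n. x $ i)" for i
    by (intro real_polynomial_function.intros(1) bounded_linear_vec_nth)
  then have "real_polynomial_function (monomial \<alpha> :: real ^ 'n \<Rightarrow> real)" for \<alpha>
    unfolding monomial_def[abs_def]
    by (intro real_polynomial_function_prod real_polynomial_function_power) auto
  then show "real_polynomial_function P" unfolding c
    by (intro real_polynomial_function_sum finite_multi_indices
        real_polynomial_function.intros(2,4))
qed

definition general_position :: "(nat \<Rightarrow> real ^ 'n::finite \<Rightarrow> real ^ 'k::finite) \<Rightarrow> bool" where
  "general_position \<pi> \<longleftrightarrow>
     (\<forall>i\<in>{1..3}. \<forall>j\<in>{1..3}. i \<noteq> j \<longrightarrow>
        {u + v | u v. \<pi> i u = 0 \<and> \<pi> j v = 0} = UNIV)"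

definition degenerate ::
    "(nat \<Rightarrow> real ^ 'n::finite \<Rightarrow> real ^ 'k::finite) \<Rightarrow> (real ^ 'n \<Rightarrow> real) \<Rightarrow> bool" where
  "degenerate \<pi> P \<longleftrightarrow>
     (\<exists>p. (\<forall>j\<in>{1..3}. real_polynomial_function (p j)) \<and> P = (\<lambda>z. \<Sum>j=1..3. p j (\<pi> j z)))"

text \<open>The class of \<open>P\<close> in the quotient of the polynomials of degree at most \<open>d\<close> by the
  degenerate ones, as a coset.\<close>

definition nd_class ::
    "nat \<Rightarrow> (nat \<Rightarrow> real ^ 'n::finite \<Rightarrow> real ^ 'k::finite) \<Rightarrow> (real ^ 'n \<Rightarrow> real) \<Rightarrow> (real ^ 'n \<Rightarrow> real) set"
  where
  "nd_class d \<pi> P = {Q \<in> polys_upto d. degenerate \<pi> (\<lambda>z. Q z - P z)}"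

text \<open>\<open>ip\<close> is an inner product on that quotient. The vector space operations of the quotient are
  those induced from representatives; as the quotient is finite-dimensional, every inner product
  makes it a Hilbert space.\<close>

definition nd_inner_product ::
    "nat \<Rightarrow> (nat \<Rightarrow> real ^ 'n::finite \<Rightarrow> real ^ 'k::finite) \<Rightarrow>
     ((real ^ 'n \<Rightarrow> real) set \<Rightarrow> (real ^ 'n \<Rightarrow> real) set \<Rightarrow> real) \<Rightarrow> bool" where
  "nd_inner_product d \<pi> ip \<longleftrightarrow>
     (\<forall>P\<in>polys_upto d. \<forall>Q\<in>polys_upto d.
        ip (nd_class d \<pi> P) (nd_class d \<pi> Q) = ip (nd_class d \<pi> Q) (nd_class d \<pi> P)) \<and>
     (\<forall>P\<in>polys_upto d. \<forall>Q\<in>polys_upto d. \<forall>R\<in>polys_upto d.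
        ip (nd_class d \<pi> (\<lambda>z. P z + Q z)) (nd_class d \<pi> R) =
        ip (nd_class d \<pi> P) (nd_class d \<pi> R) + ip (nd_class d \<pi> Q) (nd_class d \<pi> R)) \<and>
     (\<forall>a. \<forall>P\<in>polys_upto d. \<forall>Q\<in>polys_upto d.
        ip (nd_class d \<pi> (\<lambda>z. a * P z)) (nd_class d \<pi> Q) =
        a * ip (nd_class d \<pi> P) (nd_class d \<pi> Q)) \<and>
     (\<forall>P\<in>polys_upto d. 0 \<le> ip (nd_class d \<pi> P) (nd_class d \<pi> P)) \<and>
     (\<forall>P\<in>polys_upto d. ip (nd_class d \<pi> P) (nd_class d \<pi> P) = 0 \<longrightarrow>
        nd_class d \<pi> P = nd_class d \<pi> (\<lambda>_. 0))"

definition nd_norm ::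
    "nat \<Rightarrow> (nat \<Rightarrow> real ^ 'n::finite \<Rightarrow> real ^ 'k::finite) \<Rightarrow>
     ((real ^ 'n \<Rightarrow> real) set \<Rightarrow> (real ^ 'n \<Rightarrow> real) set \<Rightarrow> real) \<Rightarrow> (real ^ 'n \<Rightarrow> real) \<Rightarrow> real" where
  "nd_norm d \<pi> ip P = sqrt (ip (nd_class d \<pi> P) (nd_class d \<pi> P))"

definition C1_compact_support :: "('a::euclidean_space \<Rightarrow> complex) \<Rightarrow> bool" where
  "C1_compact_support \<eta> \<longleftrightarrow>
     compact (closure {z. \<eta> z \<noteq> 0}) \<and>
     (\<exists>\<eta>' :: 'a \<Rightarrow> 'a \<Rightarrow>\<^sub>L complex.
        (\<forall>z. (\<eta> has_derivative blinfun_apply (\<eta>' z)) (at z)) \<and> continuous_on UNIV \<eta>')"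

definition in_L2 :: "('a::euclidean_space \<Rightarrow> complex) \<Rightarrow> bool" where
  "in_L2 f \<longleftrightarrow> f \<in> borel_measurable lebesgue \<and> integrable lebesgue (\<lambda>x. (cmod (f x))\<^sup>2)"

definition L2_norm :: "('a::euclidean_space \<Rightarrow> complex) \<Rightarrow> real" where
  "L2_norm f = sqrt (LINT x|lebesgue. (cmod (f x))\<^sup>2)"

definition japanese_bracket :: "real \<Rightarrow> real" where
  "japanese_bracket t = (1 + t\<^sup>2) powr (1 / 2)"

definition trilinear_form ::
    "(real ^ 'n::finite \<Rightarrow> complex) \<Rightarrow> (nat \<Rightarrow> real ^ 'n \<Rightarrow> real ^ 'k::finite) \<Rightarrow>
     (real ^ 'n \<Rightarrow> real) \<Rightarrow> (nat \<Rightarrow> real ^ 'k \<Rightarrow> complex) \<Rightarrow> complex" where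
  "trilinear_form \<eta> \<pi> P f =
     (LINT z|lebesgue. exp (\<i> * of_real (P z)) * (\<Prod>j=1..3. f j (\<pi> j z)) * \<eta> z)"

end

theory Submission
  imports Defs "HOL-Computational_Algebra.Fundamental_Theorem_Algebra"
begin

text \<open>In coordinates \<open>z = T (x, y)\<close> adapted to the kernels of \<open>\<pi>\<^sub>1\<close> and \<open>\<pi>\<^sub>2\<close> the form becomes the integral
  of \<open>exp (\<i> P) f(x) g(y) h(x + y) \<eta>\<close>. Since one of the three functions may be measured in \<open>L\<^sup>1\<close> when the
  others are measured in \<open>L\<^sup>2\<close>, truncating them at height \<open>\<lambda>\<close> costs only \<open>O(1 / \<lambda>)\<close>, and it suffices to
  gain a power for bounded functions.

  For these the Cauchy-Schwarz inequality eliminates first \<open>h\<close> and then a function of \<open>(w, x)\<close>, where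
  \<open>w\<close> is a difference of points; what is left is an oscillatory integral in
  \<open>((w, x), (x', x''))\<close> whose remaining unknown factor does not depend on \<open>x\<close>. Averaging over shifts in
  \<open>x\<close>, together with a sublevel set estimate for polynomials, bounds it by a negative power of the size
  \<open>M\<close> of the \<open>x\<close>-gradient of the new phase. That phase is linear in \<open>P\<close>, and it is independent
  of \<open>x\<close> only if \<open>P\<close>, after subtracting functions of \<open>x\<close> and of \<open>y\<close>, is a symmetric 2-cocycle,
  hence a coboundary \<open>p (x + y) - p x - p y\<close>; that is, only if \<open>P\<close> is degenerate. As \<open>P\<close> ranges over
  a finite-dimensional space, \<open>M\<close> dominates the nondegenerate norm.\<close>

text \<open>The functions \<open>f\<close>, \<open>g\<close>, \<open>h\<close> are merely
  measurable, so no derivative may fall on them. This is why the oscillation is extracted by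
  shifting in the one direction along which the surviving unknown is constant, and why the amplitude
  is only ever asked to be bounded and Lipschitz. The exponent \<open>1 / (96 * d)\<close> collects
  the losses. With \<open>M\<close> the size of the slope, a shift of length
  \<open>M powr (- 2 / 3)\<close> keeps the quadratic Taylor error small while the linear phase
  still turns many times; a polynomial of degree \<open>d\<close> can fall below
  \<open>\<tau> ^ d\<close> times its size on a set of measure comparable to \<open>\<tau>\<close>,
  and balancing the two gives \<open>1 / (6 * d)\<close>. Each of the two Cauchy-Schwarz steps takes
  a square root, which makes it \<open>1 / (24 * d)\<close>. Truncation trades a factor
  \<open>lam ^ 3\<close> against \<open>1 / lam\<close>, which makes it \<open>1 / (96 * d)\<close>.
  None of this sees the maps or the chosen norm; they enter only through multiplicative constants.
  Polynomials are studied through their restrictions to lines, so that interpolation and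
  factorization in one variable do the work of calculus in several.\<close>

section \<open>Polynomials on lines and sublevel sets\<close>

text \<open>Degree is measured on lines, without coordinates: the notion survives linear
  substitutions, makes sense on nested products, and brings every estimate back to polynomials in
  one variable.\<close>

definition line_poly :: "nat \<Rightarrow> ('a::real_vector \<Rightarrow> real) \<Rightarrow> bool" where
  "line_poly d Q \<longleftrightarrow> (\<forall>z v. \<exists>p. degree p \<le> d \<and> (\<forall>s. Q (z + s *\<^sub>R v) = poly p s))"

text \<open>\<open>l i k\<close> is the \<open>i\<close>-th coefficient of the \<open>k\<close>-th
  Lagrange polynomial for the nodes \<open>k / Suc d\<close>. The nodes lie in the unit interval, so
  a bound there controls all coefficients; the denominator \<open>Suc d\<close> is never
  zero.\<close>

lemma ex_coeff_interpolation:
  "\<exists>l :: nat \<Rightarrow> nat \<Rightarrow> real. \<forall>p. degree p \<le> d \<longrightarrow>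
     (\<forall>i. coeff p i = (\<Sum>k\<le>d. l i k * poly p (real k / Suc d)))"
proof -
  define n where "n k = real k / Suc d" for k
  have inj: "n j \<noteq> n k" if "j \<noteq> k" for j k using that by (simp add: n_def)
  define l where "l k = (\<Prod>j\<in>{..d} - {k}. smult (1 / (n k - n j)) [:- n j, 1:])" for k
  have pl: "poly (l k) (n m) = (if m = k then 1 else 0)" if "k \<le> d" "m \<le> d" for k m
  proof (cases "m = k")
    case True
    have "poly (l k) (n k) = (\<Prod>j\<in>{..d} - {k}. 1)"
      unfolding l_def poly_prod by (rule prod.cong) (use inj[of k] in \<open>auto simp flip: diff_divide_distrib\<close>)
    then show ?thesis using True by simp
  next
    case False
    have "poly (l k) (n m) = 0"
      unfolding l_def poly_prod by (rule prod_zero) (use False that in auto)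
    then show ?thesis using False by simp
  qed
  have dl: "degree (l k) \<le> d" if "k \<le> d" for k
  proof -
    have "degree (l k) \<le> sum (degree \<circ> (\<lambda>j. smult (1 / (n k - n j)) [:- n j, 1:])) ({..d} - {k})"
      unfolding l_def by (rule degree_prod_sum_le) simp
    also have "\<dots> \<le> (\<Sum>j\<in>{..d} - {k}. 1)"
      by (rule sum_mono) (simp add: degree_smult_le)
    also have "\<dots> = d" using that by simp
    finally show ?thesis .
  qed
  have "coeff p i = (\<Sum>k\<le>d. coeff (l k) i * poly p (n k))" if p: "degree p \<le> d" for p i
  proof -
    have "p = (\<Sum>k\<le>d. smult (poly p (n k)) (l k))"
    proof (rule poly_eqI_degree[where A = "n ` {..d}"])
      fix x assume "x \<in> n ` {..d}"
      then obtain m where m: "m \<le> d" "x = n m" by auto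
      have "poly (\<Sum>k\<le>d. smult (poly p (n k)) (l k)) x = (\<Sum>k\<le>d. if k = m then poly p (n k) else 0)"
        unfolding poly_sum m(2) by (rule sum.cong) (use pl m in auto)
      then show "poly p x = poly (\<Sum>k\<le>d. smult (poly p (n k)) (l k)) x" using m by simp
    next
      have c: "card (n ` {..d}) = Suc d"
        by (subst card_image) (use inj in \<open>auto simp: inj_on_def\<close>)
      show "degree p < card (n ` {..d})" using p c by simp
      have "degree (\<Sum>k\<le>d. smult (poly p (n k)) (l k)) \<le> d"
        by (rule degree_sum_le) (use dl degree_smult_le le_trans in \<open>auto\<close>)
      then show "degree (\<Sum>k\<le>d. smult (poly p (n k)) (l k)) < card (n ` {..d})" using c by simp
    qed
    then have "coeff p i = coeff (\<Sum>k\<le>d. smult (poly p (n k)) (l k)) i" by simp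
    then show ?thesis by (simp add: coeff_sum mult.commute)
  qed
  then show ?thesis unfolding n_def by (intro exI[of _ "\<lambda>i k. coeff (l k) i"]) auto
qed

lemma ex_coeff_bound:
  "\<exists>C\<ge>0. \<forall>(p::real poly) M. degree p \<le> d \<longrightarrow> (\<forall>s\<in>{0..1}. \<bar>poly p s\<bar> \<le> M) \<longrightarrow> (\<forall>i. \<bar>coeff p i\<bar> \<le> C * M)"
proof -
  obtain l :: "nat \<Rightarrow> nat \<Rightarrow> real" where
    l: "coeff p i = (\<Sum>k\<le>d. l i k * poly p (real k / Suc d))" if "degree p \<le> d" for p i
    using ex_coeff_interpolation by blast
  define C where "C = (\<Sum>i\<le>d. \<Sum>k\<le>d. \<bar>l i k\<bar>)"
  have C0: "C \<ge> 0" unfolding C_def by (intro sum_nonneg) auto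
  have "\<bar>coeff p i\<bar> \<le> C * M" if p: "degree p \<le> d" and M: "\<forall>s\<in>{0..1}. \<bar>poly p s\<bar> \<le> M" for p M i
  proof (cases "i \<le> d")
    case True
    have M0: "M \<ge> 0" using M[rule_format, of 0] by simp
    have "\<bar>coeff p i\<bar> \<le> (\<Sum>k\<le>d. \<bar>l i k * poly p (real k / Suc d)\<bar>)"
      unfolding l[OF p] by (rule sum_abs)
    also have "\<dots> \<le> (\<Sum>k\<le>d. \<bar>l i k\<bar> * M)"
      unfolding abs_mult by (intro sum_mono mult_left_mono M[rule_format]) auto
    also have "\<dots> = (\<Sum>k\<le>d. \<bar>l i k\<bar>) * M" by (simp add: sum_distrib_right)
    also have "\<dots> \<le> C * M"
      unfolding C_def using True M0
      by (intro mult_right_mono member_le_sum[where f = "\<lambda>i. \<Sum>k\<le>d. \<bar>l i k\<bar>"]) (auto intro: sum_nonneg)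
    finally show ?thesis .
  next
    case False
    then have "coeff p i = 0" using p by (simp add: coeff_eq_0)
    then show ?thesis using C0 M[rule_format, of 0] by auto
  qed
  then show ?thesis using C0 by blast
qed

text \<open>Factor over the complex numbers and compare \<open>poly p s\<close> with
  \<open>poly p 0\<close> root by root: if the quotient is below \<open>\<tau> ^ d\<close>, some
  root \<open>r\<close> has \<open>|s - r| < \<tau> * |r|\<close>. As \<open>s\<close> is at most 2
  and \<open>\<tau>\<close> at most 1/2, such a root has modulus at most 4, so \<open>s\<close> lies
  within \<open>4 * \<tau>\<close> of its real part. The reference point 0 stays outside the
  interval from 1 to 2 because the estimate is applied to dilations by \<open>s\<close> about a
  fixed point.\<close>

lemma poly_sublevel_emeasure:
  fixes p :: "real poly"
  assumes deg: "degree p \<le> d" and t: "0 < \<tau>" "\<tau> \<le> 1 / 2"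
  shows "emeasure lborel {s\<in>{1..2}. \<bar>poly p s\<bar> < \<bar>poly p 0\<bar> * \<tau> ^ d} \<le> ennreal (8 * real d * \<tau>)"
proof -
  define q where "q = map_poly complex_of_real p"
  have q: "poly q (of_real s) = of_real (poly p s)" for s
    unfolding q_def by (induction p) (auto simp: map_poly_pCons)
  define m where "m = degree q"
  have m: "m \<le> d" unfolding m_def q_def using deg by (simp add: degree_map_poly)
  obtain r where r: "smult (lead_coeff q) (\<Prod>i<m. [:- r i, 1:]) = q"
    using complex_poly_decompose' unfolding m_def by blast
  have pq: "poly q x = lead_coeff q * (\<Prod>i<m. x - r i)" for x
    by (subst r[symmetric]) (simp add: poly_prod)
  let ?E = "{s\<in>{1..2}. \<bar>poly p s\<bar> < \<bar>poly p 0\<bar> * \<tau> ^ d}"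
  have sub: "?E \<subseteq> (\<Union>i<m. {Re (r i) - 4 * \<tau> .. Re (r i) + 4 * \<tau>})"
  proof
    fix s assume s: "s \<in> ?E"
    have "\<exists>i<m. cmod (of_real s - r i) < \<tau> * cmod (r i)"
    proof (rule ccontr)
      assume "\<not> ?thesis"
      then have ge: "\<tau> * cmod (r i) \<le> cmod (of_real s - r i)" if "i < m" for i
        using that by force
      have "\<bar>poly p 0\<bar> * \<tau> ^ m = cmod (poly q 0) * \<tau> ^ m" using q[of 0] by simp
      also have "\<dots> = cmod (lead_coeff q) * (\<Prod>i<m. \<tau> * cmod (r i))"
        by (simp add: pq norm_mult prod.distrib flip: prod_norm)
      also have "\<dots> \<le> cmod (lead_coeff q) * (\<Prod>i<m. cmod (of_real s - r i))"
        by (intro mult_left_mono prod_mono) (use ge t in auto)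
      also have "\<dots> = cmod (poly q (of_real s))" by (simp add: pq norm_mult prod_norm)
      also have "\<dots> = \<bar>poly p s\<bar>" using q[of s] by simp
      finally have "\<bar>poly p 0\<bar> * \<tau> ^ m \<le> \<bar>poly p s\<bar>" .
      moreover have "\<bar>poly p 0\<bar> * \<tau> ^ d \<le> \<bar>poly p 0\<bar> * \<tau> ^ m"
        using m t by (intro mult_left_mono power_decreasing) auto
      ultimately show False using s by simp
    qed
    then obtain i where i: "i < m" "cmod (of_real s - r i) < \<tau> * cmod (r i)" by blast
    have "cmod (r i) \<le> cmod (of_real s) + cmod (of_real s - r i)"
      by (metis norm_minus_commute norm_triangle_sub add.commute)
    also have "\<dots> \<le> 2 + cmod (r i) / 2"
      using s i(2) mult_right_mono[OF t(2), of "cmod (r i)"] by auto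
    finally have "cmod (r i) \<le> 4" by simp
    then have "\<tau> * cmod (r i) \<le> \<tau> * 4" using t by (intro mult_left_mono) auto
    then have "cmod (of_real s - r i) \<le> 4 * \<tau>" using i by simp
    then have "\<bar>s - Re (r i)\<bar> \<le> 4 * \<tau>"
      using abs_Re_le_cmod[of "of_real s - r i"] by simp
    then show "s \<in> (\<Union>i<m. {Re (r i) - 4 * \<tau> .. Re (r i) + 4 * \<tau>})" using i(1)
      by (intro UN_I[of i]) (auto simp: abs_le_iff)
  qed
  have "emeasure lborel ?E \<le> emeasure lborel (\<Union>i<m. {Re (r i) - 4 * \<tau> .. Re (r i) + 4 * \<tau>})"
    by (rule emeasure_mono[OF sub]) auto
  also have "\<dots> \<le> (\<Sum>i<m. emeasure lborel {Re (r i) - 4 * \<tau> .. Re (r i) + 4 * \<tau>})"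
    by (rule emeasure_subadditive_finite) auto
  also have "\<dots> = (\<Sum>i<m. ennreal (8 * \<tau>))"
    using t by (intro sum.cong) auto
  also have "\<dots> = ennreal (8 * m * \<tau>)"
    using t by (simp add: ennreal_of_nat_eq_real_of_nat ennreal_mult' mult_ac flip: ennreal_mult'')
  also have "\<dots> \<le> ennreal (8 * real d * \<tau>)"
    using m t by (intro ennreal_leI mult_mono) auto
  finally show ?thesis .
qed

lemma nn_integral_lborel_dilation:
  fixes f :: "'a::euclidean_space \<Rightarrow> ennreal"
  assumes [measurable]: "f \<in> borel_measurable borel" and s: "s > 0"
  shows "(\<integral>\<^sup>+x. f x \<partial>lborel) = ennreal (s ^ DIM('a)) * (\<integral>\<^sup>+x. f (t + s *\<^sub>R x) \<partial>lborel)"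
  using s by (subst lborel_affine[of s t])
    (auto simp: nn_integral_density nn_integral_distr nn_integral_cmult)

text \<open>The one-variable estimate is averaged over the lines through \<open>z0\<close>. For each
  \<open>s\<close> between 1 and 2 the substitution \<open>z = z0 + s v\<close> has Jacobian at most
  \<open>2 ^ DIM('a)\<close>; integrating over this interval of length 1 and exchanging the
  integrals leaves a one-variable sublevel set for each \<open>v\<close>. Since \<open>s\<close> is
  at least 1, only \<open>v\<close> of norm at most \<open>2 * R\<close> contribute.\<close>

lemma sublevel_emeasure:
  fixes Q :: "'a::euclidean_space \<Rightarrow> real"
  assumes Q: "line_poly d Q" "Q \<in> borel_measurable borel"
    and z0: "norm z0 \<le> R" and t: "0 < \<tau>" "\<tau> \<le> 1 / 2"
  shows "emeasure lborel {z\<in>cball 0 R. \<bar>Q z\<bar> < \<bar>Q z0\<bar> * \<tau> ^ d}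
    \<le> ennreal (2 ^ DIM('a) * measure lborel (cball (0::'a) (2 * R)) * (8 * real d * \<tau>))"
proof -
  note [measurable] = Q(2)
  define E where "E = {z\<in>cball 0 R. \<bar>Q z\<bar> < \<bar>Q z0\<bar> * \<tau> ^ d}"
  have Em[measurable]: "E \<in> sets borel" unfolding E_def by measurable
  let ?n = "DIM('a)"
  have scale: "emeasure lborel E \<le> ennreal (2 ^ ?n) * (\<integral>\<^sup>+v. indicator E (z0 + s *\<^sub>R v) \<partial>lborel)"
    if s: "s \<in> {1..2}" for s
  proof -
    have "emeasure lborel E = (\<integral>\<^sup>+x. indicator E x \<partial>lborel)" by simp
    also have "\<dots> = ennreal (s ^ ?n) * (\<integral>\<^sup>+v. indicator E (z0 + s *\<^sub>R v) \<partial>lborel)"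
      using s by (subst nn_integral_lborel_dilation[of _ s z0]) auto
    also have "\<dots> \<le> ennreal (2 ^ ?n) * (\<integral>\<^sup>+v. indicator E (z0 + s *\<^sub>R v) \<partial>lborel)"
      using s by (intro mult_right_mono ennreal_leI power_mono) auto
    finally show ?thesis .
  qed
  have inner: "(\<integral>\<^sup>+s. indicator {1..2} s * indicator E (z0 + s *\<^sub>R v) \<partial>lborel)
      \<le> ennreal (8 * real d * \<tau>) * indicator (cball 0 (2 * R)) v" for v
  proof (cases "norm v \<le> 2 * R")
    case True
    obtain p where p: "degree p \<le> d" "\<And>s. Q (z0 + s *\<^sub>R v) = poly p s"
      using Q(1) unfolding line_poly_def by blast
    have [measurable]: "poly p \<in> borel_measurable borel"
      by (intro borel_measurable_continuous_onI continuous_intros)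
    have [measurable]: "{s \<in> {1..2}. \<bar>poly p s\<bar> < \<bar>poly p 0\<bar> * \<tau> ^ d} \<in> sets borel" by measurable
    have "(\<integral>\<^sup>+s. indicator {1..2} s * indicator E (z0 + s *\<^sub>R v) \<partial>lborel)
      \<le> (\<integral>\<^sup>+s. indicator {s \<in> {1..2}. \<bar>poly p s\<bar> < \<bar>poly p 0\<bar> * \<tau> ^ d} s \<partial>lborel)"
      by (intro nn_integral_mono) (use p(2) p(2)[of 0] in \<open>auto simp: E_def indicator_def\<close>)
    also have "\<dots> = emeasure lborel {s \<in> {1..2}. \<bar>poly p s\<bar> < \<bar>poly p 0\<bar> * \<tau> ^ d}"
      by (rule nn_integral_indicator) simp
    also have "\<dots> \<le> ennreal (8 * real d * \<tau>)" by (rule poly_sublevel_emeasure[OF p(1) t])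
    finally show ?thesis using True by simp
  next
    case False
    have "indicator {1..2} s * indicator E (z0 + s *\<^sub>R v) = (0::ennreal)" for s
    proof (rule ccontr)
      assume "\<not> ?thesis"
      then have s: "s \<in> {1..2}" "norm (z0 + s *\<^sub>R v) \<le> R" by (auto simp: E_def indicator_def split: if_splits)
      have "norm v \<le> norm (s *\<^sub>R v)" using s by (simp add: mult_le_cancel_right1)
      also have "\<dots> \<le> norm (z0 + s *\<^sub>R v) + norm z0" by (metis add.commute norm_triangle_sub norm_minus_commute add_diff_cancel_left' )
      finally show False using False s z0 by simp
    qed
    then show ?thesis by (simp only: nn_integral_0_iff_AE) simp
  qed
  have "emeasure lborel E = (\<integral>\<^sup>+s. emeasure lborel E * indicator {1..2} s \<partial>(lborel::real measure))"
    by (subst nn_integral_cmult_indicator) auto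
  also have "\<dots> \<le> (\<integral>\<^sup>+s. ennreal (2 ^ ?n) * (\<integral>\<^sup>+v. indicator {1..2} s * indicator E (z0 + s *\<^sub>R v) \<partial>lborel) \<partial>lborel)"
    by (intro nn_integral_mono) (use scale in \<open>auto simp: indicator_def\<close>)
  also have "\<dots> = ennreal (2 ^ ?n) * (\<integral>\<^sup>+s. (\<integral>\<^sup>+v. indicator {1..2} s * indicator E (z0 + s *\<^sub>R v) \<partial>lborel) \<partial>lborel)"
    by (rule nn_integral_cmult) measurable
  also have "\<dots> = ennreal (2 ^ ?n) * (\<integral>\<^sup>+v. (\<integral>\<^sup>+s. indicator {1..2} s * indicator E (z0 + s *\<^sub>R v) \<partial>lborel) \<partial>lborel)"
    by (subst lborel_pair.Fubini') auto
  also have "\<dots> \<le> ennreal (2 ^ ?n) * (\<integral>\<^sup>+v. ennreal (8 * real d * \<tau>) * indicator (cball 0 (2 * R)) v \<partial>(lborel::'a measure))"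
    by (intro mult_left_mono nn_integral_mono inner) auto
  also have "\<dots> = ennreal (2 ^ ?n) * (ennreal (8 * real d * \<tau>) * emeasure lborel (cball (0::'a) (2 * R)))"
    by (simp add: nn_integral_cmult_indicator)
  also have "emeasure lborel (cball (0::'a) (2 * R)) = ennreal (measure lborel (cball (0::'a) (2 * R)))"
    by (rule emeasure_eq_ennreal_measure) (use emeasure_compact_finite[of "cball (0::'a) (2*R)"] in auto)
  finally show ?thesis unfolding E_def using t by (simp add: mult_ac flip: ennreal_mult)
qed

section \<open>Closure properties of polynomials on lines\<close>

lemma line_poly_const: "line_poly d (\<lambda>z. c)"
  unfolding line_poly_def by (intro allI exI[of _ "[:c:]"]) auto

lemma line_poly_add:
  assumes "line_poly d P" "line_poly d Q"
  shows "line_poly d (\<lambda>z. P z + Q z)"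
  unfolding line_poly_def
proof (intro allI)
  fix z v
  obtain p where "degree p \<le> d" "\<And>s. P (z + s *\<^sub>R v) = poly p s" using assms(1) unfolding line_poly_def by blast
  moreover obtain q where "degree q \<le> d" "\<And>s. Q (z + s *\<^sub>R v) = poly q s" using assms(2) unfolding line_poly_def by blast
  ultimately show "\<exists>p. degree p \<le> d \<and> (\<forall>s. P (z + s *\<^sub>R v) + Q (z + s *\<^sub>R v) = poly p s)"
    by (intro exI[of _ "p + q"]) (auto intro: degree_add_le)
qed

lemma line_poly_mult:
  assumes "line_poly m P" "line_poly n Q"
  shows "line_poly (m + n) (\<lambda>z. P z * Q z)"
  unfolding line_poly_def
proof (intro allI)
  fix z v
  obtain p where "degree p \<le> m" "\<And>s. P (z + s *\<^sub>R v) = poly p s" using assms(1) unfolding line_poly_def by blast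
  moreover obtain q where "degree q \<le> n" "\<And>s. Q (z + s *\<^sub>R v) = poly q s" using assms(2) unfolding line_poly_def by blast
  ultimately show "\<exists>p. degree p \<le> m + n \<and> (\<forall>s. P (z + s *\<^sub>R v) * Q (z + s *\<^sub>R v) = poly p s)"
    by (intro exI[of _ "p * q"]) (auto intro: degree_mult_le[THEN le_trans] add_mono)
qed

lemma line_poly_cmult: "line_poly d Q \<Longrightarrow> line_poly d (\<lambda>z. c * Q z)"
  using line_poly_mult[OF line_poly_const[of 0 c], of d Q] by simp

lemma line_poly_diff: "line_poly d P \<Longrightarrow> line_poly d Q \<Longrightarrow> line_poly d (\<lambda>z. P z - Q z)"
  using line_poly_add[of d P "\<lambda>z. -1 * Q z"] line_poly_cmult[of d Q "-1"] by simp

lemma line_poly_sum: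
  "(\<And>i. i \<in> I \<Longrightarrow> line_poly d (Q i)) \<Longrightarrow> line_poly d (\<lambda>z. \<Sum>i\<in>I. Q i z)"
  by (induction I rule: infinite_finite_induct) (auto intro: line_poly_const line_poly_add)

lemma line_poly_mono: "line_poly m Q \<Longrightarrow> m \<le> n \<Longrightarrow> line_poly n Q"
  unfolding line_poly_def by (meson le_trans)

lemma line_poly_linear:
  assumes "linear f"
  shows "line_poly 1 f"
  unfolding line_poly_def
proof (intro allI)
  fix z v
  show "\<exists>p. degree p \<le> 1 \<and> (\<forall>s. f (z + s *\<^sub>R v) = poly p s)"
    by (intro exI[of _ "[:f z, f v:]"]) (auto simp: linear_add[OF assms] linear_scale[OF assms])
qed

lemma line_poly_translate: "line_poly d Q \<Longrightarrow> line_poly d (\<lambda>z. Q (z + w))"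
  unfolding line_poly_def by (metis add.assoc add.commute)

lemma line_poly_compose_linear:
  assumes "line_poly d Q" "linear f"
  shows "line_poly d (\<lambda>z. Q (f z))"
  using assms(1) unfolding line_poly_def by (simp add: linear_add[OF assms(2)] linear_scale[OF assms(2)])

section \<open>Directional derivatives of polynomials on lines\<close>

definition ddir :: "('a::real_vector \<Rightarrow> real) \<Rightarrow> 'a \<Rightarrow> 'a \<Rightarrow> real" where
  "ddir Q e z = deriv (\<lambda>s. Q (z + s *\<^sub>R e)) 0"

lemma ddir_eq_poly:
  assumes "\<And>s. Q (z + s *\<^sub>R e) = poly p s"
  shows "ddir Q e (z + s *\<^sub>R e) = poly (pderiv p) s"
proof -
  have eq: "(\<lambda>t. Q (z + s *\<^sub>R e + t *\<^sub>R e)) = (\<lambda>t. poly p (s + t))"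
    by (simp add: add.assoc flip: assms scaleR_add_left)
  have "((\<lambda>t. poly p (s + t)) has_field_derivative poly (pderiv p) (s + 0) * 1) (at 0)"
    by (rule DERIV_chain2[OF poly_DERIV]) (auto intro!: derivative_eq_intros)
  then show ?thesis unfolding ddir_def eq by (simp add: DERIV_imp_deriv)
qed

text \<open>The derivative at \<open>z\<close> is the linear coefficient on the line, hence a
  combination of translates of \<open>Q\<close> with weights depending only on \<open>d\<close>.
  Degree, continuity and linearity in \<open>Q\<close> all pass to \<open>ddir\<close> through this
  formula.\<close>

lemma ddir_interpolation:
  "\<exists>l. \<forall>(Q :: 'a::real_vector \<Rightarrow> real) e z. line_poly d Q \<longrightarrow>
     ddir Q e z = (\<Sum>k\<le>d. l k * Q (z + (real k / Suc d) *\<^sub>R e))"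
proof -
  obtain l :: "nat \<Rightarrow> nat \<Rightarrow> real" where
    l: "coeff p i = (\<Sum>k\<le>d. l i k * poly p (real k / Suc d))" if "degree p \<le> d" for p i
    using ex_coeff_interpolation by blast
  have "ddir Q e z = (\<Sum>k\<le>d. l 1 k * Q (z + (real k / Suc d) *\<^sub>R e))"
    if Q: "line_poly d Q" for Q :: "'a \<Rightarrow> real" and e z
  proof -
    obtain p where p: "degree p \<le> d" "\<And>s. Q (z + s *\<^sub>R e) = poly p s" using Q unfolding line_poly_def by blast
    have "ddir Q e z = poly (pderiv p) 0" using ddir_eq_poly[OF p(2), of 0] by simp
    also have "\<dots> = coeff p 1" by (simp add: poly_0_coeff_0 coeff_pderiv)
    finally show ?thesis by (simp add: l[OF p(1)] p(2))
  qed
  then show ?thesis by blast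
qed

lemma line_poly_ddir:
  assumes "line_poly d Q" shows "line_poly d (ddir Q e)"
proof -
  obtain l where "\<And>z. ddir Q e z = (\<Sum>k\<le>d. l k * Q (z + (real k / Suc d) *\<^sub>R e))"
    using ddir_interpolation assms by blast
  then have "ddir Q e = (\<lambda>z. \<Sum>k\<le>d. l k * Q (z + (real k / Suc d) *\<^sub>R e))" by blast
  then show ?thesis
    by (auto intro!: line_poly_sum line_poly_cmult line_poly_translate assms)
qed

lemma continuous_on_ddir:
  fixes Q :: "'a::real_normed_vector \<Rightarrow> real"
  assumes "line_poly d Q" "continuous_on UNIV Q" shows "continuous_on UNIV (ddir Q e)"
proof -
  obtain l where "\<And>z. ddir Q e z = (\<Sum>k\<le>d. l k * Q (z + (real k / Suc d) *\<^sub>R e))"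
    using ddir_interpolation assms by blast
  then have "ddir Q e = (\<lambda>z. \<Sum>k\<le>d. l k * Q (z + (real k / Suc d) *\<^sub>R e))" by blast
  then show ?thesis
    by (auto intro!: continuous_intros continuous_on_compose2[OF assms(2)])
qed

lemma poly_eq_sum_upto:
  fixes p :: "'a::comm_semiring_1 poly"
  assumes "degree p \<le> d"
  shows "poly p x = (\<Sum>i\<le>d. coeff p i * x ^ i)"
  unfolding poly_altdef
  by (rule sum.mono_neutral_left) (use assms in \<open>auto simp: coeff_eq_0\<close>)

lemma poly_le_coeff_sum:
  fixes p :: "real poly"
  assumes "degree p \<le> d" "\<And>i. \<bar>coeff p i\<bar> \<le> B" "1 \<le> r" "\<bar>s\<bar> \<le> r"
  shows "\<bar>poly p s\<bar> \<le> (d + 1) * B * r ^ d"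
proof -
  have "\<bar>poly p s\<bar> = \<bar>\<Sum>i\<le>d. coeff p i * s ^ i\<bar>"
    by (simp add: poly_eq_sum_upto[OF assms(1)])
  also have "\<dots> \<le> (\<Sum>i\<le>d. \<bar>coeff p i * s ^ i\<bar>)" by (rule sum_abs)
  also have "\<dots> \<le> (\<Sum>i\<le>d. B * r ^ d)"
  proof (rule sum_mono)
    fix i assume i: "i \<in> {..d}"
    have "\<bar>s\<bar> ^ i \<le> r ^ i" using assms by (intro power_mono) auto
    also have "\<dots> \<le> r ^ d" using i assms by (intro power_increasing) auto
    finally have "\<bar>coeff p i\<bar> * \<bar>s\<bar> ^ i \<le> B * r ^ d"
      using assms(2)[of i] by (intro mult_mono) auto
    then show "\<bar>coeff p i * s ^ i\<bar> \<le> B * r ^ d" by (simp add: abs_mult power_abs)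
  qed
  finally show ?thesis by (simp add: mult.assoc add.commute)
qed

text \<open>On the ray through \<open>z\<close> the values at parameters in the unit interval bound
  the coefficients, and these bound the value at parameter \<open>norm z\<close>. The constant
  depends on \<open>d\<close> and \<open>R\<close> alone; with \<open>M = 0\<close> this becomes an
  identity theorem.\<close>

lemma line_poly_bound_extend:
  "\<exists>C\<ge>0. \<forall>(q :: 'a::real_normed_vector \<Rightarrow> real) M. line_poly d q \<longrightarrow>
     (\<forall>z\<in>cball 0 1. \<bar>q z\<bar> \<le> M) \<longrightarrow> (\<forall>z\<in>cball 0 R. \<bar>q z\<bar> \<le> C * M)"
proof -
  obtain C where C: "C \<ge> 0" "\<And>(p::real poly) M i. degree p \<le> d \<Longrightarrow> (\<forall>s\<in>{0..1}. \<bar>poly p s\<bar> \<le> M) \<Longrightarrow> \<bar>coeff p i\<bar> \<le> C * M"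
    using ex_coeff_bound[of d] by blast
  define r where "r = max 1 R"
  have "\<bar>q z\<bar> \<le> ((d + 1) * C * r ^ d) * M"
    if q: "line_poly d q" and M: "\<forall>z\<in>cball 0 1. \<bar>q z\<bar> \<le> M" and z: "z \<in> cball 0 R" for q :: "'a \<Rightarrow> real" and M z
  proof -
    obtain p where p: "degree p \<le> d" "\<And>s. q (0 + s *\<^sub>R sgn z) = poly p s" using q unfolding line_poly_def by blast
    have nz: "norm (sgn z) \<le> 1" by (simp add: norm_sgn)
    have "\<bar>poly p s\<bar> \<le> M" if "s \<in> {0..1}" for s
    proof -
      have "norm (s *\<^sub>R sgn z) \<le> 1" using that nz by (simp add: mult_le_one)
      then show ?thesis using M[rule_format, of "s *\<^sub>R sgn z"] p(2)[of s] by simp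
    qed
    then have co: "\<bar>coeff p i\<bar> \<le> C * M" for i using C(2)[OF p(1)] by blast
    have "q z = poly p (norm z)" using p(2)[of "norm z"] by (cases "z = 0") (auto simp: sgn_div_norm)
    then show ?thesis
      using poly_le_coeff_sum[OF p(1) co, of r "norm z"] z by (simp add: r_def mult_ac add.commute)
  qed
  then show ?thesis using C(1) by (intro exI[of _ "(d + 1) * C * r ^ d"]) (auto simp: r_def)
qed

text \<open>The remainder is controlled by the first derivative alone, with no bound on
  \<open>Q\<close> itself: \<open>M\<close> extends to the larger ball, bounds the coefficients of
  the derived polynomial, and hence all coefficients of \<open>Q\<close> on the line except the
  constant one.\<close>

lemma ddir_taylor_bound:
  "\<exists>C\<ge>0. \<forall>(Q :: 'a::real_normed_vector \<Rightarrow> real) e M. line_poly d Q \<longrightarrow> norm e \<le> 1 \<longrightarrow>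
     (\<forall>z\<in>cball 0 1. \<bar>ddir Q e z\<bar> \<le> M) \<longrightarrow>
     (\<forall>z\<in>cball 0 R. \<forall>s\<in>{0..1}. \<bar>Q (z + s *\<^sub>R e) - Q z - s * ddir Q e z\<bar> \<le> C * M * s\<^sup>2)"
proof -
  obtain C where C: "C \<ge> 0" "\<And>(p::real poly) M i. degree p \<le> d \<Longrightarrow> (\<forall>s\<in>{0..1}. \<bar>poly p s\<bar> \<le> M) \<Longrightarrow> \<bar>coeff p i\<bar> \<le> C * M"
    using ex_coeff_bound[of d] by blast
  obtain C' where C': "C' \<ge> 0" "\<And>(q :: 'a \<Rightarrow> real) M z. line_poly d q \<Longrightarrow>
     (\<forall>z\<in>cball 0 1. \<bar>q z\<bar> \<le> M) \<Longrightarrow> z\<in>cball 0 (R + 1) \<Longrightarrow> \<bar>q z\<bar> \<le> C' * M"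
    using line_poly_bound_extend[of d "R + 1"] by blast
  have "\<bar>Q (z + s *\<^sub>R e) - Q z - s * ddir Q e z\<bar> \<le> (d * C * C') * M * s\<^sup>2"
    if Q: "line_poly d Q" and e: "norm e \<le> 1" and M: "\<forall>z\<in>cball 0 1. \<bar>ddir Q e z\<bar> \<le> M"
      and z: "z \<in> cball 0 R" and s: "s \<in> {0..1}" for Q :: "'a \<Rightarrow> real" and e M z s
  proof -
    obtain p where p: "degree p \<le> d" "\<And>s. Q (z + s *\<^sub>R e) = poly p s" using Q unfolding line_poly_def by blast
    have pd: "ddir Q e (z + s *\<^sub>R e) = poly (pderiv p) s" for s by (rule ddir_eq_poly[OF p(2)])
    have "\<bar>poly (pderiv p) s\<bar> \<le> C' * M" if "s \<in> {0..1}" for s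
    proof -
      have "norm (z + s *\<^sub>R e) \<le> norm z + \<bar>s\<bar> * norm e" by (metis norm_scaleR norm_triangle_ineq)
      also have "\<dots> \<le> R + 1 * 1" using z e that by (intro add_mono mult_mono) auto
      finally show ?thesis using C'(2)[OF line_poly_ddir[OF Q] M, of "z + s *\<^sub>R e"] pd by simp
    qed
    then have co: "\<bar>coeff (pderiv p) i\<bar> \<le> C * (C' * M)" for i
      by (intro C(2)) (use p(1) in \<open>auto simp: degree_pderiv\<close>)
    have co2: "\<bar>coeff p i\<bar> \<le> C * (C' * M)" if "i \<ge> 1" for i
    proof -
      obtain j where j: "i = Suc j" using \<open>i \<ge> 1\<close> by (cases i) auto
      have "\<bar>coeff p i\<bar> \<le> real (Suc j) * \<bar>coeff p i\<bar>" by (simp add: mult_le_cancel_right1)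
      also have "\<dots> = \<bar>coeff (pderiv p) j\<bar>" by (simp add: coeff_pderiv j abs_mult del: of_nat_Suc)
      finally show ?thesis using co[of j] by simp
    qed
    have M0: "0 \<le> C * (C' * M)" using co[of 0] by linarith
    have q0: "Q z = coeff p 0" using p(2)[of 0] by (simp add: poly_0_coeff_0)
    have q1: "ddir Q e z = coeff p 1" using pd[of 0] by (simp add: poly_0_coeff_0 coeff_pderiv)
    \<comment> \<open>Summing up to \<open>Suc d\<close> allows the terms of index 0 and 1 to be
      split off for every \<open>d\<close>, including 0.\<close>
    have "poly p s = (\<Sum>i\<le>Suc d. coeff p i * s ^ i)"
      by (rule poly_eq_sum_upto) (use p(1) in auto)
    also have "\<dots> = coeff p 0 + (coeff p 1 * s + (\<Sum>i<d. coeff p (i + 2) * s ^ (i + 2)))"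
      by (simp add: sum.lessThan_Suc_shift flip: lessThan_Suc_atMost del: sum.lessThan_Suc power_Suc)
    finally have "Q (z + s *\<^sub>R e) - Q z - s * ddir Q e z = (\<Sum>i<d. coeff p (i + 2) * s ^ (i + 2))"
      by (simp add: p(2) q0 q1 mult.commute)
    also have "\<bar>\<dots>\<bar> \<le> (\<Sum>i<d. \<bar>coeff p (i + 2) * s ^ (i + 2)\<bar>)" by (rule sum_abs)
    also have "\<dots> \<le> (\<Sum>i<d. C * (C' * M) * s\<^sup>2)"
    proof (rule sum_mono)
      fix i
      have "s ^ (i + 2) \<le> s\<^sup>2" using s by (intro power_decreasing) auto
      then have "\<bar>coeff p (i + 2)\<bar> * s ^ (i + 2) \<le> C * (C' * M) * s\<^sup>2"
        using co2[of "i + 2"] s M0 by (intro mult_mono) auto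
      then show "\<bar>coeff p (i + 2) * s ^ (i + 2)\<bar> \<le> C * (C' * M) * s\<^sup>2"
        using s by (simp add: abs_mult)
    qed
    finally show ?thesis by (simp add: mult_ac)
  qed
  then show ?thesis using C(1) C'(1) by (intro exI[of _ "d * C * C'"]) auto
qed

section \<open>Oscillatory integrals\<close>

lemma integrable_bounded_support:
  fixes f :: "'a::euclidean_space \<Rightarrow> 'b::{banach, second_countable_topology}"
  assumes [measurable]: "f \<in> borel_measurable borel"
    and B: "\<And>z. norm (f z) \<le> B" and R: "\<And>z. norm z > R \<Longrightarrow> f z = 0"
  shows "integrable lborel f"
proof (rule Bochner_Integration.integrable_bound)
  show "integrable lborel (\<lambda>z. B * indicator (cball 0 R) z :: real)"
    by (intro integrable_mult_right integrable_real_indicator emeasure_compact_finite) auto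
  show "AE z in lborel. norm (f z) \<le> norm (B * indicator (cball 0 R) z :: real)"
    using B R by (auto simp: indicator_def not_le intro: order_trans[OF _ abs_ge_self])
qed simp

lemma cmod_exp_ii_diff_le: "cmod (exp (\<i> * of_real x) - exp (\<i> * of_real y)) \<le> \<bar>x - y\<bar>"
proof -
  have "norm (exp (\<i> * of_real x) - exp (\<i> * of_real y)) \<le> 1 * norm (x - y)"
  proof (rule differentiable_bound[where S = UNIV])
    fix t :: real
    show "((\<lambda>t. exp (\<i> * of_real t)) has_derivative (\<lambda>h. of_real h * (\<i> * exp (\<i> * of_real t)))) (at t within UNIV)"
    proof -
      have "((\<lambda>t. exp (\<i> * t)) has_field_derivative \<i> * exp (\<i> * of_real t)) (at (complex_of_real t))"
        by (auto intro!: derivative_eq_intros)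
      from has_vector_derivative_real_field[OF this, of UNIV] show ?thesis
        by (simp add: has_vector_derivative_def scaleR_conv_of_real)
    qed
    show "onorm (\<lambda>h. of_real h * (\<i> * exp (\<i> * of_real t))) \<le> 1"
      by (rule onorm_le) (simp add: norm_mult)
  qed auto
  then show ?thesis by simp
qed

lemma cmod_integral_exp_le:
  assumes q: "q \<noteq> 0" and S: "S \<ge> 0"
  shows "cmod (LINT s|lborel. indicator {0..S} s *\<^sub>R exp (\<i> * of_real (s * q))) \<le> 2 / \<bar>q\<bar>"
proof -
  let ?F = "\<lambda>s::real. exp (\<i> * of_real (s * q)) / (\<i> * of_real q)"
  have "(LINT s|lborel. indicator {0..S} s *\<^sub>R exp (\<i> * of_real (s * q))) = ?F S - ?F 0"
  proof (rule integral_FTC_atLeastAtMost[OF S])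
    fix s assume "0 \<le> s" "s \<le> S"
    show "(?F has_vector_derivative exp (\<i> * of_real (s * q))) (at s within {0..S})"
    proof -
      have "((\<lambda>t. exp (\<i> * (t * of_real q)) / (\<i> * of_real q)) has_field_derivative
          exp (\<i> * of_real (s * q))) (at (complex_of_real s))"
        using q by (auto intro!: derivative_eq_intros simp: mult_ac)
      from has_vector_derivative_real_field[OF this, of "{0..S}"] show ?thesis by simp
    qed
  qed (intro continuous_intros)
  also have "cmod \<dots> \<le> cmod (?F S) + cmod (?F 0)" by (rule norm_triangle_ineq4)
  also have "\<dots> = 2 / \<bar>q\<bar>" by (simp add: norm_divide norm_mult)
  finally show ?thesis .
qed

text \<open>Replacing \<open>z\<close> by \<open>z + s e\<close> does not change the integral; averaging over \<open>0 \<le> s \<le> S\<close> exhibits the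
  cancellation of \<open>exp (\<i> s q z)\<close>, and needs no differentiability of the amplitude.\<close>

lemma shift_average_bound:
  fixes F :: "'a::euclidean_space \<Rightarrow> complex" and G :: "'a \<Rightarrow> real"
  assumes [measurable]: "F \<in> borel_measurable borel" "G \<in> borel_measurable borel"
    and F: "\<And>z. cmod (F z) \<le> H" "\<And>z. norm z > R \<Longrightarrow> F z = 0"
    and e: "norm e \<le> 1" and S: "0 < S" "S \<le> 1"
    and inner: "\<And>z. norm z \<le> R + 1 \<Longrightarrow> cmod (LINT s|lborel. indicator {0..S} s *\<^sub>R F (z + s *\<^sub>R e)) \<le> S * G z"
    and G: "integrable lborel (\<lambda>z. indicator (cball 0 (R + 1)) z * G z)"
  shows "cmod (LINT z|lborel. F z) \<le> (LINT z|lborel. indicator (cball 0 (R + 1)) z * G z)"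
proof -
  let ?K = "\<lambda>s z. indicator {0..S} s *\<^sub>R F (z + s *\<^sub>R e)"
  have K0: "?K s z = 0" if "norm z > R + 1" for s z
  proof (cases "s \<in> {0..S}")
    case True
    have "norm z \<le> norm (z + s *\<^sub>R e) + norm (s *\<^sub>R e)"
      by (metis add_diff_cancel_right' norm_triangle_ineq4)
    moreover have "norm (s *\<^sub>R e) \<le> 1" using True S e by (simp add: mult_le_one)
    ultimately have "norm (z + s *\<^sub>R e) > R" using that by simp
    then show ?thesis by (simp add: F)
  qed simp
  have Fint: "integrable lborel F" by (rule integrable_bounded_support[OF _ F]) simp
  have shift: "(LINT z|lborel. F (z + w)) = (LINT z|lborel. F z)" for w :: 'a
  proof -
    have "(LINT z|lborel. F z) = (LINT z|distr lborel borel ((+) w). F z)" by (simp add: lborel_distr_plus)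
    also have "\<dots> = (LINT z|lborel. F (w + z))" by (subst integral_distr) auto
    finally show ?thesis by (simp add: add.commute)
  qed
  have H0: "H \<ge> 0" using F(1)[of 0] norm_ge_zero order_trans by blast
  have Kint: "integrable (lborel \<Otimes>\<^sub>M lborel) (\<lambda>(s, z). ?K s z)"
    unfolding lborel_prod
  proof (rule integrable_bounded_support)
    show "norm (case x of (s, z) \<Rightarrow> ?K s z) \<le> H" for x :: "real \<times> 'a"
      using F(1) H0 by (cases x) (auto simp: indicator_def)
    show "(case x of (s, z) \<Rightarrow> ?K s z) = 0" if "norm x > 1 + (R + 1)" for x :: "real \<times> 'a"
    proof (cases x)
      case (Pair s z)
      show ?thesis
      proof (cases "s \<in> {0..S}")
        case True
        then have "norm z > R + 1"
          using that norm_Pair_le[of s z] S by (simp add: Pair)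
        then show ?thesis using K0 Pair by simp
      qed (simp add: Pair)
    qed
  qed (unfold borel_prod[symmetric], measurable)
  have "S *\<^sub>R (LINT z|lborel. F z) = (LINT s|lborel. indicator {0..S} s *\<^sub>R (LINT z|lborel. F z))"
    using S by (simp add: integral_scaleR_left)
  also have "\<dots> = (LINT s|lborel. (LINT z|lborel. ?K s z))"
    using shift by (simp add: integral_scaleR_right)
  also have "\<dots> = (LINT z|lborel. (LINT s|lborel. ?K s z))"
    using lborel_pair.Fubini_integral[OF Kint] by simp
  finally have "S * cmod (LINT z|lborel. F z) = cmod (LINT z|lborel. (LINT s|lborel. ?K s z))"
    using S by (metis abs_of_pos norm_scaleR)
  also have "\<dots> \<le> (LINT z|lborel. S * (indicator (cball 0 (R + 1)) z * G z))"
  proof (rule Bochner_Integration.integral_norm_bound_integral)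
    show "integrable lborel (\<lambda>z. LINT s|lborel. ?K s z)"
      using lborel_pair.integrable_snd[OF Kint] by simp
    show "cmod (LINT s|lborel. ?K s z) \<le> S * (indicator (cball 0 (R + 1)) z * G z)" for z
    proof (cases "norm z \<le> R + 1")
      case False
      then have "(\<lambda>s. ?K s z) = (\<lambda>s. 0)" using K0[of z] by auto
      then show ?thesis using False by (simp only: Bochner_Integration.integral_zero) simp
    qed (use inner in simp)
  qed (use G in simp)
  also have "\<dots> = S * (LINT z|lborel. indicator (cball 0 (R + 1)) z * G z)" by simp
  finally show ?thesis using S by simp
qed

text \<open>The factor \<open>\<theta>\<close> is only measurable but invariant under shifts along
  \<open>e\<close>, so it passes through the shift average unchanged. Over a shift of length
  \<open>S\<close> the amplitude moves by \<open>L * S\<close> and linearizing the phase costs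
  \<open>M * S\<^sup>2\<close>; the linear phase then integrates to at most 2 divided by the slope.
  Where the slope is too small for this, the sublevel estimate bounds the measure and absolute
  values suffice.\<close>

lemma oscillatory_decay:
  fixes d :: nat and R H L :: real
  assumes d: "d \<ge> 1" and H: "H \<ge> 0" and R: "R \<ge> 0" and L: "L \<ge> 0"
  shows "\<exists>C\<ge>0. \<forall>(Q :: 'a::euclidean_space \<Rightarrow> real) e a \<theta> M.
    line_poly d Q \<longrightarrow> continuous_on UNIV Q \<longrightarrow> norm e \<le> 1 \<longrightarrow>
    \<theta> \<in> borel_measurable borel \<longrightarrow> (\<forall>z. cmod (\<theta> z) \<le> 1) \<longrightarrow> (\<forall>z s. \<theta> (z + s *\<^sub>R e) = \<theta> z) \<longrightarrow>
    (\<forall>z. cmod (a z) \<le> H) \<longrightarrow> (\<forall>z z'. cmod (a z - a z') \<le> L * dist z z') \<longrightarrow> (\<forall>z. norm z > R \<longrightarrow> a z = 0) \<longrightarrow>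
    1 \<le> M \<longrightarrow> (\<forall>z\<in>cball 0 1. \<bar>ddir Q e z\<bar> \<le> M) \<longrightarrow> (\<exists>z\<in>cball 0 1. M / 2 \<le> \<bar>ddir Q e z\<bar>) \<longrightarrow>
    cmod (LINT z|lborel. exp (\<i> * of_real (Q z)) * a z * \<theta> z) \<le> C * M powr (- 1 / (6 * d))"
proof -
  obtain CT where CT: "CT \<ge> 0" "\<And>(Q :: 'a \<Rightarrow> real) e M z s. line_poly d Q \<Longrightarrow> norm e \<le> 1 \<Longrightarrow>
     (\<forall>z\<in>cball 0 1. \<bar>ddir Q e z\<bar> \<le> M) \<Longrightarrow> z\<in>cball 0 (R + 1) \<Longrightarrow> s\<in>{0..1} \<Longrightarrow>
     \<bar>Q (z + s *\<^sub>R e) - Q z - s * ddir Q e z\<bar> \<le> CT * M * s\<^sup>2"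
    using ddir_taylor_bound[of d "R + 1"] by blast
  define V where "V = measure lborel (cball (0::'a) (R + 1))"
  define W where "W = 2 ^ DIM('a) * measure lborel (cball (0::'a) (2 * (R + 1))) * (8 * real d)"
  define C where "C = V * (L + H * CT + 4 * H * 2 ^ d) + H * W"
  have V0: "V \<ge> 0" and W0: "W \<ge> 0" by (auto simp: V_def W_def)
  have "cmod (LINT z|lborel. exp (\<i> * of_real (Q z)) * a z * \<theta> z) \<le> C * M powr (- 1 / (6 * d))"
    if Q: "line_poly d Q" "continuous_on UNIV Q" and e: "norm e \<le> 1"
      and th: "\<theta> \<in> borel_measurable borel" "\<forall>z. cmod (\<theta> z) \<le> 1" "\<forall>z s. \<theta> (z + s *\<^sub>R e) = \<theta> z"
      and a: "\<forall>z. cmod (a z) \<le> H" "\<forall>z z'. cmod (a z - a z') \<le> L * dist z z'" "\<forall>z. norm z > R \<longrightarrow> a z = 0"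
      and M: "1 \<le> M" "\<forall>z\<in>cball 0 1. \<bar>ddir Q e z\<bar> \<le> M" and M2: "\<exists>z\<in>cball 0 1. M / 2 \<le> \<bar>ddir Q e z\<bar>"
    for Q :: "'a \<Rightarrow> real" and e a \<theta> M
  proof -
    define q where "q = ddir Q e"
    obtain z0 where z0: "z0 \<in> cball 0 1" "M / 2 \<le> \<bar>q z0\<bar>" using M2 unfolding q_def by blast
    \<comment> \<open>With these choices each of \<open>S\<close>, \<open>M * S\<^sup>2\<close>,
      \<open>1 / (S * M * u ^ d)\<close> and \<open>\<tau>\<close> is at most the target
      \<open>u\<close>. Halving \<open>u\<close> ensures that \<open>\<tau>\<close> is at most 1/2,
      as the sublevel estimate requires.\<close>
    define u where "u = M powr (- 1 / (6 * d))"
    define S where "S = M powr (- 2 / 3)"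
    define \<tau> where "\<tau> = u / 2"
    have u: "0 < u" "u \<le> 1" unfolding u_def using M(1) powr_mono[of "-1/(6*d)" 0 M] by auto
    have S: "0 < S" "S \<le> 1" unfolding S_def using M(1) powr_mono[of "-2/3" 0 M] by auto
    have dd: "1 / (6 * real d) \<le> 1 / 6" using d by (simp add: field_simps)
    have Su: "S \<le> u" unfolding S_def u_def using M(1) dd by (intro powr_mono) auto
    have "M * S\<^sup>2 = M powr 1 * M powr (-2/3 + -2/3)" unfolding S_def powr_add using M(1) by (simp add: power2_eq_square)
    also have "\<dots> = M powr (-1/3)" by (subst powr_add[symmetric]) simp
    also have "\<dots> \<le> u" unfolding u_def using M(1) dd by (intro powr_mono) auto
    finally have MSu: "M * S\<^sup>2 \<le> u" .
    have ud: "u ^ d = M powr (-1/6)"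
      unfolding u_def using d M(1) by (simp add: powr_powr flip: powr_realpow)
    have "1 / (S * M * u ^ d) = M powr (-1/6)"
    proof -
      have "S * M * u ^ d = M powr (-2/3) * M powr 1 * M powr (-1/6)" unfolding ud S_def using M(1) by simp
      also have "\<dots> = M powr (-2/3 + 1 + -1/6)" by (simp only: powr_add)
      also have "\<dots> = M powr (1/6)" by simp
      finally show ?thesis by (simp add: powr_minus_divide)
    qed
    also have "\<dots> \<le> u" unfolding u_def using M(1) dd by (intro powr_mono) auto
    finally have SMu: "1 / (S * M * u ^ d) \<le> u" .
    have tau: "0 < \<tau>" "\<tau> \<le> 1 / 2" using u by (auto simp: \<tau>_def)
    have ql: "line_poly d q" unfolding q_def by (rule line_poly_ddir[OF Q(1)])
    have qc: "continuous_on UNIV q" unfolding q_def by (rule continuous_on_ddir[OF Q])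
    have [measurable]: "Q \<in> borel_measurable borel" "q \<in> borel_measurable borel" "\<theta> \<in> borel_measurable borel"
      using Q(2) qc th(1) by (auto intro: borel_measurable_continuous_onI)
    have "L-lipschitz_on UNIV a" using a(2) L by (auto simp: lipschitz_on_def dist_norm)
    then have ac: "continuous_on UNIV a" by (rule lipschitz_on_continuous_on)
    then have [measurable]: "a \<in> borel_measurable borel" by (rule borel_measurable_continuous_onI)
    define F where "F z = exp (\<i> * of_real (Q z)) * a z * \<theta> z" for z
    have [measurable]: "F \<in> borel_measurable borel" unfolding F_def by measurable
    have FH: "cmod (F z) \<le> H" for z
      unfolding F_def using a(1) th(2) mult_mono[of "cmod (a z)" H "cmod (\<theta> z)" 1] H by (simp add: norm_mult)
    have FR: "F z = 0" if "norm z > R" for z using a(3) that by (simp add: F_def)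
    define B where "B = {z\<in>cball 0 (R + 1). \<bar>q z\<bar> < \<bar>q z0\<bar> * \<tau> ^ d}"
    have [measurable]: "B \<in> sets borel" unfolding B_def by measurable
    have Bm: "emeasure lborel B \<le> ennreal (W * \<tau>)"
      using sublevel_emeasure[of d q z0 "R + 1" \<tau>] ql z0(1) R tau
      unfolding B_def W_def by (simp add: mult_ac)
    define G where "G z = (L * S + H * CT * M * S\<^sup>2 + 4 * H * 2 ^ d / (S * M * u ^ d)) + H * indicator B z" for z
    have [measurable]: "G \<in> borel_measurable borel" unfolding G_def by measurable
    have "cmod (LINT z|lborel. F z) \<le> (LINT z|lborel. indicator (cball 0 (R + 1)) z * G z)"
    proof (rule shift_average_bound[OF _ _ FH FR e S])
      fix z :: 'a assume z: "norm z \<le> R + 1"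
      define X where "X s = indicator {0..S} s *\<^sub>R F (z + s *\<^sub>R e)" for s :: real
      define Y where "Y s = indicator {0..S} s *\<^sub>R (exp (\<i> * of_real (s * q z)) * F z)" for s :: real
      have [measurable]: "X \<in> borel_measurable borel" "Y \<in> borel_measurable borel"
        unfolding X_def Y_def by measurable
      have S01: "norm s > 1 \<Longrightarrow> s \<notin> {0..S}" for s :: real using S by auto
      have Xi: "integrable lborel X"
        by (rule integrable_bounded_support[of _ H 1]) (use FH H S01 in \<open>auto simp: X_def indicator_def\<close>)
      have Yi: "integrable lborel Y"
        by (rule integrable_bounded_support[of _ H 1])
          (use FH H S01 in \<open>auto simp: Y_def indicator_def norm_mult\<close>)
      have XY: "cmod (X s - Y s) \<le> indicator {0..S} s * (L * S + H * CT * M * S\<^sup>2)" for s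
      proof (cases "s \<in> {0..S}")
        case True
        \<comment> \<open>The difference splits into the change of the amplitude and the error of
          the linearized phase; \<open>\<theta>\<close> factors out.\<close>
        have "F (z + s *\<^sub>R e) - exp (\<i> * of_real (s * q z)) * F z =
          (exp (\<i> * of_real (Q (z + s *\<^sub>R e))) * (a (z + s *\<^sub>R e) - a z)
          + (exp (\<i> * of_real (Q (z + s *\<^sub>R e))) - exp (\<i> * of_real (Q z + s * q z))) * a z) * \<theta> z"
          by (simp add: F_def th(3) algebra_simps exp_add)
        also have "cmod \<dots> \<le> cmod (exp (\<i> * of_real (Q (z + s *\<^sub>R e))) * (a (z + s *\<^sub>R e) - a z)
          + (exp (\<i> * of_real (Q (z + s *\<^sub>R e))) - exp (\<i> * of_real (Q z + s * q z))) * a z) * 1"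
          unfolding norm_mult by (intro mult_left_mono) (use th(2) in auto)
        also have "\<dots> \<le> cmod (a (z + s *\<^sub>R e) - a z)
           + cmod (exp (\<i> * of_real (Q (z + s *\<^sub>R e))) - exp (\<i> * of_real (Q z + s * q z))) * cmod (a z)"
          unfolding mult_1_right by (rule norm_triangle_le) (simp add: norm_mult)
        also have "\<dots> \<le> L * S + (CT * M * S\<^sup>2) * H"
        proof (intro add_mono mult_mono)
          have "cmod (a (z + s *\<^sub>R e) - a z) \<le> L * norm (s *\<^sub>R e)"
            using a(2)[rule_format, of "z + s *\<^sub>R e" z] by (simp add: dist_norm)
          also have "\<dots> \<le> L * S"
            using True e L mult_mono[of s S "norm e" 1] by (intro mult_left_mono) auto
          finally show "cmod (a (z + s *\<^sub>R e) - a z) \<le> L * S" .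
          have "cmod (exp (\<i> * of_real (Q (z + s *\<^sub>R e))) - exp (\<i> * of_real (Q z + s * q z)))
             \<le> \<bar>Q (z + s *\<^sub>R e) - (Q z + s * q z)\<bar>" by (rule cmod_exp_ii_diff_le)
          also have "\<dots> \<le> CT * M * s\<^sup>2"
            using CT(2)[OF Q(1) e M(2), of z s] True S z by (simp add: q_def algebra_simps)
          also have "\<dots> \<le> CT * M * S\<^sup>2"
            using True CT(1) M(1) by (intro mult_left_mono power_mono) auto
          finally show "cmod (exp (\<i> * of_real (Q (z + s *\<^sub>R e))) - exp (\<i> * of_real (Q z + s * q z))) \<le> CT * M * S\<^sup>2" .
        qed (use a(1) CT(1) M(1) in auto)
        finally show ?thesis using True by (simp add: X_def Y_def mult_ac)
      qed (simp add: X_def Y_def)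
      have ind: "integrable lborel (indicator {0..S} :: real \<Rightarrow> real)"
        by (rule integrable_real_indicator) (use S in auto)
      have XYi: "cmod (LINT s|lborel. X s - Y s) \<le> (LINT s|lborel. indicator {0..S} s * (L * S + H * CT * M * S\<^sup>2))"
        by (rule Bochner_Integration.integral_norm_bound_integral) (use Xi Yi XY ind in auto)
      also have "\<dots> = S * (L * S + H * CT * M * S\<^sup>2)" using S by simp
      finally have XYi': "cmod (LINT s|lborel. X s - Y s) \<le> S * (L * S + H * CT * M * S\<^sup>2)" .
      have Yb: "cmod (LINT s|lborel. Y s) \<le> S * (4 * H * 2 ^ d / (S * M * u ^ d) + H * indicator B z)"
      proof (cases "z \<in> B")
        case True
        have "cmod (LINT s|lborel. Y s) \<le> (LINT s|lborel. indicator {0..S} s * H)"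
        proof (rule Bochner_Integration.integral_norm_bound_integral[OF Yi])
          show "integrable lborel (\<lambda>s. indicator {0..S} s * H)" using ind by simp
          show "cmod (Y s) \<le> indicator {0..S} s * H" for s
            using FH[of z] by (simp add: Y_def norm_mult indicator_def)
        qed
        also have "\<dots> = S * H" using S by simp
        finally have "cmod (LINT s|lborel. Y s) \<le> S * H" .
        moreover have "0 \<le> S * (4 * H * 2 ^ d / (S * M * u ^ d))"
          using S H M(1) u by (intro mult_nonneg_nonneg divide_nonneg_nonneg) auto
        ultimately show ?thesis using True by (simp add: distrib_left)
      next
        case False
        have pos: "0 < M / 2 * \<tau> ^ d" using M(1) tau by simp
        have "M / 2 * \<tau> ^ d \<le> \<bar>q z0\<bar> * \<tau> ^ d" using z0(2) tau by (intro mult_right_mono) auto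
        also have "\<dots> \<le> \<bar>q z\<bar>" using False z by (auto simp: B_def)
        finally have qz: "M / 2 * \<tau> ^ d \<le> \<bar>q z\<bar>" .
        then have q0: "q z \<noteq> 0" using pos by auto
        have "(LINT s|lborel. Y s) = (LINT s|lborel. indicator {0..S} s *\<^sub>R exp (\<i> * of_real (s * q z))) * F z"
          by (simp add: Y_def flip: integral_mult_left_zero)
        also have "cmod \<dots> \<le> 2 / \<bar>q z\<bar> * H"
          unfolding norm_mult by (intro mult_mono cmod_integral_exp_le q0 FH) (use S in auto)
        also have "\<dots> \<le> 2 / (M / 2 * \<tau> ^ d) * H"
          using qz pos H by (intro mult_right_mono divide_left_mono) auto
        also have "\<dots> = S * (4 * H * 2 ^ d / (S * M * u ^ d))"
          using S by (simp add: \<tau>_def power_divide)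
        finally show ?thesis using False by simp
      qed
      have "(LINT s|lborel. X s) = (LINT s|lborel. X s - Y s) + (LINT s|lborel. Y s)"
        using Xi Yi by simp
      also have "cmod \<dots> \<le> cmod (LINT s|lborel. X s - Y s) + cmod (LINT s|lborel. Y s)"
        by (rule norm_triangle_ineq)
      also have "\<dots> \<le> S * G z" using XYi' Yb by (simp add: G_def distrib_left)
      finally show "cmod (LINT s|lborel. indicator {0..S} s *\<^sub>R F (z + s *\<^sub>R e)) \<le> S * G z"
        by (simp add: X_def)
    next
      show "integrable lborel (\<lambda>z. indicator (cball 0 (R + 1)) z * G z)"
        by (rule integrable_bounded_support[of _ "\<bar>L * S + H * CT * M * S\<^sup>2 + 4 * H * 2 ^ d / (S * M * u ^ d)\<bar> + H" "R + 1"])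
          (use H in \<open>auto simp: G_def indicator_def intro!: order_trans[OF abs_triangle_ineq]\<close>)
    qed simp_all
    also have "\<dots> \<le> V * ((L + H * CT + 4 * H * 2 ^ d) * u) + H * (W * u)"
    proof -
      have sub: "B \<subseteq> cball 0 (R + 1)" by (auto simp: B_def)
      have fin: "emeasure lborel (cball (0::'a) (R + 1)) < \<infinity>" by (rule emeasure_compact_finite) simp
      have finB: "emeasure lborel B < \<infinity>" using Bm by (simp add: le_less_trans)
      let ?c = "L * S + H * CT * M * S\<^sup>2 + 4 * H * 2 ^ d / (S * M * u ^ d)"
      have "(LINT z|lborel. indicator (cball 0 (R + 1)) z * G z) =
        (LINT z|lborel. indicator (cball (0::'a) (R + 1)) z * ?c + indicator B z * H)"
        by (rule Bochner_Integration.integral_cong) (use sub in \<open>auto simp: G_def indicator_def\<close>)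
      also have "\<dots> = V * ?c + measure lborel B * H"
        by (subst Bochner_Integration.integral_add) (use fin finB in \<open>auto simp: V_def less_top\<close>)
      also have "measure lborel B \<le> W * \<tau>"
        using Bm W0 tau unfolding measure_def by (intro enn2real_leI) auto
      also have "W * \<tau> \<le> W * u" unfolding \<tau>_def using W0 u by (intro mult_left_mono) auto
      also have "?c \<le> (L + H * CT + 4 * H * 2 ^ d) * u"
      proof -
        have "L * S \<le> L * u" using Su L by (rule mult_left_mono)
        moreover have "(H * CT) * (M * S\<^sup>2) \<le> (H * CT) * u" using MSu H CT(1) by (intro mult_left_mono) auto
        moreover have "(4 * H * 2 ^ d) * (1 / (S * M * u ^ d)) \<le> (4 * H * 2 ^ d) * u" using SMu H by (intro mult_left_mono) auto
        ultimately show ?thesis by (simp add: algebra_simps)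
      qed
      finally show ?thesis using V0 H by (simp add: mult_left_mono mult_right_mono mult.commute)
    qed
    also have "\<dots> = C * u" by (simp add: C_def algebra_simps)
    finally show ?thesis by (simp add: F_def u_def)
  qed
  moreover have "C \<ge> 0" unfolding C_def using V0 W0 L H CT(1) by simp
  ultimately show ?thesis by (intro exI[of _ C]) blast
qed

section \<open>Linear changes of variables and the Cauchy-Schwarz inequality\<close>

lemma borel_measurable_compose_continuous:
  assumes "f \<in> borel_measurable borel" "continuous_on UNIV g"
  shows "(\<lambda>x. f (g x)) \<in> borel_measurable borel"
  using measurable_compose[OF borel_measurable_continuous_onI[OF assms(2)] assms(1)] .

text \<open>The classical argument for the uniqueness of Haar measure: evaluate the double integral of
  \<open>1\<^sub>A (T x) 1\<^sub>B (y - T x)\<close> in both orders.\<close>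

lemma distr_lborel_linear:
  fixes T :: "'a::euclidean_space \<Rightarrow> 'b::euclidean_space"
  assumes T: "linear T" "bij T"
  shows "\<exists>c>0. distr lborel borel T = density lborel (\<lambda>_. ennreal c)"
proof -
  obtain T' where T'l: "linear T'" "T' \<circ> T = id"
    using linear_injective_left_inverse[OF T(1) bij_is_inj[OF T(2)]] by blast
  have T'2: "T' (T x) = x" for x using fun_cong[OF T'l(2), of x] by simp
  have T'3: "T (T' y) = y" for y
  proof -
    obtain x where "y = T x" using bij_is_surj[OF T(2)] by blast
    then show ?thesis by (simp add: T'2)
  qed
  note T' = T'l(1) T'2 T'3
  have Tc: "continuous_on UNIV T" by (rule linear_continuous_on) (use T(1) in \<open>simp add: linear_conv_bounded_linear\<close>)
  then have [measurable]: "T \<in> borel_measurable borel" by (rule borel_measurable_continuous_onI)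
  define B where "B = box (- One) (One :: 'b)"
  define D where "D = {x. - T x \<in> B}"
  have Bm[measurable]: "B \<in> sets borel" unfolding B_def by simp
  have Dm[measurable]: "D \<in> sets borel" unfolding D_def by measurable
  have lB: "emeasure lborel B = ennreal (2 ^ DIM('b))" unfolding B_def
    by (subst emeasure_lborel_box_eq) (auto simp: inner_simps)
  have Dop: "open D" unfolding D_def vimage_def[symmetric] B_def
    by (rule open_vimage) (auto intro!: continuous_intros Tc)
  have "0 \<in> D" by (simp add: D_def B_def mem_box linear_0[OF T(1)])
  then obtain l u where lu: "box l u \<subseteq> D" "\<forall>i\<in>Basis. l \<bullet> i < u \<bullet> i"
    using open_contains_box[OF Dop] by metis
  have "0 < emeasure lborel (box l u)" using lu(2)
    by (simp add: emeasure_lborel_box_eq less_imp_le inner_diff_left prod_pos)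
  also have "\<dots> \<le> emeasure lborel D" using lu(1) by (rule emeasure_mono) simp
  finally have Dpos: "emeasure lborel D > 0" .
  have "D \<subseteq> (\<lambda>y. T' (- y)) ` B"
  proof
    fix x assume "x \<in> D"
    then show "x \<in> (\<lambda>y. T' (- y)) ` B" by (intro image_eqI[of _ _ "- T x"]) (auto simp: D_def T'(2))
  qed
  moreover have "bounded ((\<lambda>y. T' (- y)) ` B)"
  proof (rule bounded_linear_image)
    show "bounded B" by (simp add: B_def)
    show "bounded_linear (\<lambda>y. T' (- y))"
      using T'(1) unfolding linear_conv_bounded_linear
      by (rule bounded_linear_compose[OF _ bounded_linear_minus[OF bounded_linear_ident]])
  qed
  ultimately have "bounded D" by (rule bounded_subset[rotated])
  then have Dfin: "emeasure lborel D < \<infinity>" by (rule emeasure_bounded_finite)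
  \<comment> \<open>The constant must be the quotient of the volumes of \<open>D\<close> and
    \<open>B\<close>. It is positive because \<open>D\<close> contains a box and finite because
    \<open>D\<close> is bounded.\<close>
  define c where "c = measure lborel D / 2 ^ DIM('b)"
  have eD: "emeasure lborel D = ennreal (measure lborel D)"
    using Dfin by (intro emeasure_eq_ennreal_measure) auto
  have c0: "c > 0" using Dpos unfolding c_def eD by simp
  have Dc: "emeasure lborel D = emeasure lborel B * ennreal c"
    unfolding eD lB c_def by (simp flip: ennreal_mult')
  have trans: "(\<integral>\<^sup>+x. f (w + x) \<partial>lborel) = (\<integral>\<^sup>+x. f x \<partial>lborel)" if "f \<in> borel_measurable borel" for f :: "'c::euclidean_space \<Rightarrow> ennreal" and w
  proof -
    have "(\<integral>\<^sup>+x. f x \<partial>lborel) = (\<integral>\<^sup>+x. f x \<partial>distr lborel borel ((+) w))" by (simp add: lborel_distr_plus)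
    also have "\<dots> = (\<integral>\<^sup>+x. f (w + x) \<partial>lborel)" using that by (subst nn_integral_distr) auto
    finally show ?thesis by simp
  qed
  have "distr lborel borel T = density lborel (\<lambda>_. ennreal c)"
  proof (rule measure_eqI)
    fix A assume "A \<in> sets (distr lborel borel T)"
    then have [measurable]: "A \<in> sets borel" by simp
    let ?K = "\<lambda>x y. indicator A (T x) * indicator B (y - T x) :: ennreal"
    have "emeasure lborel B * emeasure (distr lborel borel T) A = emeasure lborel B * (\<integral>\<^sup>+x. indicator A (T x) \<partial>lborel)"
      using nn_integral_distr[of T lborel borel "indicator A"] by simp
    also have "\<dots> = (\<integral>\<^sup>+x. indicator A (T x) * emeasure lborel B \<partial>lborel)"
      by (subst nn_integral_multc) (auto simp: mult.commute)
    also have "\<dots> = (\<integral>\<^sup>+x. \<integral>\<^sup>+y. ?K x y \<partial>lborel \<partial>lborel)"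
    proof (intro nn_integral_cong)
      fix x
      have "(\<integral>\<^sup>+y. indicator B (- T x + y) \<partial>lborel) = emeasure lborel B"
        by (subst trans[of "indicator B"]) auto
      then show "indicator A (T x) * emeasure lborel B = (\<integral>\<^sup>+y. ?K x y \<partial>lborel)"
        by (subst nn_integral_cmult) auto
    qed
    also have "\<dots> = (\<integral>\<^sup>+y. \<integral>\<^sup>+x. ?K x y \<partial>lborel \<partial>lborel)"
      by (subst lborel_pair.Fubini') auto
    \<comment> \<open>Translating \<open>x\<close> by \<open>T' y\<close> turns \<open>T x\<close>
      into \<open>T x + y\<close> and \<open>y - T x\<close> into \<open>- T x\<close>, so that the
      second indicator becomes that of \<open>D\<close> and no longer involves
      \<open>y\<close>.\<close>
    also have "\<dots> = (\<integral>\<^sup>+y. \<integral>\<^sup>+x. ?K (T' y + x) y \<partial>lborel \<partial>lborel)"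
    proof (rule nn_integral_cong)
      fix y
      show "(\<integral>\<^sup>+x. ?K x y \<partial>lborel) = (\<integral>\<^sup>+x. ?K (T' y + x) y \<partial>lborel)"
        by (rule trans[of "\<lambda>x. ?K x y", symmetric]) measurable
    qed
    also have "\<dots> = (\<integral>\<^sup>+y. \<integral>\<^sup>+x. indicator A (T x + y) * indicator D x \<partial>lborel \<partial>lborel)"
      by (intro nn_integral_cong) (auto simp: linear_add[OF T(1)] T'(3) D_def indicator_def add.commute)
    also have "\<dots> = (\<integral>\<^sup>+x. \<integral>\<^sup>+y. indicator A (T x + y) * indicator D x \<partial>lborel \<partial>lborel)"
      by (subst lborel_pair.Fubini') auto
    also have "\<dots> = (\<integral>\<^sup>+x. emeasure lborel A * indicator D x \<partial>lborel)"
    proof (rule nn_integral_cong)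
      fix x
      have "(\<integral>\<^sup>+y. indicator A (T x + y) * indicator D x \<partial>lborel) = (\<integral>\<^sup>+y. indicator A (T x + y) \<partial>lborel) * indicator D x"
        by (rule nn_integral_multc) measurable
      then show "(\<integral>\<^sup>+y. indicator A (T x + y) * indicator D x \<partial>lborel) = emeasure lborel A * indicator D x"
        by (subst (asm) trans[of "indicator A"]) auto
    qed
    also have "\<dots> = emeasure lborel A * emeasure lborel D" by (simp add: nn_integral_cmult_indicator)
    also have "\<dots> = emeasure lborel B * (ennreal c * emeasure lborel A)"
      unfolding Dc by (simp only: mult_ac)
    finally have "emeasure (distr lborel borel T) A = ennreal c * emeasure lborel A"
      unfolding lB by (simp add: ennreal_mult_cancel_left)
    then show "emeasure (distr lborel borel T) A = emeasure (density lborel (\<lambda>_. ennreal c)) A"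
      by (simp add: emeasure_density nn_integral_cmult_indicator)
  qed simp
  then show ?thesis using c0 by blast
qed

lemma linear_change_of_variables:
  fixes T :: "'a::euclidean_space \<Rightarrow> 'b::euclidean_space"
  assumes T: "linear T" "bij T"
  obtains c where "c > 0"
    "\<And>f :: 'b \<Rightarrow> ennreal. f \<in> borel_measurable borel \<Longrightarrow> (\<integral>\<^sup>+x. f (T x) \<partial>lborel) = ennreal c * (\<integral>\<^sup>+x. f x \<partial>lborel)"
    "\<And>f :: 'b \<Rightarrow> complex. f \<in> borel_measurable borel \<Longrightarrow> (LINT x|lborel. f (T x)) = c * (LINT x|lborel. f x)"
proof -
  obtain c where c: "c > 0" "distr lborel borel T = density lborel (\<lambda>_. ennreal c)"
    using distr_lborel_linear[OF T] by blast
  have Tm[measurable]: "T \<in> borel_measurable borel"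
    using T(1) by (intro borel_measurable_continuous_onI linear_continuous_on) (simp add: linear_conv_bounded_linear)
  show thesis
  proof (rule that[OF c(1)])
    fix f :: "'b \<Rightarrow> ennreal" assume [measurable]: "f \<in> borel_measurable borel"
    have "(\<integral>\<^sup>+x. f (T x) \<partial>lborel) = (\<integral>\<^sup>+x. f x \<partial>distr lborel borel T)" by (simp add: nn_integral_distr)
    then show "(\<integral>\<^sup>+x. f (T x) \<partial>lborel) = ennreal c * (\<integral>\<^sup>+x. f x \<partial>lborel)"
      by (simp add: c(2) nn_integral_density nn_integral_cmult)
  next
    fix f :: "'b \<Rightarrow> complex" assume [measurable]: "f \<in> borel_measurable borel"
    have "(LINT x|lborel. f (T x)) = (LINT x|distr lborel borel T. f x)" by (subst integral_distr) auto
    also have "\<dots> = (LINT x|lborel. c *\<^sub>R f x)"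
      unfolding c(2) using c(1) by (subst integral_density) auto
    finally show "(LINT x|lborel. f (T x)) = c * (LINT x|lborel. f x)"
      by (simp add: scaleR_conv_of_real)
  qed
qed

text \<open>The bounded factor \<open>u\<close> disappears because only the modulus of the inner
  integral over \<open>y\<close> enters. Cauchy-Schwarz over the ball that carries this inner
  integral yields its square, which expands into an integral over two copies of
  \<open>y\<close>.\<close>

lemma cauchy_schwarz_doubling:
  fixes u :: "'x::euclidean_space \<Rightarrow> complex" and F :: "'x \<times> 'y::euclidean_space \<Rightarrow> complex"
  assumes um[measurable]: "u \<in> borel_measurable borel" and Fm: "F \<in> borel_measurable borel"
    and u: "\<And>x. cmod (u x) \<le> 1" and F: "\<And>z. cmod (F z) \<le> H" "\<And>z. norm z > R \<Longrightarrow> F z = 0"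
    and R: "R > 0"
  shows "(cmod (LINT z|lborel. u (fst z) * F z))\<^sup>2 \<le> measure lborel (cball (0::'x) R) *
    cmod (LINT z|lborel. F (fst z, fst (snd z)) * cnj (F (fst z, snd (snd z))))"
proof -
  let ?K = "cball (0::'x) R" and ?V = "measure lborel (cball (0::'x) R)"
  have V: "?V > 0" using R by (simp add: content_cball_pos)
  have H: "H \<ge> 0" using F(1)[of 0] norm_ge_zero order_trans by blast
  have F0: "F (x, y) = 0" if "norm x > R \<or> norm y > R" for x y
    using that norm_fst_le[of x y] norm_snd_le[of y x] by (intro F(2)) auto
  have Fm'[measurable]: "F \<in> borel_measurable (borel \<Otimes>\<^sub>M borel)" using Fm by (simp add: borel_prod)
  have [measurable]: "cnj \<in> borel_measurable borel"
    by (intro borel_measurable_continuous_onI continuous_intros)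
  have uF: "integrable (lborel \<Otimes>\<^sub>M lborel) (\<lambda>z. u (fst z) * F z)"
    unfolding lborel_prod
  proof (rule integrable_bounded_support[of _ H R])
    show "(\<lambda>z. u (fst z) * F z) \<in> borel_measurable borel" unfolding borel_prod[symmetric] by measurable
    show "cmod (u (fst z) * F z) \<le> H" for z
      using mult_mono[OF u[of "fst z"] F(1)[of z]] H by (simp add: norm_mult)
  qed (simp add: F)
  have Fx: "integrable lborel (\<lambda>y. F (x, y))" for x
    by (rule integrable_bounded_support[of _ H R]) (use F(1) F0 in auto)
  define g where "g x = (LINT y|lborel. F (x, y))" for x
  have [measurable]: "g \<in> borel_measurable borel" unfolding g_def by measurable
  have gb: "cmod (g x) \<le> H * measure lborel (cball (0::'y) R)" for x
  proof -
    have "cmod (g x) \<le> (LINT y|lborel. H * indicator (cball (0::'y) R) y)"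
      unfolding g_def
    proof (rule Bochner_Integration.integral_norm_bound_integral[OF Fx])
      show "integrable lborel (\<lambda>y. H * indicator (cball (0::'y) R) y)"
        by (intro integrable_mult_right integrable_real_indicator emeasure_compact_finite) auto
      show "cmod (F (x, y)) \<le> H * indicator (cball 0 R) y" for y
        using F(1) F0[of x y] by (auto simp: indicator_def)
    qed
    then show ?thesis by simp
  qed
  have g0: "g x = 0" if "norm x > R" for x unfolding g_def using F0[of x] that by simp
  have gi: "integrable lborel (\<lambda>x. cmod (g x))"
    by (rule integrable_bounded_support[of _ "H * measure lborel (cball (0::'y) R)" R]) (use gb g0 in auto)
  have gi2: "integrable lborel (\<lambda>x. (cmod (g x))\<^sup>2)"
    by (rule integrable_bounded_support[of _ "(H * measure lborel (cball (0::'y) R))\<^sup>2" R])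
      (use gb g0 in \<open>auto intro!: power_mono\<close>)
  \<comment> \<open>\<open>m\<close> is the mean of \<open>cmod (g x)\<close> over the ball; the
    Cauchy-Schwarz inequality is the nonnegativity of the variance.\<close>
  define m where "m = (LINT x|lborel. cmod (g x)) / ?V"
  have Ki: "integrable lborel (indicator ?K :: 'x \<Rightarrow> real)"
    by (intro integrable_real_indicator emeasure_compact_finite) auto
  have "0 \<le> (LINT x|lborel. indicator ?K x * (cmod (g x) - m)\<^sup>2)" by (intro integral_nonneg_AE) auto
  also have "\<dots> = (LINT x|lborel. (cmod (g x))\<^sup>2 - 2 * m * cmod (g x) + m\<^sup>2 * indicator ?K x)"
    using g0 by (intro Bochner_Integration.integral_cong) (auto simp: indicator_def power2_eq_square algebra_simps)
  also have "\<dots> = (LINT x|lborel. (cmod (g x))\<^sup>2) - 2 * m * (LINT x|lborel. cmod (g x)) + m\<^sup>2 * ?V"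
    using gi gi2 Ki by simp
  also have "\<dots> = (LINT x|lborel. (cmod (g x))\<^sup>2) - (LINT x|lborel. cmod (g x))\<^sup>2 / ?V"
    using V by (simp add: m_def power2_eq_square field_simps)
  finally have CS: "(LINT x|lborel. cmod (g x))\<^sup>2 \<le> ?V * (LINT x|lborel. (cmod (g x))\<^sup>2)"
    using V by (simp add: field_simps)
  have "(LINT z|lborel. u (fst z) * F z) = (LINT x|lborel. LINT y|lborel. u x * F (x, y))"
    using lborel_pair.integral_fst'[OF uF] by (simp add: lborel_prod)
  also have "\<dots> = (LINT x|lborel. u x * g x)" using Fx by (simp add: g_def)
  also have "cmod \<dots> \<le> (LINT x|lborel. cmod (g x))"
  proof (rule Bochner_Integration.integral_norm_bound_integral)
    show "integrable lborel (\<lambda>x. u x * g x)"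
      by (rule Bochner_Integration.integrable_bound[OF gi])
        (use u in \<open>auto simp: norm_mult intro!: mult_left_le_one_le\<close>)
  qed (use gi u in \<open>auto simp: norm_mult intro!: mult_left_le_one_le\<close>)
  finally have "(cmod (LINT z|lborel. u (fst z) * F z))\<^sup>2 \<le> (LINT x|lborel. cmod (g x))\<^sup>2"
    by (intro power_mono) auto
  also note CS
  also have "(LINT x|lborel. (cmod (g x))\<^sup>2) = cmod (LINT x|lborel. g x * cnj (g x))"
  proof -
    have "(LINT x|lborel. g x * cnj (g x)) = (LINT x|lborel. of_real ((cmod (g x))\<^sup>2))"
      by (simp only: complex_norm_square)
    also have "\<dots> = of_real (LINT x|lborel. (cmod (g x))\<^sup>2)" by (rule integral_complex_of_real)
    finally show ?thesis by (simp del: of_real_power)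
  qed
  also have "(LINT x|lborel. g x * cnj (g x)) = (LINT z|lborel. F (fst z, fst (snd z)) * cnj (F (fst z, snd (snd z))))"
  proof -
    let ?G = "\<lambda>z::'x \<times> 'y \<times> 'y. F (fst z, fst (snd z)) * cnj (F (fst z, snd (snd z)))"
    have Gm: "?G \<in> borel_measurable borel" unfolding borel_prod[symmetric] by measurable
    have Gi: "integrable (lborel \<Otimes>\<^sub>M lborel) ?G"
      unfolding lborel_prod
    proof (rule integrable_bounded_support[OF Gm, of "H * H" "R + (R + R)"])
      show "cmod (?G z) \<le> H * H" for z
        using mult_mono[OF F(1)[of "(fst z, fst (snd z))"] F(1)[of "(fst z, snd (snd z))"]] H by (simp add: norm_mult)
      fix z :: "'x \<times> 'y \<times> 'y" assume z: "norm z > R + (R + R)"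
      obtain x y y' where [simp]: "z = (x, y, y')" by (cases z)
      have "norm z \<le> norm x + (norm y + norm y')"
        using norm_Pair_le[of x "(y, y')"] norm_Pair_le[of y y'] by simp
      then have "norm x > R \<or> norm y > R \<or> norm y' > R" using z by linarith
      then show "?G z = 0" using F0[of x y] F0[of x y'] by auto
    qed
    have gg: "g x * cnj (g x) = (LINT v|lborel. F (x, fst v) * cnj (F (x, snd v)))" for x
    proof -
      have i: "integrable (lborel \<Otimes>\<^sub>M lborel) (\<lambda>v. F (x, fst v) * cnj (F (x, snd v)))"
        unfolding lborel_prod
      proof (rule integrable_bounded_support[of _ "H * H" "R + R"])
        show "(\<lambda>v. F (x, fst v) * cnj (F (x, snd v))) \<in> borel_measurable borel" unfolding borel_prod[symmetric] by measurable
        show "cmod (F (x, fst v) * cnj (F (x, snd v))) \<le> H * H" for v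
          using mult_mono[OF F(1)[of "(x, fst v)"] F(1)[of "(x, snd v)"]] H by (simp add: norm_mult)
        fix v :: "'y \<times> 'y" assume v: "norm v > R + R"
        have "norm v \<le> norm (fst v) + norm (snd v)" using norm_Pair_le[of "fst v" "snd v"] by simp
        then have "norm (fst v) > R \<or> norm (snd v) > R" using v by linarith
        then show "F (x, fst v) * cnj (F (x, snd v)) = 0" using F0[of x "fst v"] F0[of x "snd v"] by auto
      qed
      have "(LINT v|lborel. F (x, fst v) * cnj (F (x, snd v))) = (LINT y|lborel. LINT y'|lborel. F (x, y) * cnj (F (x, y')))"
        using lborel_pair.integral_fst'[OF i] by (simp add: lborel_prod)
      also have "\<dots> = (LINT y|lborel. F (x, y) * cnj (g x))"
        using Fx by (simp add: g_def)
      also have "\<dots> = g x * cnj (g x)" using Fx[of x] by (simp add: g_def)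
      finally show ?thesis by simp
    qed
    show ?thesis unfolding gg
      using lborel_pair.integral_fst'[OF Gi] by (simp add: lborel_prod)
  qed
  finally show ?thesis .
qed

section \<open>Bounded functions\<close>

text \<open>The class of amplitudes. It is stable under products and linear substitutions, which is
  how the fourfold amplitude after two doublings arises from \<open>\<eta>\<close>.\<close>

definition bdd_lip :: "real \<Rightarrow> real \<Rightarrow> ('a::metric_space \<Rightarrow> complex) \<Rightarrow> bool" where
  "bdd_lip H L f \<longleftrightarrow> 0 \<le> H \<and> 0 \<le> L \<and> (\<forall>z. cmod (f z) \<le> H) \<and> (\<forall>z z'. cmod (f z - f z') \<le> L * dist z z')"

lemma bdd_lip_mult:
  assumes "bdd_lip H1 L1 f" "bdd_lip H2 L2 g"
  shows "bdd_lip (H1 * H2) (H1 * L2 + L1 * H2) (\<lambda>z. f z * g z)"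
  unfolding bdd_lip_def
proof (intro conjI allI)
  note a = assms[unfolded bdd_lip_def]
  show "0 \<le> H1 * H2" "0 \<le> H1 * L2 + L1 * H2" using a by auto
  show "cmod (f z * g z) \<le> H1 * H2" for z unfolding norm_mult using a by (intro mult_mono) auto
  show "cmod (f z * g z - f z' * g z') \<le> (H1 * L2 + L1 * H2) * dist z z'" for z z'
  proof -
    have "f z * g z - f z' * g z' = f z * (g z - g z') + (f z - f z') * g z'" by (simp add: algebra_simps)
    also have "cmod \<dots> \<le> cmod (f z) * cmod (g z - g z') + cmod (f z - f z') * cmod (g z')"
      by (rule norm_triangle_le) (simp add: norm_mult)
    also have "\<dots> \<le> H1 * (L2 * dist z z') + (L1 * dist z z') * H2"
      using a by (intro add_mono mult_mono) auto
    finally show ?thesis by (simp add: algebra_simps)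
  qed
qed

lemma bdd_lip_compose_linear:
  fixes f :: "'b::euclidean_space \<Rightarrow> complex" and T :: "'a::euclidean_space \<Rightarrow> 'b"
  assumes f: "bdd_lip H L f" and T: "linear T"
  obtains L' where "bdd_lip H L' (\<lambda>z. f (T z))"
proof -
  obtain K where K: "K > 0" "\<And>z. norm (T z) \<le> norm z * K"
    using bounded_linear.pos_bounded T unfolding linear_conv_bounded_linear by blast
  note f' = f[unfolded bdd_lip_def]
  have "cmod (f (T z) - f (T z')) \<le> (L * K) * dist z z'" for z z'
  proof -
    have "cmod (f (T z) - f (T z')) \<le> L * dist (T z) (T z')" using f' by blast
    also have "\<dots> \<le> L * (dist z z' * K)"
      using K(2)[of "z - z'"] f' by (intro mult_left_mono) (auto simp: dist_norm linear_diff[OF T])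
    finally show ?thesis using f' by (simp add: mult_ac)
  qed
  then have "bdd_lip H (L * K) (\<lambda>z. f (T z))" using f' K(1) by (auto simp: bdd_lip_def)
  then show thesis by (rule that)
qed

lemma bdd_lip_cnj: "bdd_lip H L f \<Longrightarrow> bdd_lip H L (\<lambda>z. cnj (f z))"
  unfolding bdd_lip_def by (simp flip: complex_cnj_diff)

lemma bdd_lip_continuous: "bdd_lip H L f \<Longrightarrow> continuous_on UNIV f"
  by (rule lipschitz_on_continuous_on[of L]) (auto simp: bdd_lip_def lipschitz_on_def dist_norm)

text \<open>The phase left after two applications of the Cauchy-Schwarz inequality, at
  \<open>z = ((w, x), (x', x''))\<close>. After the first one the points \<open>(x, x' - w)\<close> and \<open>(x', x - w)\<close> are
  paired so that the functions of \<open>x\<close> and of \<open>x'\<close> separate for fixed \<open>w\<close>; this pairing, unlike third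
  differences along the three kernels, also sees skew-symmetric bilinear forms.\<close>

definition paired_phase :: "('a::real_vector \<times> 'a \<Rightarrow> real) \<Rightarrow> ('a \<times> 'a) \<times> ('a \<times> 'a) \<Rightarrow> real" where
  "paired_phase P z =
     P (snd (fst z), fst (snd z) - fst (fst z)) - P (fst (snd z), snd (fst z) - fst (fst z))
   - P (snd (fst z), snd (snd z) - fst (fst z)) + P (snd (snd z), snd (fst z) - fst (fst z))"

abbreviation phase_slope :: "('a::real_vector \<times> 'a \<Rightarrow> real) \<Rightarrow> 'a \<Rightarrow> ('a \<times> 'a) \<times> ('a \<times> 'a) \<Rightarrow> real" where
  "phase_slope P e \<equiv> ddir (paired_phase P) ((0, e), (0, 0))"

abbreviation trilinear_integral ::
    "('a::euclidean_space \<times> 'a \<Rightarrow> complex) \<Rightarrow> ('a \<times> 'a \<Rightarrow> real) \<Rightarrow> ('a \<Rightarrow> complex) \<Rightarrow> ('a \<Rightarrow> complex) \<Rightarrow> ('a \<Rightarrow> complex) \<Rightarrow> complex" where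
  "trilinear_integral \<eta> P f g h \<equiv>
     (LINT z|lborel. exp (\<i> * of_real (P z)) * (f (fst z) * g (snd z) * h (fst z + snd z)) * \<eta> z)"

lemma linear_pair_maps:
  "linear (\<lambda>z :: ('a::real_vector \<times> 'a) \<times> ('a \<times> 'a). (snd (fst z), fst (snd z) - fst (fst z)))"
  "linear (\<lambda>z :: ('a \<times> 'a) \<times> ('a \<times> 'a). (fst (snd z), snd (fst z) - fst (fst z)))"
  "linear (\<lambda>z :: ('a \<times> 'a) \<times> ('a \<times> 'a). (snd (fst z), snd (snd z) - fst (fst z)))"
  "linear (\<lambda>z :: ('a \<times> 'a) \<times> ('a \<times> 'a). (snd (snd z), snd (fst z) - fst (fst z)))"
  by (auto intro!: linearI simp: algebra_simps)

lemma line_poly_paired_phase: "line_poly d P \<Longrightarrow> line_poly d (paired_phase P)"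
  unfolding paired_phase_def[abs_def]
  by (intro line_poly_add line_poly_diff line_poly_compose_linear[OF _ linear_pair_maps(1)]
      line_poly_compose_linear[OF _ linear_pair_maps(2)] line_poly_compose_linear[OF _ linear_pair_maps(3)]
      line_poly_compose_linear[OF _ linear_pair_maps(4)])

lemma continuous_on_paired_phase:
  fixes P :: "'a::real_normed_vector \<times> 'a \<Rightarrow> real"
  assumes "continuous_on UNIV P"
  shows "continuous_on UNIV (paired_phase P)"
  unfolding paired_phase_def[abs_def]
  by (intro continuous_intros continuous_on_compose2[OF assms]) auto

lemma linear_change_of_variables_complex:
  fixes T :: "'a::euclidean_space \<Rightarrow> 'b::euclidean_space"
  assumes "linear T" "bij T"
  shows "\<exists>c>0. \<forall>f :: 'b \<Rightarrow> complex. f \<in> borel_measurable borel \<longrightarrow>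
    (LINT x|lborel. f (T x)) = of_real c * (LINT x|lborel. f x)"
  by (rule linear_change_of_variables[OF assms]) auto

text \<open>In the coordinates \<open>(x + y, x)\<close> the first Cauchy-Schwarz step removes
  \<open>h\<close> and doubles \<open>x\<close> into \<open>x\<close>, \<open>x'\<close>. At the
  common value \<open>t = x + y\<close> one sets \<open>w = x + x' - t\<close>: then
  \<open>t - x = x' - w\<close> and \<open>t - x' = x - w\<close>, so for fixed \<open>w\<close> the
  unknowns split into \<open>f x * cnj (g (x - w))\<close> and a function of \<open>x'\<close>. The
  second step removes the former, and what remains depends on \<open>w\<close>, \<open>x'\<close>,
  \<open>x''\<close> only.\<close>

lemma bounded_trilinear_decay:
  fixes \<eta> :: "'a::euclidean_space \<times> 'a \<Rightarrow> complex"
  assumes d: "d \<ge> 1" and eta: "bdd_lip H L \<eta>" "\<And>z. norm z > R \<Longrightarrow> \<eta> z = 0" and R: "R > 0"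
  shows "\<exists>C\<ge>0. \<forall>P (f :: 'a \<Rightarrow> complex) (g :: 'a \<Rightarrow> complex) (h :: 'a \<Rightarrow> complex) e M.
    line_poly d P \<longrightarrow> continuous_on UNIV P \<longrightarrow>
    f \<in> borel_measurable borel \<longrightarrow> g \<in> borel_measurable borel \<longrightarrow> h \<in> borel_measurable borel \<longrightarrow>
    (\<forall>x. cmod (f x) \<le> 1) \<longrightarrow> (\<forall>x. cmod (g x) \<le> 1) \<longrightarrow> (\<forall>x. cmod (h x) \<le> 1) \<longrightarrow> norm e \<le> 1 \<longrightarrow>
    1 \<le> M \<longrightarrow> (\<forall>z\<in>cball 0 1. \<bar>phase_slope P e z\<bar> \<le> M) \<longrightarrow>
    (\<exists>z\<in>cball 0 1. M / 2 \<le> \<bar>phase_slope P e z\<bar>) \<longrightarrow>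
    cmod (trilinear_integral \<eta> P f g h)
      \<le> C * M powr (- 1 / (24 * d))"
proof -
  have H: "H \<ge> 0" and etab: "\<And>z. cmod (\<eta> z) \<le> H" using eta(1) by (auto simp: bdd_lip_def)
  define T1 :: "'a \<times> 'a \<Rightarrow> 'a \<times> 'a" where "T1 z = (snd z, fst z - snd z)" for z
  \<comment> \<open>At \<open>((w, x), x')\<close> this gives \<open>(x + x' - w, (x, x'))\<close>;
    its first component is the value of \<open>x + y\<close> shared by both copies.\<close>
  define T2 :: "('a \<times> 'a) \<times> 'a \<Rightarrow> 'a \<times> ('a \<times> 'a)" where
    "T2 z = (snd (fst z) + snd z - fst (fst z), (snd (fst z), snd z))" for z
  have lin1: "linear T1" by (auto intro!: linearI simp: T1_def algebra_simps)
  have bij1: "bij T1"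
    by (rule bij_betw_byWitness[of _ "\<lambda>z. (fst z + snd z, fst z)"]) (auto simp: T1_def)
  obtain c1 :: real where c1: "c1 > 0"
      "\<And>f :: _ \<Rightarrow> complex. f \<in> borel_measurable borel \<Longrightarrow> (LINT x|lborel. f (T1 x)) = c1 * (LINT x|lborel. f x)"
    using linear_change_of_variables_complex[OF lin1 bij1] by blast
  have lin2: "linear T2" by (auto intro!: linearI simp: T2_def algebra_simps)
  have bij2: "bij T2"
    by (rule bij_betw_byWitness[of _ "\<lambda>z. ((fst (snd z) + snd (snd z) - fst z, fst (snd z)), snd (snd z))"])
      (auto simp: T2_def)
  obtain c2 :: real where c2: "c2 > 0"
      "\<And>f :: _ \<Rightarrow> complex. f \<in> borel_measurable borel \<Longrightarrow> (LINT x|lborel. f (T2 x)) = c2 * (LINT x|lborel. f x)"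
    using linear_change_of_variables_complex[OF lin2 bij2] by blast
  define a :: "('a \<times> 'a) \<times> ('a \<times> 'a) \<Rightarrow> complex" where
    "a z = \<eta> (snd (fst z), fst (snd z) - fst (fst z)) * cnj (\<eta> (fst (snd z), snd (fst z) - fst (fst z)))
      * (cnj (\<eta> (snd (fst z), snd (snd z) - fst (fst z))) * \<eta> (snd (snd z), snd (fst z) - fst (fst z)))" for z
  have "\<exists>L'. bdd_lip (H * H * (H * H)) L' a"
  proof -
    obtain L1 where l1: "bdd_lip H L1 (\<lambda>z :: ('a \<times> 'a) \<times> ('a \<times> 'a). \<eta> (snd (fst z), fst (snd z) - fst (fst z)))"
      by (rule bdd_lip_compose_linear[OF eta(1) linear_pair_maps(1)])
    obtain L2 where l2: "bdd_lip H L2 (\<lambda>z :: ('a \<times> 'a) \<times> ('a \<times> 'a). \<eta> (fst (snd z), snd (fst z) - fst (fst z)))"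
      by (rule bdd_lip_compose_linear[OF eta(1) linear_pair_maps(2)])
    obtain L3 where l3: "bdd_lip H L3 (\<lambda>z :: ('a \<times> 'a) \<times> ('a \<times> 'a). \<eta> (snd (fst z), snd (snd z) - fst (fst z)))"
      by (rule bdd_lip_compose_linear[OF eta(1) linear_pair_maps(3)])
    obtain L4 where l4: "bdd_lip H L4 (\<lambda>z :: ('a \<times> 'a) \<times> ('a \<times> 'a). \<eta> (snd (snd z), snd (fst z) - fst (fst z)))"
      by (rule bdd_lip_compose_linear[OF eta(1) linear_pair_maps(4)])
    show ?thesis unfolding a_def[abs_def]
      by (rule exI) (rule bdd_lip_mult[OF bdd_lip_mult[OF l1 bdd_lip_cnj[OF l2]]
          bdd_lip_mult[OF bdd_lip_cnj[OF l3] l4]])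
  qed
  then obtain L' where a: "bdd_lip (H * H * (H * H)) L' a" by blast
  have eta0: "\<eta> (x, y) = 0" if "norm x > R \<or> norm y > R" for x y
    using that norm_fst_le[of x y] norm_snd_le[of y x] by (intro eta(2)) auto
  have w_bound: "norm w \<le> 2 * R" if "norm x \<le> R" "norm (x - w) \<le> R" for w x :: 'a
  proof -
    have "norm w \<le> norm x + norm (x - w)" by (metis add_diff_cancel_left' diff_diff_eq2 norm_triangle_ineq4)
    then show ?thesis using that by simp
  qed
  \<comment> \<open>The points \<open>x\<close>, \<open>x'\<close>, \<open>x''\<close> have norm at
    most \<open>R\<close> and \<open>w\<close> at most \<open>2 * R\<close>, in total
    \<open>5 * R\<close>. The radii \<open>3 * R\<close> and \<open>4 * R\<close> used for the two
    doublings arise in the same way.\<close>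
  have a0: "a z = 0" if "norm z > 5 * R" for z
  proof (rule ccontr)
    assume "a z \<noteq> 0"
    obtain w x x' x'' where z: "z = ((w, x), (x', x''))"
      by (cases z, cases "fst z", cases "snd z") auto
    have n: "norm x \<le> R" "norm (x - w) \<le> R" "norm x' \<le> R" "norm x'' \<le> R"
      using \<open>a z \<noteq> 0\<close> eta0[of x "x' - w"] eta0[of x' "x - w"] eta0[of x'' "x - w"]
      by (auto simp: a_def z not_less[symmetric])
    have "norm z \<le> (norm w + norm x) + (norm x' + norm x'')"
      unfolding z by (intro order_trans[OF norm_Pair_le] add_mono norm_Pair_le)
    then show False using n w_bound[OF n(1,2)] that by simp
  qed
  obtain C3 where C3: "C3 \<ge> 0" "\<And>(Q :: ('a \<times> 'a) \<times> ('a \<times> 'a) \<Rightarrow> real) e a \<theta> M.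
    line_poly d Q \<Longrightarrow> continuous_on UNIV Q \<Longrightarrow> norm e \<le> 1 \<Longrightarrow>
    \<theta> \<in> borel_measurable borel \<Longrightarrow> (\<forall>z. cmod (\<theta> z) \<le> 1) \<Longrightarrow> (\<forall>z s. \<theta> (z + s *\<^sub>R e) = \<theta> z) \<Longrightarrow>
    (\<forall>z. cmod (a z) \<le> H * H * (H * H)) \<Longrightarrow> (\<forall>z z'. cmod (a z - a z') \<le> L' * dist z z') \<Longrightarrow> (\<forall>z. norm z > 5 * R \<longrightarrow> a z = 0) \<Longrightarrow>
    1 \<le> M \<Longrightarrow> (\<forall>z\<in>cball 0 1. \<bar>ddir Q e z\<bar> \<le> M) \<Longrightarrow> (\<exists>z\<in>cball 0 1. M / 2 \<le> \<bar>ddir Q e z\<bar>) \<Longrightarrow>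
    cmod (LINT z|lborel. exp (\<i> * of_real (Q z)) * a z * \<theta> z) \<le> C3 * M powr (- 1 / (6 * d))"
    using oscillatory_decay[OF d, of "H * H * (H * H)" "5 * R" L', where 'a = "('a \<times> 'a) \<times> ('a \<times> 'a)"] R a[unfolded bdd_lip_def]
    by auto
  define V1 where "V1 = measure lborel (cball (0::'a) (3 * R))"
  define V2 where "V2 = measure lborel (cball (0::'a \<times> 'a) (4 * R))"
  \<comment> \<open>Squaring the first Cauchy-Schwarz inequality and inserting the second bounds
    \<open>c1 ^ 4 * c2\<^sup>2\<close> times the fourth power of the integral by
    \<open>V1\<^sup>2 * V2\<close> times the modulus of the final oscillatory integral.\<close>
  define K where "K = (V1\<^sup>2 * V2 * C3) / (c1 ^ 4 * c2\<^sup>2)"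
  have V: "V1 \<ge> 0" "V2 \<ge> 0" by (auto simp: V1_def V2_def)
  have K0: "K \<ge> 0" unfolding K_def using V C3(1) c1(1) c2(1) by simp
  have etac: "continuous_on UNIV \<eta>" using eta(1) by (rule bdd_lip_continuous)
  have cnjm[measurable]: "cnj \<in> borel_measurable borel"
    by (intro borel_measurable_continuous_onI continuous_intros)
  have "cmod (trilinear_integral \<eta> P f g h)
      \<le> max 1 K * M powr (- 1 / (24 * d))"
    if P: "line_poly d P" "continuous_on UNIV P"
      and fm: "f \<in> borel_measurable borel" "g \<in> borel_measurable borel" "h \<in> borel_measurable borel"
      and fb: "\<forall>x. cmod (f x) \<le> 1" "\<forall>x. cmod (g x) \<le> 1" "\<forall>x. cmod (h x) \<le> 1" and e: "norm e \<le> 1"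
      and M: "1 \<le> M" "\<forall>z\<in>cball 0 1. \<bar>phase_slope P e z\<bar> \<le> M"
      and M2: "\<exists>z\<in>cball 0 1. M / 2 \<le> \<bar>phase_slope P e z\<bar>"
    for P and f g h :: "'a \<Rightarrow> complex" and e M
  proof -
    have comp: "(\<lambda>x. P (k x)) \<in> borel_measurable borel" "(\<lambda>x. \<eta> (k x)) \<in> borel_measurable borel"
      if "continuous_on UNIV k" for k :: "'b::euclidean_space \<Rightarrow> 'a \<times> 'a"
      using that P(2) etac by (auto intro!: borel_measurable_continuous_onI intro: continuous_on_compose2)
    have fcomp: "(\<lambda>x. f (k x)) \<in> borel_measurable borel" "(\<lambda>x. g (k x)) \<in> borel_measurable borel"
      "(\<lambda>x. h (k x)) \<in> borel_measurable borel" if "continuous_on UNIV k" for k :: "'b::euclidean_space \<Rightarrow> 'a"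
      using that fm by (auto intro: borel_measurable_compose_continuous)
    have ecomp: "(\<lambda>x. exp (\<i> * of_real (p x))) \<in> borel_measurable borel" if "p \<in> borel_measurable borel"
      for p :: "'b::euclidean_space \<Rightarrow> real" using that by measurable
    have ccomp: "(\<lambda>x. cnj (p x)) \<in> borel_measurable borel" if "p \<in> borel_measurable borel"
      for p :: "'b::euclidean_space \<Rightarrow> complex" using that by measurable
    note mrules = borel_measurable_times comp fcomp ecomp ccomp continuous_intros borel_measurable_diff borel_measurable_add
    define I where "I = trilinear_integral \<eta> P f g h"
    define F1 where "F1 z = exp (\<i> * of_real (P (snd z, fst z - snd z))) * f (snd z) * g (fst z - snd z) * \<eta> (snd z, fst z - snd z)"
      for z :: "'a \<times> 'a"
    define J1 where "J1 = (LINT z|lborel. F1 (fst z, fst (snd z)) * cnj (F1 (fst z, snd (snd z))))"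
    have F1m: "F1 \<in> borel_measurable borel" unfolding F1_def[abs_def] by (intro mrules)
    have F1b: "cmod (F1 z) \<le> H" for z
    proof -
      have "cmod (F1 z) = cmod (f (snd z)) * cmod (g (fst z - snd z)) * cmod (\<eta> (snd z, fst z - snd z))"
        by (simp add: F1_def norm_mult)
      also have "\<dots> \<le> 1 * 1 * H" using fb etab by (intro mult_mono) auto
      finally show ?thesis by simp
    qed
    have F10: "F1 z = 0" if "norm z > 3 * R" for z
    proof (rule ccontr)
      assume "F1 z \<noteq> 0"
      then have n: "norm (snd z) \<le> R" "norm (fst z - snd z) \<le> R"
        using eta0[of "snd z" "fst z - snd z"] by (auto simp: F1_def not_less[symmetric])
      have "norm (fst z) \<le> norm (snd z) + norm (fst z - snd z)" by (metis norm_triangle_sub)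
      moreover have "norm z \<le> norm (fst z) + norm (snd z)" using norm_Pair_le[of "fst z" "snd z"] by simp
      ultimately show False using n that by simp
    qed
    have "c1 * I = (LINT z|lborel. exp (\<i> * of_real (P (T1 z))) * (f (fst (T1 z)) * g (snd (T1 z)) * h (fst (T1 z) + snd (T1 z))) * \<eta> (T1 z))"
      unfolding I_def by (rule c1(2)[symmetric]) (intro mrules)
    also have "\<dots> = (LINT z|lborel. h (fst z) * F1 z)"
      by (intro Bochner_Integration.integral_cong) (auto simp: T1_def F1_def)
    finally have "c1 * cmod I = cmod (LINT z|lborel. h (fst z) * F1 z)" using c1(1)
      by (metis abs_of_pos norm_mult norm_of_real)
    then have step1: "(c1 * cmod I)\<^sup>2 \<le> V1 * cmod J1"
      using cauchy_schwarz_doubling[of h F1 H "3 * R"] fm(3) F1m fb(3) F1b F10 R unfolding V1_def J1_def by simp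
    define u where "u z = f (snd z) * cnj (g (snd z - fst z))" for z :: "'a \<times> 'a"
    define F2 where "F2 z = exp (\<i> * of_real (P (snd (fst z), snd z - fst (fst z)) - P (snd z, snd (fst z) - fst (fst z))))
        * cnj (f (snd z)) * g (snd z - fst (fst z)) * (\<eta> (snd (fst z), snd z - fst (fst z)) * cnj (\<eta> (snd z, snd (fst z) - fst (fst z))))"
      for z :: "('a \<times> 'a) \<times> 'a"
    define J2 where "J2 = (LINT z|lborel. F2 (fst z, fst (snd z)) * cnj (F2 (fst z, snd (snd z))))"
    have um: "u \<in> borel_measurable borel" unfolding u_def[abs_def] by (intro mrules)
    have F2m: "F2 \<in> borel_measurable borel" unfolding F2_def[abs_def] by (intro mrules)
    have ub: "cmod (u z) \<le> 1" for z
      using fb mult_mono[of "cmod (f (snd z))" 1 "cmod (g (snd z - fst z))" 1] by (simp add: u_def norm_mult)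
    have F2b: "cmod (F2 z) \<le> H * H" for z
    proof -
      have "cmod (F2 z) = cmod (f (snd z)) * cmod (g (snd z - fst (fst z))) *
        (cmod (\<eta> (snd (fst z), snd z - fst (fst z))) * cmod (\<eta> (snd z, snd (fst z) - fst (fst z))))"
        by (simp add: F2_def norm_mult del: of_real_diff)
      also have "\<dots> \<le> 1 * 1 * (H * H)" using fb etab H by (intro mult_mono) auto
      finally show ?thesis by simp
    qed
    have F20: "F2 z = 0" if "norm z > 4 * R" for z
    proof (rule ccontr)
      assume "F2 z \<noteq> 0"
      then have n: "norm (snd (fst z)) \<le> R" "norm (snd (fst z) - fst (fst z)) \<le> R" "norm (snd z) \<le> R"
        using eta0[of "snd (fst z)" "snd z - fst (fst z)"] eta0[of "snd z" "snd (fst z) - fst (fst z)"]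
        by (auto simp: F2_def not_less[symmetric])
      have "norm z \<le> norm (fst (fst z)) + norm (snd (fst z)) + norm (snd z)"
        using norm_Pair_le[of "fst z" "snd z"] norm_Pair_le[of "fst (fst z)" "snd (fst z)"] by simp
      then show False using n w_bound[OF n(1,2)] that by simp
    qed
    have "c2 * J1 = (LINT z|lborel. F1 (fst (T2 z), fst (snd (T2 z))) * cnj (F1 (fst (T2 z), snd (snd (T2 z)))))"
      unfolding J1_def
      by (rule c2(2)[symmetric])
        (intro borel_measurable_times ccomp borel_measurable_compose_continuous[OF F1m] continuous_intros)
    also have "\<dots> = (LINT z|lborel. u (fst z) * F2 z)"
      by (intro Bochner_Integration.integral_cong)
        (auto simp: T2_def F1_def F2_def u_def exp_cnj exp_diff exp_minus field_simps)
    finally have "c2 * cmod J1 = cmod (LINT z|lborel. u (fst z) * F2 z)" using c2(1)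
      by (metis abs_of_pos norm_mult norm_of_real)
    then have step2: "(c2 * cmod J1)\<^sup>2 \<le> V2 * cmod J2"
      using cauchy_schwarz_doubling[of u F2 "H * H" "4 * R"] um F2m ub F2b F20 R unfolding V2_def J2_def by simp
    define \<theta> where "\<theta> z = cnj (f (fst (snd z))) * g (fst (snd z) - fst (fst z)) * (f (snd (snd z)) * cnj (g (snd (snd z) - fst (fst z))))"
      for z :: "('a \<times> 'a) \<times> ('a \<times> 'a)"
    have "J2 = (LINT z|lborel. exp (\<i> * of_real (paired_phase P z)) * a z * \<theta> z)"
      unfolding J2_def
      by (intro Bochner_Integration.integral_cong)
        (auto simp: F2_def a_def \<theta>_def paired_phase_def exp_cnj exp_diff exp_add exp_minus algebra_simps divide_inverse)
    also have "cmod \<dots> \<le> C3 * M powr (- 1 / (6 * d))"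
    proof (rule C3(2)[OF line_poly_paired_phase[OF P(1)] continuous_on_paired_phase[OF P(2)], of "((0, e), (0, 0))"])
      show "norm ((0::'a, e), (0::'a, 0::'a)) \<le> 1" using e by (simp add: norm_Pair)
      show "\<theta> \<in> borel_measurable borel" unfolding \<theta>_def[abs_def] by (intro mrules)
      show "\<forall>z. cmod (\<theta> z) \<le> 1"
      proof
        fix z
        have "cmod (\<theta> z) \<le> (1 * 1) * (1 * 1)"
          unfolding \<theta>_def norm_mult complex_mod_cnj using fb by (intro mult_mono) auto
        then show "cmod (\<theta> z) \<le> 1" by simp
      qed
      show "\<forall>z s. \<theta> (z + s *\<^sub>R ((0, e), 0, 0)) = \<theta> z" by (simp add: \<theta>_def)
    qed (use a a0 M M2 in \<open>auto simp: bdd_lip_def\<close>)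
    finally have step3: "cmod J2 \<le> C3 * M powr (- 1 / (6 * d))" .
    define v where "v = M powr (- 1 / (24 * d))"
    have v4: "v ^ 4 = M powr (- 1 / (6 * d))"
      unfolding v_def using d M(1) by (simp add: powr_powr flip: powr_realpow)
    have "(c1 * cmod I) ^ 4 * c2\<^sup>2 \<le> (V1 * cmod J1)\<^sup>2 * c2\<^sup>2"
      using power_mono[OF step1, of 2] by (intro mult_right_mono) (auto simp flip: power_mult)
    also have "\<dots> = V1\<^sup>2 * (c2 * cmod J1)\<^sup>2" by (simp add: power_mult_distrib mult_ac)
    also have "\<dots> \<le> V1\<^sup>2 * (V2 * (C3 * v ^ 4))"
      unfolding v4 using step2 step3 V by (intro mult_left_mono order_trans[OF step2] mult_left_mono) auto
    finally have "cmod I ^ 4 \<le> K * v ^ 4"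
      unfolding K_def using c1(1) c2(1) by (simp add: field_simps power_mult_distrib)
    \<comment> \<open>Passing to \<open>max 1 K\<close>, which is at most its own fourth power,
      avoids a fourth root of \<open>K\<close>.\<close>
    also have "\<dots> \<le> (max 1 K) ^ 4 * v ^ 4"
    proof (rule mult_right_mono)
      have "K \<le> max 1 K ^ 1" by simp
      also have "\<dots> \<le> max 1 K ^ 4" by (rule power_increasing) auto
      finally show "K \<le> max 1 K ^ 4" .
    qed simp
    finally have "cmod I ^ 4 \<le> (max 1 K * v) ^ 4" by (simp add: power_mult_distrib)
    then have "cmod I \<le> max 1 K * v"
      by (rule power_le_imp_le_base[of _ 3, simplified]) (auto simp: v_def numeral_eq_Suc)
    then show ?thesis by (simp add: I_def v_def)
  qed
  then show ?thesis by (intro exI[of _ "max 1 K"]) auto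
qed

section \<open>Truncation\<close>

lemma nn_integral_lborel_translate:
  fixes f :: "'a::euclidean_space \<Rightarrow> ennreal"
  assumes [measurable]: "f \<in> borel_measurable borel"
  shows "(\<integral>\<^sup>+x. f (t + x) \<partial>lborel) = (\<integral>\<^sup>+x. f x \<partial>lborel)"
  using nn_integral_lborel_dilation[OF assms, of 1 t] by simp

lemma nn_integral_lborel_reflect:
  fixes f :: "'a::euclidean_space \<Rightarrow> ennreal"
  assumes [measurable]: "f \<in> borel_measurable borel"
  shows "(\<integral>\<^sup>+x. f (t - x) \<partial>lborel) = (\<integral>\<^sup>+x. f x \<partial>lborel)"
  by (subst (2) lborel_affine[of "-1" t]) (auto simp: nn_integral_density nn_integral_distr)

lemma nn_integral_mult_le_1:
  fixes f g :: "'a \<Rightarrow> ennreal"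
  assumes "f \<in> borel_measurable M" "g \<in> borel_measurable M"
    and "(\<integral>\<^sup>+x. (f x)\<^sup>2 \<partial>M) \<le> 1" "(\<integral>\<^sup>+x. (g x)\<^sup>2 \<partial>M) \<le> 1"
  shows "(\<integral>\<^sup>+x. f x * g x \<partial>M) \<le> 1"
proof -
  have "(\<integral>\<^sup>+x. f x * g x \<partial>M)\<^sup>2 \<le> (\<integral>\<^sup>+x. (f x)\<^sup>2 \<partial>M) * (\<integral>\<^sup>+x. (g x)\<^sup>2 \<partial>M)"
    by (rule Cauchy_Schwarz_nn_integral[OF assms(1,2)])
  also have "\<dots> \<le> 1 * 1" using assms(3,4) by (intro mult_mono) auto
  finally have le: "(\<integral>\<^sup>+x. f x * g x \<partial>M)\<^sup>2 \<le> 1" by simp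
  show ?thesis
  proof (rule ccontr)
    assume "\<not> ?thesis"
    then have gt: "1 < (\<integral>\<^sup>+x. f x * g x \<partial>M)" by simp
    have "1 * (\<integral>\<^sup>+x. f x * g x \<partial>M) \<le> (\<integral>\<^sup>+x. f x * g x \<partial>M) * (\<integral>\<^sup>+x. f x * g x \<partial>M)"
      using gt by (intro mult_right_mono) auto
    then show False using gt le by (auto simp: power2_eq_square)
  qed
qed

text \<open>One of the three functions may be measured in \<open>L\<^sup>1\<close> when the other two are measured in
  \<open>L\<^sup>2\<close>; in all three cases this is the Cauchy-Schwarz inequality for the inner integral.\<close>

lemma nn_trilinear_le_1:
  fixes u v w :: "'a::euclidean_space \<Rightarrow> ennreal"
  assumes [measurable]: "u \<in> borel_measurable borel" "v \<in> borel_measurable borel" "w \<in> borel_measurable borel"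
    and u: "(\<integral>\<^sup>+x. (u x)\<^sup>2 \<partial>lborel) \<le> 1" and v: "(\<integral>\<^sup>+x. (v x)\<^sup>2 \<partial>lborel) \<le> 1" and w: "(\<integral>\<^sup>+x. (w x)\<^sup>2 \<partial>lborel) \<le> 1"
  shows "(\<integral>\<^sup>+x. \<integral>\<^sup>+y. (u x)\<^sup>2 * (v y * w (x + y)) \<partial>lborel \<partial>lborel) \<le> 1" (is ?A)
    and "(\<integral>\<^sup>+x. \<integral>\<^sup>+y. u x * (v y)\<^sup>2 * w (x + y) \<partial>lborel \<partial>lborel) \<le> 1" (is ?B)
    and "(\<integral>\<^sup>+x. \<integral>\<^sup>+y. u x * v y * (w (x + y))\<^sup>2 \<partial>lborel \<partial>lborel) \<le> 1" (is ?C)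
proof -
  have inner: "(\<integral>\<^sup>+y. v y * w (x + y) \<partial>lborel) \<le> 1" for x
    using v w nn_integral_lborel_translate[of "\<lambda>y. (w y)\<^sup>2" x] by (intro nn_integral_mult_le_1) auto
  have "(\<integral>\<^sup>+x. \<integral>\<^sup>+y. (u x)\<^sup>2 * (v y * w (x + y)) \<partial>lborel \<partial>lborel) = (\<integral>\<^sup>+x. (u x)\<^sup>2 * (\<integral>\<^sup>+y. v y * w (x + y) \<partial>lborel) \<partial>lborel)"
    by (intro nn_integral_cong nn_integral_cmult) auto
  also have "\<dots> \<le> (\<integral>\<^sup>+x. (u x)\<^sup>2 * 1 \<partial>lborel)"
    by (intro nn_integral_mono mult_left_mono inner) auto
  finally show ?A using u by simp
  have inner': "(\<integral>\<^sup>+x. u x * w (y + x) \<partial>lborel) \<le> 1" for y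
    using u w nn_integral_lborel_translate[of "\<lambda>x. (w x)\<^sup>2" y] by (intro nn_integral_mult_le_1) auto
  have "(\<integral>\<^sup>+x. \<integral>\<^sup>+y. u x * (v y)\<^sup>2 * w (x + y) \<partial>lborel \<partial>lborel) = (\<integral>\<^sup>+y. \<integral>\<^sup>+x. u x * (v y)\<^sup>2 * w (x + y) \<partial>lborel \<partial>lborel)"
    by (subst lborel_pair.Fubini') auto
  also have "\<dots> = (\<integral>\<^sup>+y. \<integral>\<^sup>+x. (v y)\<^sup>2 * (u x * w (y + x)) \<partial>lborel \<partial>lborel)"
    by (simp add: ac_simps)
  also have "\<dots> = (\<integral>\<^sup>+y. (v y)\<^sup>2 * (\<integral>\<^sup>+x. u x * w (y + x) \<partial>lborel) \<partial>lborel)"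
    by (intro nn_integral_cong nn_integral_cmult) auto
  also have "\<dots> \<le> (\<integral>\<^sup>+y. (v y)\<^sup>2 * 1 \<partial>lborel)"
    by (intro nn_integral_mono mult_left_mono inner') auto
  finally show ?B using v by simp
  have inner'': "(\<integral>\<^sup>+x. u x * v (z - x) \<partial>lborel) \<le> 1" for z
    using u v nn_integral_lborel_reflect[of "\<lambda>x. (v x)\<^sup>2" z] by (intro nn_integral_mult_le_1) auto
  have "(\<integral>\<^sup>+x. \<integral>\<^sup>+y. u x * v y * (w (x + y))\<^sup>2 \<partial>lborel \<partial>lborel) = (\<integral>\<^sup>+x. \<integral>\<^sup>+z. u x * v (z - x) * (w z)\<^sup>2 \<partial>lborel \<partial>lborel)"
  proof (rule nn_integral_cong)
    fix x
    show "(\<integral>\<^sup>+y. u x * v y * (w (x + y))\<^sup>2 \<partial>lborel) = (\<integral>\<^sup>+z. u x * v (z - x) * (w z)\<^sup>2 \<partial>lborel)"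
      using nn_integral_lborel_translate[of "\<lambda>z. u x * v (z - x) * (w z)\<^sup>2" x] by simp
  qed
  also have "\<dots> = (\<integral>\<^sup>+z. \<integral>\<^sup>+x. u x * v (z - x) * (w z)\<^sup>2 \<partial>lborel \<partial>lborel)"
    by (subst lborel_pair.Fubini') auto
  also have "\<dots> = (\<integral>\<^sup>+z. (\<integral>\<^sup>+x. u x * v (z - x) \<partial>lborel) * (w z)\<^sup>2 \<partial>lborel)"
    by (intro nn_integral_cong nn_integral_multc) auto
  also have "\<dots> \<le> (\<integral>\<^sup>+z. 1 * (w z)\<^sup>2 \<partial>lborel)"
    by (intro nn_integral_mono mult_right_mono inner'') auto
  finally show ?C using w by simp
qed

abbreviation sq_integral :: "('a::euclidean_space \<Rightarrow> complex) \<Rightarrow> ennreal" where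
  "sq_integral f \<equiv> (\<integral>\<^sup>+x. ennreal ((cmod (f x))\<^sup>2) \<partial>lborel)"

text \<open>If all three values are at most \<open>lam\<close>, truncation changes nothing.
  Otherwise one of them satisfies \<open>cmod t \<le> (cmod t)\<^sup>2 / lam\<close>, and the
  product is at most \<open>1 / lam\<close> times the same product with that factor squared. A
  square of an \<open>L2\<close> function is an \<open>L1\<close> function, so
  \<open>nn_trilinear_le_1\<close> bounds each of the three possible errors.\<close>

lemma trilinear_truncation:
  fixes \<eta> W :: "'a::euclidean_space \<times> 'a \<Rightarrow> complex"
  assumes m: "\<eta> \<in> borel_measurable borel" "W \<in> borel_measurable borel"
    "f \<in> borel_measurable borel" "g \<in> borel_measurable borel" "h \<in> borel_measurable borel"
    and eta: "\<And>z. cmod (\<eta> z) \<le> H" "\<And>z. norm z > R \<Longrightarrow> \<eta> z = 0" and W: "\<And>z. cmod (W z) \<le> 1"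
    and L2: "sq_integral f \<le> 1" "sq_integral g \<le> 1"
      "sq_integral h \<le> 1"
    and lam: "lam > 0"
    and bd: "\<And>f g h :: 'a \<Rightarrow> complex. f \<in> borel_measurable borel \<Longrightarrow> g \<in> borel_measurable borel \<Longrightarrow> h \<in> borel_measurable borel \<Longrightarrow>
      (\<forall>x. cmod (f x) \<le> 1) \<Longrightarrow> (\<forall>x. cmod (g x) \<le> 1) \<Longrightarrow> (\<forall>x. cmod (h x) \<le> 1) \<Longrightarrow>
      cmod (LINT z|lborel. W z * (f (fst z) * g (snd z) * h (fst z + snd z)) * \<eta> z) \<le> B"
  shows "cmod (LINT z|lborel. W z * (f (fst z) * g (snd z) * h (fst z + snd z)) * \<eta> z) \<le> lam ^ 3 * B + 3 * H / lam"
proof -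
  have H: "H \<ge> 0" using eta(1)[of 0] norm_ge_zero order_trans by blast
  \<comment> \<open>Dividing by \<open>lam\<close> makes the truncated functions bounded by 1, so
    that \<open>bd\<close> applies; undoing it in three factors costs
    \<open>lam ^ 3\<close>.\<close>
  define lo where "lo f x = (if cmod (f x) \<le> lam then f x / lam else 0)" for f :: "'a \<Rightarrow> complex" and x
  have lom: "lo f \<in> borel_measurable borel" if [measurable]: "f \<in> borel_measurable borel" for f
    unfolding lo_def[abs_def] by measurable
  have lob: "\<forall>x. cmod (lo f x) \<le> 1" for f using lam by (auto simp: lo_def norm_divide)
  define X where "X z = W z * (f (fst z) * g (snd z) * h (fst z + snd z)) * \<eta> z" for z
  define Y where "Y z = W z * (lo f (fst z) * lo g (snd z) * lo h (fst z + snd z)) * \<eta> z" for z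
  note [measurable] = lom[OF m(3)] lom[OF m(4)] lom[OF m(5)] m(3-5)
  have [measurable]: "W \<in> borel_measurable (borel \<Otimes>\<^sub>M borel)" "\<eta> \<in> borel_measurable (borel \<Otimes>\<^sub>M borel)"
    using m(1,2) by (auto simp: borel_prod)
  have Xm: "X \<in> borel_measurable borel" and Ym: "Y \<in> borel_measurable borel"
    unfolding X_def[abs_def] Y_def[abs_def] borel_prod[symmetric] by measurable
  have Yi: "integrable lborel Y"
  proof (rule integrable_bounded_support[OF Ym, of "1 * (1 * 1 * 1) * H" R])
    show "cmod (Y z) \<le> 1 * (1 * 1 * 1) * H" for z
      unfolding Y_def norm_mult using W lob eta(1) by (intro mult_mono) auto
  qed (simp add: Y_def eta)
  let ?e = "\<lambda>z. (cmod (f (fst z)))\<^sup>2 * (cmod (g (snd z)) * cmod (h (fst z + snd z)))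
       + cmod (f (fst z)) * (cmod (g (snd z)))\<^sup>2 * cmod (h (fst z + snd z))
       + cmod (f (fst z)) * cmod (g (snd z)) * (cmod (h (fst z + snd z)))\<^sup>2"
  have err: "cmod (X z - lam ^ 3 * Y z) \<le> H / lam * ?e z" for z
  proof -
    define a b c where "a = f (fst z)" and "b = g (snd z)" and "c = h (fst z + snd z)"
    have e0: "0 \<le> (cmod a)\<^sup>2 * (cmod b * cmod c)" "0 \<le> cmod a * (cmod b)\<^sup>2 * cmod c" "0 \<le> cmod a * cmod b * (cmod c)\<^sup>2"
      by auto
    have sq: "cmod t \<le> (cmod t)\<^sup>2 / lam" if "\<not> cmod t \<le> lam" for t :: complex
    proof -
      have "cmod t * lam \<le> cmod t * cmod t" using that by (intro mult_left_mono) auto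
      then show ?thesis using lam by (simp add: field_simps power2_eq_square)
    qed
    have key: "cmod (a * b * c - lam ^ 3 * (lo f (fst z) * lo g (snd z) * lo h (fst z + snd z)))
       \<le> 1 / lam * ((cmod a)\<^sup>2 * (cmod b * cmod c) + cmod a * (cmod b)\<^sup>2 * cmod c + cmod a * cmod b * (cmod c)\<^sup>2)"
    proof (cases "cmod a \<le> lam \<and> cmod b \<le> lam \<and> cmod c \<le> lam")
      case True
      then have "lam ^ 3 * (lo f (fst z) * lo g (snd z) * lo h (fst z + snd z)) = a * b * c"
        using lam by (simp add: lo_def a_def b_def c_def power3_eq_cube)
      then show ?thesis using lam e0 by simp
    next
      case False
      then have z: "lo f (fst z) * lo g (snd z) * lo h (fst z + snd z) = 0"
        by (auto simp: lo_def a_def b_def c_def)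
      have "cmod (a * b * c) \<le> 1 / lam * ((cmod a)\<^sup>2 * (cmod b * cmod c)) \<or>
         cmod (a * b * c) \<le> 1 / lam * (cmod a * (cmod b)\<^sup>2 * cmod c) \<or>
         cmod (a * b * c) \<le> 1 / lam * (cmod a * cmod b * (cmod c)\<^sup>2)"
      proof -
        consider "\<not> cmod a \<le> lam" | "\<not> cmod b \<le> lam" | "\<not> cmod c \<le> lam" using False by blast
        then show ?thesis
        proof cases
          case 1
          from mult_right_mono[OF sq[OF 1], of "cmod b * cmod c"] show ?thesis by (simp add: norm_mult mult_ac)
        next
          case 2
          from mult_right_mono[OF sq[OF 2], of "cmod a * cmod c"] show ?thesis by (simp add: norm_mult mult_ac)
        next
          case 3
          from mult_right_mono[OF sq[OF 3], of "cmod a * cmod b"] show ?thesis by (simp add: norm_mult mult_ac)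
        qed
      qed
      moreover have "0 \<le> 1 / lam * ((cmod a)\<^sup>2 * (cmod b * cmod c))" "0 \<le> 1 / lam * (cmod a * (cmod b)\<^sup>2 * cmod c)"
         "0 \<le> 1 / lam * (cmod a * cmod b * (cmod c)\<^sup>2)" using lam by auto
      ultimately show ?thesis unfolding z distrib_left by auto
    qed
    have "X z - lam ^ 3 * Y z = W z * (a * b * c - lam ^ 3 * (lo f (fst z) * lo g (snd z) * lo h (fst z + snd z))) * \<eta> z"
      by (simp add: X_def Y_def a_def b_def c_def algebra_simps)
    also have "cmod \<dots> \<le> 1 * (1 / lam * ((cmod a)\<^sup>2 * (cmod b * cmod c) + cmod a * (cmod b)\<^sup>2 * cmod c + cmod a * cmod b * (cmod c)\<^sup>2)) * H"
      unfolding norm_mult[of _ "\<eta> z"] norm_mult[of "W z"] using W eta(1) key lam by (intro mult_mono) auto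
    finally show ?thesis by (simp add: a_def b_def c_def mult_ac)
  qed
  have e2: "ennreal (cmod t) ^ 2 = ennreal ((cmod t)\<^sup>2)" for t :: complex by (simp add: ennreal_power)
  have nn: "(\<integral>\<^sup>+z. ennreal (cmod (X z - lam ^ 3 * Y z)) \<partial>lborel) \<le> ennreal (3 * H / lam)"
  proof -
    let ?u = "\<lambda>x. ennreal (cmod (f x))" and ?v = "\<lambda>x. ennreal (cmod (g x))" and ?w = "\<lambda>x. ennreal (cmod (h x))"
    let ?E = "\<lambda>x y. (?u x)\<^sup>2 * (?v y * ?w (x + y)) + ?u x * (?v y)\<^sup>2 * ?w (x + y) + ?u x * ?v y * (?w (x + y))\<^sup>2"
    have eE: "ennreal (?e z) = ?E (fst z) (snd z)" for z
      by (simp add: e2 ennreal_mult)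
    have "(\<integral>\<^sup>+z. ennreal (cmod (X z - lam ^ 3 * Y z)) \<partial>lborel) \<le> (\<integral>\<^sup>+z. ennreal (H / lam) * ?E (fst z) (snd z) \<partial>lborel)"
    proof (rule nn_integral_mono)
      fix z
      have "ennreal (cmod (X z - lam ^ 3 * Y z)) \<le> ennreal (H / lam * ?e z)" using err by (rule ennreal_leI)
      also have "\<dots> = ennreal (H / lam) * ennreal (?e z)" using H lam by (intro ennreal_mult) auto
      finally show "ennreal (cmod (X z - lam ^ 3 * Y z)) \<le> ennreal (H / lam) * ?E (fst z) (snd z)"
        unfolding eE .
    qed
    also have "\<dots> = ennreal (H / lam) * (\<integral>\<^sup>+z. ?E (fst z) (snd z) \<partial>(lborel \<Otimes>\<^sub>M lborel))"
      unfolding lborel_prod[symmetric] by (rule nn_integral_cmult) measurable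
    also have "(\<integral>\<^sup>+z. ?E (fst z) (snd z) \<partial>(lborel \<Otimes>\<^sub>M lborel)) = (\<integral>\<^sup>+x. \<integral>\<^sup>+y. ?E x y \<partial>lborel \<partial>lborel)"
      by (subst lborel.nn_integral_fst[symmetric]) auto
    also have "\<dots> = (\<integral>\<^sup>+x. \<integral>\<^sup>+y. (?u x)\<^sup>2 * (?v y * ?w (x + y)) \<partial>lborel \<partial>lborel)
        + (\<integral>\<^sup>+x. \<integral>\<^sup>+y. ?u x * (?v y)\<^sup>2 * ?w (x + y) \<partial>lborel \<partial>lborel)
        + (\<integral>\<^sup>+x. \<integral>\<^sup>+y. ?u x * ?v y * (?w (x + y))\<^sup>2 \<partial>lborel \<partial>lborel)"
      by (simp add: nn_integral_add)
    also have "\<dots> \<le> 1 + 1 + 1"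
      by (intro add_mono nn_trilinear_le_1) (use L2 in \<open>auto simp: e2\<close>)
    also have "ennreal (H / lam) * (1 + 1 + 1) = ennreal (3 * H / lam)"
    proof -
      have three: "(1 + 1 + 1 :: ennreal) = ennreal 3" by simp
      show ?thesis unfolding three
        by (subst ennreal_mult[symmetric]) (use H lam in \<open>auto simp: mult.commute\<close>)
    qed
    finally show ?thesis by (simp add: mult_left_mono)
  qed
  \<comment> \<open>Integrability of the untruncated integrand is obtained here: the error is
    integrable by \<open>nn\<close>, and \<open>Y\<close> is bounded with bounded support.\<close>
  have Di: "integrable lborel (\<lambda>z. X z - lam ^ 3 * Y z)"
    unfolding integrable_iff_bounded using nn Xm Ym by (auto intro: le_less_trans)
  have "(LINT z|lborel. X z) = (LINT z|lborel. (X z - lam ^ 3 * Y z) + lam ^ 3 * Y z)" by simp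
  also have "\<dots> = (LINT z|lborel. X z - lam ^ 3 * Y z) + lam ^ 3 * (LINT z|lborel. Y z)"
    using Di Yi by (subst Bochner_Integration.integral_add) auto
  also have "cmod \<dots> \<le> 3 * H / lam + lam ^ 3 * B"
  proof (rule norm_triangle_le, rule add_mono)
    have "ennreal (cmod (LINT z|lborel. X z - lam ^ 3 * Y z)) \<le> ennreal (3 * H / lam)"
      using integral_norm_bound_ennreal[OF Di] nn by (rule order_trans)
    then show "cmod (LINT z|lborel. X z - lam ^ 3 * Y z) \<le> 3 * H / lam"
      using H lam by (subst (asm) ennreal_le_iff) auto
    have "cmod (LINT z|lborel. Y z) \<le> B" unfolding Y_def by (rule bd) (use lom m lob in auto)
    then show "cmod (complex_of_real (lam ^ 3) * (LINT z|lborel. Y z)) \<le> lam ^ 3 * B"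
      using lam by (simp add: norm_mult norm_power)
  qed
  finally show ?thesis by (simp add: X_def)
qed

section \<open>Degenerate polynomials\<close>

lemma line_poly_vanishing:
  fixes q :: "'a::real_normed_vector \<Rightarrow> real"
  assumes "line_poly d q" "\<forall>z\<in>cball 0 1. q z = 0"
  shows "q z = 0"
proof -
  obtain C where "\<forall>z\<in>cball 0 (norm z). \<bar>q z\<bar> \<le> C * 0"
    using line_poly_bound_extend[of d "norm z", where 'a = 'a] assms by (metis abs_zero order_refl)
  then show ?thesis by simp
qed

lemma line_poly_ddir_zero:
  assumes Q: "line_poly d Q" and z: "\<And>z. ddir Q e z = 0"
  shows "Q (z + s *\<^sub>R e) = Q z"
proof -
  obtain p where p: "degree p \<le> d" "\<And>s. Q (z + s *\<^sub>R e) = poly p s"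
    using Q unfolding line_poly_def by blast
  have "poly (pderiv p) = poly 0" using ddir_eq_poly[OF p(2)] z by auto
  then have "pderiv p = 0" by (simp only: poly_eq_poly_eq_iff)
  then have "degree p = 0" by (simp add: pderiv_eq_0_iff)
  then obtain c where "p = [:c:]" by (rule degree_eq_zeroE)
  then show ?thesis using p(2)[of s] p(2)[of 0] by simp
qed

text \<open>Vanishing slopes on the unit ball vanish everywhere, so the phase is constant along each
  basis direction; \<open>x\<close> is then moved to 0 one coordinate at a time.\<close>

lemma paired_phase_indep:
  fixes P :: "'a::euclidean_space \<times> 'a \<Rightarrow> real"
  assumes P: "line_poly d P"
    and z: "\<forall>b\<in>Basis. \<forall>z\<in>cball 0 1. phase_slope P b z = 0"
  shows "paired_phase P ((w, x), v) = paired_phase P ((w, y), v)"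
proof -
  have step: "paired_phase P (z + s *\<^sub>R ((0, b), (0, 0))) = paired_phase P z" if "b \<in> Basis" for b z s
    using that z line_poly_vanishing[OF line_poly_ddir[OF line_poly_paired_phase[OF P]]]
    by (intro line_poly_ddir_zero[OF line_poly_paired_phase[OF P]]) blast
  have sum: "paired_phase P ((w, (\<Sum>b\<in>B. c b *\<^sub>R b)), v) = paired_phase P ((w, 0), v)"
    if "B \<subseteq> Basis" for B c
    using finite_subset[OF that finite_Basis] that
  proof (induction B)
    case (insert b B)
    then show ?case
      using step[of b "((w, (\<Sum>b\<in>B. c b *\<^sub>R b)), v)" "c b"] by (cases v) (simp add: add.commute)
  qed simp
  have "paired_phase P ((w, x), v) = paired_phase P ((w, 0), v)" for x
    using sum[OF subset_refl, of "\<lambda>b. x \<bullet> b"] by (simp add: euclidean_representation)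
  then show ?thesis by metis
qed

lemma real_polynomial_function_compose_linear:
  fixes f :: "'a::euclidean_space \<Rightarrow> 'b::real_normed_vector"
  assumes "real_polynomial_function P" "linear f"
  shows "real_polynomial_function (\<lambda>x. P (f x))"
  using real_polynomial_function_compose[OF polynomial_function_bounded_linear assms(1)] assms(2)
  by (simp add: linear_conv_bounded_linear o_def)

lemma monomial_scale: "monomial \<alpha> (c *\<^sub>R x) = c ^ (\<Sum>i\<in>UNIV. \<alpha> i) * monomial \<alpha> x"
  by (simp add: monomial_def power_mult_distrib prod.distrib power_sum)

lemma monomial_affine:
  assumes "(\<Sum>i\<in>UNIV. \<alpha> i) \<le> 1"
  shows "monomial \<alpha> (x + y) = monomial \<alpha> x + monomial \<alpha> y - monomial \<alpha> 0"
proof (cases "\<forall>i. \<alpha> i = 0")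
  case True
  then show ?thesis by (simp add: monomial_def)
next
  case False
  then obtain i where i: "\<alpha> i \<noteq> 0" by blast
  have "(\<Sum>i\<in>UNIV. \<alpha> i) = \<alpha> i + (\<Sum>j\<in>UNIV - {i}. \<alpha> j)" by (rule sum.remove) auto
  moreover have "\<alpha> i \<ge> 1" using i by simp
  ultimately have "\<alpha> i = 1" "(\<Sum>j\<in>UNIV - {i}. \<alpha> j) = 0" using assms by linarith+
  then have a: "\<alpha> i = 1" "\<forall>j\<in>UNIV - {i}. \<alpha> j = 0" by auto
  have "monomial \<alpha> x = x $ i" for x
  proof -
    have "monomial \<alpha> x = (x $ i) ^ \<alpha> i * (\<Prod>j\<in>UNIV - {i}. (x $ j) ^ \<alpha> j)"
      unfolding monomial_def by (rule prod.remove) auto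
    also have "(\<Prod>j\<in>UNIV - {i}. (x $ j) ^ \<alpha> j) = 1" by (rule prod.neutral) (use a in auto)
    finally show ?thesis using a by simp
  qed
  then show ?thesis by simp
qed

text \<open>On each ray the doubling rule multiplies the \<open>i\<close>-th coefficient by
  \<open>2 ^ i - 2\<close> and gives 0, so only \<open>i = 1\<close> survives. A function that is
  homogeneous of degree one and differentiable at 0 equals its derivative there.\<close>

lemma homogeneous_degree_one_linear:
  fixes S :: "'a::euclidean_space \<Rightarrow> real"
  assumes S: "real_polynomial_function S" and two: "\<And>z. S (2 *\<^sub>R z) = 2 * S z"
  shows "linear S"
proof -
  have hom: "S (t *\<^sub>R z) = t * S z" for t z
  proof -
    have "real_polynomial_function (\<lambda>t. S (t *\<^sub>R z))"
      by (rule real_polynomial_function_compose_linear[OF S]) (auto intro!: linearI simp: scaleR_left_distrib)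
    then obtain a n where "(\<lambda>t. S (t *\<^sub>R z)) = (\<lambda>t. \<Sum>i\<le>n. a i * t ^ i)"
      unfolding real_polynomial_function_iff_sum by blast
    then have an: "S (t *\<^sub>R z) = (\<Sum>i\<le>n. a i * t ^ i)" for t by meson
    have "(\<Sum>i\<le>n. (a i * (2 ^ i - 2)) * t ^ i) = 0" for t
    proof -
      have "S ((2 * t) *\<^sub>R z) = 2 * S (t *\<^sub>R z)" using two[of "t *\<^sub>R z"] by simp
      then show ?thesis unfolding an
        by (simp add: power_mult_distrib sum_distrib_left algebra_simps sum_subtractf)
    qed
    then have "\<forall>i\<le>n. a i * (2 ^ i - 2) = 0" using polyfun_eq_0[where n = n and c = "\<lambda>i. a i * (2 ^ i - 2)"] by blast
    then have z0: "a i = 0" if "i \<le> n" "i \<noteq> 1" for i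
    proof -
      have "(2::real) ^ i \<noteq> 2 ^ 1" using that(2) by (subst power_inject_exp) auto
      then show ?thesis using \<open>\<forall>i\<le>n. a i * (2 ^ i - 2) = 0\<close> that by auto
    qed
    have "S (t *\<^sub>R z) = (\<Sum>i\<le>n. if i = 1 then a 1 * t else 0)" for t
      unfolding an by (rule sum.cong) (use z0 in auto)
    then have *: "S (t *\<^sub>R z) = (if 1 \<le> n then a 1 * t else 0)" for t by simp
    show ?thesis using *[of t] *[of 1] by (auto split: if_splits)
  qed
  have "S differentiable at 0"
    using differentiable_at_real_polynomial_function[OF S] by blast
  then obtain D where D: "(S has_derivative D) (at 0)" unfolding differentiable_def by blast
  have S0: "S 0 = 0" using two[of 0] by simp
  have "S z = D z" for z
  proof -
    have "((\<lambda>t::real. t *\<^sub>R z) has_derivative (\<lambda>t. t *\<^sub>R z)) (at 0)"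
      by (auto intro!: derivative_eq_intros)
    then have "((\<lambda>t. S (t *\<^sub>R z)) has_derivative (\<lambda>t. D (t *\<^sub>R z))) (at 0)"
      by (rule has_derivative_compose[of "\<lambda>t. t *\<^sub>R z"]) (use D in simp)
    moreover have "((\<lambda>t. S (t *\<^sub>R z)) has_derivative (\<lambda>t. t * S z)) (at 0)"
      unfolding hom by (auto intro!: derivative_eq_intros)
    ultimately have "(\<lambda>t. D (t *\<^sub>R z)) = (\<lambda>t. t * S z)" by (rule has_derivative_unique)
    from fun_cong[OF this, of 1] show ?thesis by simp
  qed
  then have "S = D" by blast
  then show ?thesis using has_derivative_linear[OF D] by simp
qed

text \<open>After normalising \<open>P\<close> to vanish on both axes, the hypothesis says that \<open>P\<close> is a symmetric
  2-cocycle. If \<open>P\<close> were the coboundary of \<open>p\<close>, then \<open>P (x, x) = p (2 x) - 2 p x\<close>, which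
  determines the coefficients of \<open>p\<close> in degrees at least 2. The difference \<open>S\<close> of \<open>P\<close> and that
  coboundary then satisfies \<open>S (2 z) = 2 S z\<close>, so it is linear, and it vanishes on the axes.\<close>

lemma paired_phase_indep_imp_degenerate:
  fixes P :: "(real ^ 'k::finite) \<times> (real ^ 'k) \<Rightarrow> real"
  assumes P: "real_polynomial_function P"
    and ind: "\<And>w x y v. paired_phase P ((w, x), v) = paired_phase P ((w, y), v)"
  shows "\<exists>p1 p2 p3. real_polynomial_function p1 \<and> real_polynomial_function p2 \<and> real_polynomial_function p3 \<and>
    (\<forall>x y. P (x, y) = p1 x + p2 y + p3 (x + y))"
proof -
  define R where "R x y = P (x, y) - P (x, 0) - P (0, y) + P (0, 0)" for x y
  have R0[simp]: "R x 0 = 0" "R 0 y = 0" for x y by (auto simp: R_def)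
  have ind': "R x (x' - w) - R x' (x - w) - R x (x'' - w) + R x'' (x - w) =
     R y (x' - w) - R x' (y - w) - R y (x'' - w) + R x'' (y - w)" for w x y x' x''
    using ind[of w x "(x', x'')" y] by (simp add: paired_phase_def R_def)
  \<comment> \<open>The instance \<open>x = s\<close>, \<open>x' = t\<close>, with \<open>w\<close>,
    \<open>x''\<close> and \<open>y\<close> all 0.\<close>
  have sym: "R s t = R t s" for s t using ind'[of s t 0 0 0] by simp
  \<comment> \<open>The instance \<open>x = u + s\<close>, \<open>x'' = u + t\<close>, with
    \<open>x'\<close>, \<open>w\<close> and \<open>y\<close> all equal to \<open>u\<close>, so that
    most arguments fall on an axis.\<close>
  have perm: "R (u + t) s - R u s = R (u + s) t - R u t" for u s t
    using ind'[of "u + s" u u "u + t" u] by simp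
  have coc: "R (u + s) t + R u s = R u (s + t) + R s t" for u s t
    using perm[of s t u] sym[of u s] sym[of "s + t" u] by (simp add: add.commute)
  \<comment> \<open>In cohomological terms: doubling both arguments of the cocycle equals twice the
    cocycle plus the coboundary of the diagonal \<open>R x x\<close>. The coboundary of
    \<open>p\<close> below obeys the same rule, so their difference simply doubles.\<close>
  have dbl: "R (2 *\<^sub>R x) (2 *\<^sub>R y) = R (x + y) (x + y) - R x x - R y y + 2 * R x y" for x y
  proof -
    have "R (2 *\<^sub>R x) (2 *\<^sub>R y) = R (2 *\<^sub>R x + y) y + R (2 *\<^sub>R x) y - R y y"
      using coc[of "2 *\<^sub>R x" y y] by (simp add: scaleR_2)
    moreover have "R (2 *\<^sub>R x) y + R x x = R x (x + y) + R x y"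
      using coc[of x x y] by (simp add: scaleR_2)
    moreover have "R (2 *\<^sub>R x + y) y + R (x + y) x = R (x + y) (x + y) + R x y"
      using coc[of "x + y" x y] by (simp add: scaleR_2 algebra_simps)
    moreover have "R (x + y) x = R x (x + y)" by (rule sym)
    ultimately show ?thesis by simp
  qed
  have rp: "real_polynomial_function (\<lambda>x. P (f x))" if "linear f" for f :: "'b::euclidean_space \<Rightarrow> _"
    by (rule real_polynomial_function_compose_linear[OF P that])
  have lin: "linear (\<lambda>x. (x, 0 :: real ^ 'k))" "linear (\<lambda>x. (0 :: real ^ 'k, x))"
    "linear (\<lambda>z. (fst z :: real ^ 'k, 0 :: real ^ 'k))" "linear (\<lambda>z. (0 :: real ^ 'k, snd z :: real ^ 'k))" "linear (\<lambda>x :: real ^ 'k. (x, x))"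
    by (auto intro!: linearI)
  have "real_polynomial_function (\<lambda>x. R x x)"
    unfolding R_def by (intro real_polynomial_function_diff real_polynomial_function.intros(2,3) rp lin)
  then obtain m c where c: "\<And>x. R x x = (\<Sum>\<alpha>\<in>multi_indices m. c \<alpha> * monomial \<alpha> x)"
    unfolding real_polynomial_function_iff_polys_upto polys_upto_def by (auto dest: fun_cong)
  define deg where "deg \<alpha> = (\<Sum>i\<in>UNIV. \<alpha> i)" for \<alpha> :: "'k \<Rightarrow> nat"
  \<comment> \<open>The equation \<open>p (2 *\<^sub>R x) - 2 * p x = R x x\<close> is solved
    monomial by monomial. Degree 1 is the obstruction, since \<open>2 ^ 1 - 2 = 0\<close>; degrees
    at most 1 are collected in \<open>l\<close>, which turns out to be additive and therefore has
    zero coboundary.\<close>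
  define p where "p x = (\<Sum>\<alpha>\<in>multi_indices m. (if deg \<alpha> \<le> 1 then 0 else c \<alpha> / (2 ^ deg \<alpha> - 2)) * monomial \<alpha> x)" for x
  define l where "l x = (\<Sum>\<alpha>\<in>multi_indices m. (if deg \<alpha> \<le> 1 then c \<alpha> else 0) * monomial \<alpha> x)" for x
  have pp: "real_polynomial_function p"
    unfolding real_polynomial_function_iff_polys_upto polys_upto_def p_def[abs_def]
    by (rule exI[of _ m], rule CollectI, rule exI, rule refl)
  have p2: "p (2 *\<^sub>R x) = 2 * p x + R x x - l x" for x
  proof -
    have "(if deg \<alpha> \<le> 1 then 0 else c \<alpha> / (2 ^ deg \<alpha> - 2)) * monomial \<alpha> (2 *\<^sub>R x) =
      2 * ((if deg \<alpha> \<le> 1 then 0 else c \<alpha> / (2 ^ deg \<alpha> - 2)) * monomial \<alpha> x) + c \<alpha> * monomial \<alpha> x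
       - (if deg \<alpha> \<le> 1 then c \<alpha> else 0) * monomial \<alpha> x" for \<alpha> :: "'k \<Rightarrow> nat"
    proof (cases "deg \<alpha> \<le> 1")
      case False
      then have "(2::real) ^ deg \<alpha> \<noteq> 2 ^ 1" by (subst power_inject_exp) auto
      then show ?thesis using False by (simp add: monomial_scale deg_def[symmetric] field_simps)
    qed simp
    then show ?thesis unfolding p_def l_def c by (simp add: sum_distrib_left sum.distrib sum_subtractf)
  qed
  have p0: "p 0 = 0"
    unfolding p_def
  proof (rule sum.neutral, rule ballI)
    fix \<alpha> :: "'k \<Rightarrow> nat"
    show "(if deg \<alpha> \<le> 1 then 0 else c \<alpha> / (2 ^ deg \<alpha> - 2)) * monomial \<alpha> 0 = 0"
      using monomial_scale[of \<alpha> 0 0] by (auto simp: deg_def[symmetric] power_0_left split: if_splits)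
  qed
  have l0: "l 0 = 0" using p2[of 0] p0 by simp
  have ladd: "l (x + y) = l x + l y" for x y
  proof -
    have "(if deg \<alpha> \<le> 1 then c \<alpha> else 0) * monomial \<alpha> (x + y) = (if deg \<alpha> \<le> 1 then c \<alpha> else 0) * monomial \<alpha> x
       + (if deg \<alpha> \<le> 1 then c \<alpha> else 0) * monomial \<alpha> y - (if deg \<alpha> \<le> 1 then c \<alpha> else 0) * monomial \<alpha> 0" for \<alpha> :: "'k \<Rightarrow> nat"
    proof (cases "deg \<alpha> \<le> 1")
      case True
      then have e: "monomial \<alpha> (x + y) = monomial \<alpha> x + monomial \<alpha> y - monomial \<alpha> 0"
        unfolding deg_def by (rule monomial_affine)
      show ?thesis unfolding e by (simp add: algebra_simps)
    qed simp
    then have "l (x + y) = l x + l y - l 0" unfolding l_def by (simp add: sum.distrib sum_subtractf)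
    then show ?thesis using l0 by simp
  qed
  define S where "S z = R (fst z) (snd z) - (p (fst z + snd z) - p (fst z) - p (snd z))" for z
  have Sp: "real_polynomial_function S"
  proof -
    have "real_polynomial_function (\<lambda>z :: (real ^ 'k) \<times> (real ^ 'k). p (fst z + snd z))"
      "real_polynomial_function (\<lambda>z :: (real ^ 'k) \<times> (real ^ 'k). p (fst z))"
      "real_polynomial_function (\<lambda>z :: (real ^ 'k) \<times> (real ^ 'k). p (snd z))"
      by (rule real_polynomial_function_compose_linear[OF pp]; auto intro!: linearI simp: algebra_simps)+
    moreover have "real_polynomial_function (\<lambda>z :: (real ^ 'k) \<times> (real ^ 'k). R (fst z) (snd z))"
      unfolding R_def prod.collapse
      by (intro real_polynomial_function_diff real_polynomial_function.intros(2,3) P rp lin)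
    ultimately show ?thesis unfolding S_def[abs_def]
      by (intro real_polynomial_function_diff)
  qed
  have S2: "S (2 *\<^sub>R z) = 2 * S z" for z
    using p2[of "fst z + snd z"] p2[of "fst z"] p2[of "snd z"] dbl[of "fst z" "snd z"] ladd[of "fst z" "snd z"]
    by (simp add: S_def scaleR_add_right)
  have "linear S" by (rule homogeneous_degree_one_linear[OF Sp S2])
  then have "S (x, y) = S (x, 0) + S (0, y)" for x y by (simp flip: linear_add)
  then have S0: "S (x, y) = 0" for x y by (simp add: S_def p0)
  show ?thesis
  proof (intro exI conjI allI)
    show "real_polynomial_function (\<lambda>x. P (x, 0) - p x)"
      by (intro real_polynomial_function_diff rp lin pp)
    show "real_polynomial_function (\<lambda>y. P (0, y) - P (0, 0) - p y)"
      by (intro real_polynomial_function_diff real_polynomial_function.intros(2) rp lin pp)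
    show "real_polynomial_function p" by (rule pp)
    show "P (x, y) = (P (x, 0) - p x) + (P (0, y) - P (0, 0) - p y) + p (x + y)" for x y
      using S0[of x y] by (simp add: S_def R_def)
  qed
qed

section \<open>The nondegenerate norm and coordinates\<close>

text \<open>Gaussian elimination: a vector \<open>c\<close> is split along one functional \<open>l _ \<theta>\<^sub>0\<close> that does not
  vanish identically.\<close>

lemma finite_functional_bound:
  fixes l :: "'i \<Rightarrow> 't \<Rightarrow> real" and N :: "('i \<Rightarrow> real) \<Rightarrow> real"
  assumes "finite S"
    and "\<And>c c'. N (\<lambda>i. c i + c' i) \<le> 2 * N c + 2 * N c'" and "\<And>t c. N (\<lambda>i. t * c i) = t\<^sup>2 * N c"
    and "\<And>i. i \<in> S \<Longrightarrow> \<exists>B. \<forall>\<theta>\<in>\<Theta>. \<bar>l i \<theta>\<bar> \<le> B"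
    and "\<And>c. \<forall>i. i \<notin> S \<longrightarrow> c i = 0 \<Longrightarrow> \<forall>\<theta>\<in>\<Theta>. (\<Sum>i\<in>S. c i * l i \<theta>) = 0 \<Longrightarrow> N c \<le> 0"
  shows "\<exists>C\<ge>0. \<forall>c M. (\<forall>i. i \<notin> S \<longrightarrow> c i = 0) \<longrightarrow> (\<forall>\<theta>\<in>\<Theta>. \<bar>\<Sum>i\<in>S. c i * l i \<theta>\<bar> \<le> M) \<longrightarrow> N c \<le> C * M\<^sup>2"
  using assms
proof (induction "card S" arbitrary: S l N rule: less_induct)
  case less
  note N_add = less.prems(2) and N_scale = less.prems(3) and bdd = less.prems(4) and ker = less.prems(5)
  show ?case
  proof (cases "\<forall>i\<in>S. \<forall>\<theta>\<in>\<Theta>. l i \<theta> = 0")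
    case True
    then have "N c \<le> 0" if "\<forall>i. i \<notin> S \<longrightarrow> c i = 0" for c using that by (intro ker) auto
    then show ?thesis by (intro exI[of _ 0]) auto
  next
    case False
    then obtain i0 \<theta>0 where i0: "i0 \<in> S" "\<theta>0 \<in> \<Theta>" "l i0 \<theta>0 \<noteq> 0" by blast
    define S' where "S' = S - {i0}"
    define r where "r i = l i \<theta>0 / l i0 \<theta>0" for i
    define l' where "l' i \<theta> = l i \<theta> - r i * l i0 \<theta>" for i \<theta>
    \<comment> \<open>\<open>E\<close> fills in the entry at \<open>i0\<close> so that the
      functional at \<open>\<theta>0\<close> vanishes. The induction runs with \<open>l'\<close> and
      with \<open>N\<close> composed with \<open>E\<close>, which is why it generalizes over
      both.\<close>
    define E where "E c j = (if j = i0 then - (\<Sum>i\<in>S'. c i * r i) else c j)" for c j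
    have fin: "finite S'" using less.prems(1) by (simp add: S'_def)
    have S_sum: "(\<Sum>i\<in>S. f i) = f i0 + (\<Sum>i\<in>S'. f i)" for f :: "'i \<Rightarrow> real"
      unfolding S'_def by (rule sum.remove[OF less.prems(1) i0(1)])
    have E_sum: "(\<Sum>i\<in>S. E c i * l i \<theta>) = (\<Sum>i\<in>S'. c i * l' i \<theta>)" for c \<theta>
    proof -
      have "(\<Sum>i\<in>S'. E c i * l i \<theta>) = (\<Sum>i\<in>S'. c i * l i \<theta>)"
        by (rule sum.cong) (auto simp: E_def S'_def)
      then show ?thesis unfolding S_sum
        by (simp add: E_def l'_def algebra_simps sum_subtractf sum_distrib_left)
    qed
    have E_add: "E (\<lambda>i. c i + c' i) = (\<lambda>i. E c i + E c' i)" for c c'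
      by (auto simp: E_def sum.distrib distrib_right)
    have E_scale: "E (\<lambda>i. t * c i) = (\<lambda>i. t * E c i)" for t c
      by (auto simp: E_def sum_distrib_left mult.assoc)
    have E_supp: "E c i = 0" if "\<forall>i. i \<notin> S' \<longrightarrow> c i = 0" "i \<notin> S" for c i
      using that i0(1) by (auto simp: E_def S'_def)
    obtain b where b: "\<And>i \<theta>. i \<in> S \<Longrightarrow> \<theta> \<in> \<Theta> \<Longrightarrow> \<bar>l i \<theta>\<bar> \<le> b i" using bdd by metis
    have "\<exists>C\<ge>0. \<forall>c M. (\<forall>i. i \<notin> S' \<longrightarrow> c i = 0) \<longrightarrow> (\<forall>\<theta>\<in>\<Theta>. \<bar>\<Sum>i\<in>S'. c i * l' i \<theta>\<bar> \<le> M) \<longrightarrow> N (E c) \<le> C * M\<^sup>2"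
    proof (rule less.hyps)
      show "card S' < card S" unfolding S'_def using less.prems(1) i0(1) by (rule card_Diff1_less)
      show "finite S'" by (rule fin)
      show "N (E (\<lambda>i. c i + c' i)) \<le> 2 * N (E c) + 2 * N (E c')" for c c' unfolding E_add by (rule N_add)
      show "N (E (\<lambda>i. t * c i)) = t\<^sup>2 * N (E c)" for t c unfolding E_scale by (rule N_scale)
      show "\<exists>B. \<forall>\<theta>\<in>\<Theta>. \<bar>l' i \<theta>\<bar> \<le> B" if "i \<in> S'" for i
      proof (intro exI ballI)
        fix \<theta> assume t: "\<theta> \<in> \<Theta>"
        have "\<bar>l' i \<theta>\<bar> \<le> \<bar>l i \<theta>\<bar> + \<bar>r i\<bar> * \<bar>l i0 \<theta>\<bar>"
          unfolding l'_def by (rule order_trans[OF abs_triangle_ineq4]) (simp add: abs_mult)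
        also have "\<dots> \<le> b i + \<bar>r i\<bar> * b i0"
          using that t i0(1) by (intro add_mono mult_left_mono b) (auto simp: S'_def)
        finally show "\<bar>l' i \<theta>\<bar> \<le> b i + \<bar>r i\<bar> * b i0" .
      qed
      show "N (E c) \<le> 0" if "\<forall>i. i \<notin> S' \<longrightarrow> c i = 0" "\<forall>\<theta>\<in>\<Theta>. (\<Sum>i\<in>S'. c i * l' i \<theta>) = 0" for c
        using E_supp[OF that(1)] that(2) by (intro ker) (auto simp: E_sum)
    qed
    then obtain C where C: "C \<ge> 0" "\<And>c M. (\<forall>i. i \<notin> S' \<longrightarrow> c i = 0) \<Longrightarrow>
      (\<forall>\<theta>\<in>\<Theta>. \<bar>\<Sum>i\<in>S'. c i * l' i \<theta>\<bar> \<le> M) \<Longrightarrow> N (E c) \<le> C * M\<^sup>2" by blast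
    define a where "a = \<bar>l i0 \<theta>0\<bar>"
    have a: "a > 0" using i0(3) by (simp add: a_def)
    define u where "u j = (if j = i0 then 1 else 0 :: real)" for j
    define D where "D = 2 * C * (1 + b i0 / a)\<^sup>2 + 2 * \<bar>N u\<bar> / a\<^sup>2"
    have "N c \<le> D * M\<^sup>2" if c: "\<forall>i. i \<notin> S \<longrightarrow> c i = 0" and M: "\<forall>\<theta>\<in>\<Theta>. \<bar>\<Sum>i\<in>S. c i * l i \<theta>\<bar> \<le> M" for c M
    proof -
      \<comment> \<open>\<open>k\<close> makes the functional at \<open>\<theta>0\<close> vanish on
        \<open>c - k u\<close>. Such a vector is determined by its entries in \<open>S'\<close>, so
        it equals \<open>E c'\<close>.\<close>
      define k where "k = (\<Sum>i\<in>S. c i * l i \<theta>0) / l i0 \<theta>0"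
      define c' where "c' j = (if j = i0 then 0 else c j)" for j
      have M0: "M \<ge> 0" using M i0(2) by force
      have ka: "\<bar>k\<bar> \<le> M / a"
        unfolding k_def abs_divide a_def[symmetric] using M i0(2) a by (intro divide_right_mono) auto
      have "(\<Sum>i\<in>S'. c' i * r i) = (\<Sum>i\<in>S'. c i * r i)"
        by (rule sum.cong) (auto simp: c'_def S'_def)
      moreover have "k = c i0 + (\<Sum>i\<in>S'. c i * r i)"
        unfolding k_def S_sum using i0(3) by (simp add: r_def add_divide_distrib sum_divide_distrib)
      ultimately have dec: "c = (\<lambda>i. E c' i + k * u i)"
        by (auto simp: E_def u_def c'_def)
      have lu: "(\<Sum>i\<in>S. u i * l i \<theta>) = l i0 \<theta>" for \<theta>
      proof -
        have "(\<Sum>i\<in>S'. u i * l i \<theta>) = 0" by (rule sum.neutral) (auto simp: u_def S'_def)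
        then show ?thesis unfolding S_sum by (simp add: u_def)
      qed
      have "N (E c') \<le> C * (M + M / a * b i0)\<^sup>2"
      proof (rule C(2))
        show "\<forall>i. i \<notin> S' \<longrightarrow> c' i = 0" using c by (auto simp: c'_def S'_def)
        show "\<forall>\<theta>\<in>\<Theta>. \<bar>\<Sum>i\<in>S'. c' i * l' i \<theta>\<bar> \<le> M + M / a * b i0"
        proof
          fix \<theta> assume t: "\<theta> \<in> \<Theta>"
          have "(\<Sum>i\<in>S. c i * l i \<theta>) = (\<Sum>i\<in>S. E c' i * l i \<theta>) + k * (\<Sum>i\<in>S. u i * l i \<theta>)"
            by (subst dec) (simp add: algebra_simps sum.distrib sum_distrib_left)
          then have "(\<Sum>i\<in>S'. c' i * l' i \<theta>) = (\<Sum>i\<in>S. c i * l i \<theta>) - k * l i0 \<theta>"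
            by (simp add: E_sum lu)
          also have "\<bar>\<dots>\<bar> \<le> \<bar>\<Sum>i\<in>S. c i * l i \<theta>\<bar> + \<bar>k\<bar> * \<bar>l i0 \<theta>\<bar>"
            by (rule order_trans[OF abs_triangle_ineq4]) (simp add: abs_mult)
          also have "\<dots> \<le> M + M / a * b i0"
            using M t ka b[OF i0(1) t] M0 a by (intro add_mono mult_mono) auto
          finally show "\<bar>\<Sum>i\<in>S'. c' i * l' i \<theta>\<bar> \<le> M + M / a * b i0" .
        qed
      qed
      also have "\<dots> = C * (1 + b i0 / a)\<^sup>2 * M\<^sup>2" by (simp add: power2_eq_square algebra_simps)
      finally have 1: "N (E c') \<le> C * (1 + b i0 / a)\<^sup>2 * M\<^sup>2" .
      have "k\<^sup>2 * N u \<le> (M / a)\<^sup>2 * \<bar>N u\<bar>"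
        using power_mono[OF ka, of 2]
        by (intro order_trans[OF mult_left_mono[OF abs_ge_self] mult_right_mono]) auto
      then have 2: "N (\<lambda>i. k * u i) \<le> \<bar>N u\<bar> / a\<^sup>2 * M\<^sup>2" by (simp add: N_scale power_divide mult_ac)
      have "N c \<le> 2 * N (E c') + 2 * N (\<lambda>i. k * u i)" by (subst dec) (rule N_add)
      moreover have "D * M\<^sup>2 = 2 * (C * (1 + b i0 / a)\<^sup>2 * M\<^sup>2) + 2 * (\<bar>N u\<bar> / a\<^sup>2 * M\<^sup>2)"
        by (simp add: D_def distrib_right)
      ultimately show ?thesis using 1 2 by linarith
    qed
    moreover have "D \<ge> 0" unfolding D_def using C(1) a by (intro add_nonneg_nonneg) auto
    ultimately show ?thesis by (intro exI[of _ D]) blast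
  qed
qed

lemma line_poly_power: "line_poly m Q \<Longrightarrow> line_poly (m * n) (\<lambda>z. Q z ^ n)"
proof (induction n)
  case (Suc n)
  then show ?case using line_poly_mult[of m Q "m * n" "\<lambda>z. Q z ^ n"] by simp
qed (use line_poly_const[of 0 1] in simp)

lemma line_poly_monomial: "\<alpha> \<in> multi_indices d \<Longrightarrow> line_poly d (monomial \<alpha>)"
proof -
  assume a: "\<alpha> \<in> multi_indices d"
  have "line_poly (\<Sum>i\<in>A. \<alpha> i) (\<lambda>x. \<Prod>i\<in>A. (x $ i) ^ \<alpha> i)" if "finite A" for A
    using that
  proof induction
    case (insert i A)
    have "linear (\<lambda>x :: real ^ 'a. x $ i)" by (auto intro!: linearI)
    from line_poly_mult[OF line_poly_power[OF line_poly_linear[OF this], of "\<alpha> i"] insert.IH]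
    show ?case using insert.hyps by simp
  qed (use line_poly_const[of 0 1] in simp)
  then have "line_poly (\<Sum>i\<in>UNIV. \<alpha> i) (monomial \<alpha>)" unfolding monomial_def[abs_def] by simp
  then show ?thesis by (rule line_poly_mono) (use a in \<open>simp add: multi_indices_def\<close>)
qed

lemma continuous_on_monomial: "continuous_on UNIV (monomial \<alpha>)"
  unfolding monomial_def[abs_def] by (intro continuous_intros)

text \<open>The interpolation formula has the same weights for all functions of degree
  \<open>d\<close>, so linearity reduces to exchanging two finite sums.\<close>

lemma ddir_sum:
  fixes Q :: "'i \<Rightarrow> 'v::real_vector \<Rightarrow> real"
  assumes "\<And>i. i \<in> I \<Longrightarrow> line_poly d (Q i)"
  shows "ddir (\<lambda>z. \<Sum>i\<in>I. c i * Q i z) e z = (\<Sum>i\<in>I. c i * ddir (Q i) e z)"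
proof -
  obtain l where l: "\<And>(Q :: 'v \<Rightarrow> real) e z. line_poly d Q \<Longrightarrow> ddir Q e z = (\<Sum>k\<le>d. l k * Q (z + (real k / Suc d) *\<^sub>R e))"
    using ddir_interpolation[where d = d and 'a = 'v] by blast
  have "ddir (\<lambda>z. \<Sum>i\<in>I. c i * Q i z) e z = (\<Sum>k\<le>d. l k * (\<Sum>i\<in>I. c i * Q i (z + (real k / Suc d) *\<^sub>R e)))"
    by (rule l) (intro line_poly_sum line_poly_cmult assms)
  also have "\<dots> = (\<Sum>i\<in>I. c i * (\<Sum>k\<le>d. l k * Q i (z + (real k / Suc d) *\<^sub>R e)))"
    unfolding sum_distrib_left by (subst sum.swap) (simp add: mult_ac)
  also have "\<dots> = (\<Sum>i\<in>I. c i * ddir (Q i) e z)"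
    by (rule sum.cong) (use l assms in auto)
  finally show ?thesis .
qed

lemma nd_class_degenerate:
  assumes "degenerate \<pi> P" shows "nd_class d \<pi> P = nd_class d \<pi> (\<lambda>_. 0)"
proof -
  obtain p where p: "\<forall>j\<in>{1..3}. real_polynomial_function (p j)" "P = (\<lambda>z. \<Sum>j=1..3. p j (\<pi> j z))"
    using assms unfolding degenerate_def by blast
  have "degenerate \<pi> (\<lambda>z. Q z - P z) \<longleftrightarrow> degenerate \<pi> (\<lambda>z. Q z - 0)" for Q
  proof
    assume "degenerate \<pi> (\<lambda>z. Q z - P z)"
    then obtain q where q: "\<forall>j\<in>{1..3}. real_polynomial_function (q j)" "(\<lambda>z. Q z - P z) = (\<lambda>z. \<Sum>j=1..3. q j (\<pi> j z))"
      unfolding degenerate_def by blast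
    have "Q z - 0 = (\<Sum>j=1..3. q j (\<pi> j z) + p j (\<pi> j z))" for z
      using fun_cong[OF q(2), of z] fun_cong[OF p(2), of z] by (simp add: sum.distrib)
    then show "degenerate \<pi> (\<lambda>z. Q z - 0)" unfolding degenerate_def using p(1) q(1)
      by (intro exI[of _ "\<lambda>j x. q j x + p j x"]) auto
  next
    assume "degenerate \<pi> (\<lambda>z. Q z - 0)"
    then obtain q where q: "\<forall>j\<in>{1..3}. real_polynomial_function (q j)" "(\<lambda>z. Q z - 0) = (\<lambda>z. \<Sum>j=1..3. q j (\<pi> j z))"
      unfolding degenerate_def by blast
    have "Q z - P z = (\<Sum>j=1..3. q j (\<pi> j z) - p j (\<pi> j z))" for z
      using fun_cong[OF q(2), of z] fun_cong[OF p(2), of z] by (simp add: sum_subtractf)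
    then show "degenerate \<pi> (\<lambda>z. Q z - P z)" unfolding degenerate_def using p(1) q(1)
      by (intro exI[of _ "\<lambda>j x. q j x - p j x"]) auto
  qed
  then show ?thesis unfolding nd_class_def by simp
qed

text \<open>These are the properties of the squared norm that \<open>finite_functional_bound\<close>
  asks of \<open>N\<close>; the first comes from expanding the nonnegative square of
  \<open>P - Q\<close>.\<close>

lemma nd_quadratic:
  assumes ip: "nd_inner_product d \<pi> ip" and P: "P \<in> polys_upto d" and Q: "Q \<in> polys_upto d"
  defines "N \<equiv> \<lambda>P. ip (nd_class d \<pi> P) (nd_class d \<pi> P)"
  shows "N (\<lambda>z. P z + Q z) \<le> 2 * N P + 2 * N Q" and "N (\<lambda>z. a * P z) = a\<^sup>2 * N P"
    and "0 \<le> N P" and "N (\<lambda>_. 0) = 0"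
proof -
  let ?c = "nd_class d \<pi>"
  have sym: "ip (?c P) (?c Q) = ip (?c Q) (?c P)" if "P \<in> polys_upto d" "Q \<in> polys_upto d" for P Q
    using ip that unfolding nd_inner_product_def by blast
  have add: "ip (?c (\<lambda>z. P z + Q z)) (?c R) = ip (?c P) (?c R) + ip (?c Q) (?c R)"
    if "P \<in> polys_upto d" "Q \<in> polys_upto d" "R \<in> polys_upto d" for P Q R
    using ip that unfolding nd_inner_product_def by blast
  have scale: "ip (?c (\<lambda>z. a * P z)) (?c Q) = a * ip (?c P) (?c Q)" if "P \<in> polys_upto d" "Q \<in> polys_upto d" for a P Q
    using ip that unfolding nd_inner_product_def by blast
  have pos: "0 \<le> N P" if "P \<in> polys_upto d" for P using ip that unfolding nd_inner_product_def N_def by blast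
  show "0 \<le> N P" by (rule pos[OF P])
  have sc: "N (\<lambda>z. a * P z) = a\<^sup>2 * N P" if P: "P \<in> polys_upto d" for a P
    using scale[OF P polys_upto_cmult[OF P], of a a] scale[OF P P, of a] sym[OF P polys_upto_cmult[OF P], of a]
    by (simp add: N_def power2_eq_square)
  then show "N (\<lambda>z. a * P z) = a\<^sup>2 * N P" using P .
  from sc[OF P, of 0] show "N (\<lambda>_. 0) = 0" by simp
  have exp: "N (\<lambda>z. P z + Q z) = N P + 2 * ip (?c P) (?c Q) + N Q" if P: "P \<in> polys_upto d" and Q: "Q \<in> polys_upto d" for P Q
    using add[OF P Q polys_upto_add[OF P Q]] add[OF P Q P] add[OF P Q Q] sym[OF P Q]
      sym[OF P polys_upto_add[OF P Q]] sym[OF Q polys_upto_add[OF P Q]]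
    by (simp add: N_def)
  have Q': "(\<lambda>z. - 1 * Q z) \<in> polys_upto d" by (rule polys_upto_cmult[OF Q])
  have "0 \<le> N (\<lambda>z. P z + - 1 * Q z)" by (intro pos polys_upto_add P Q')
  also have "\<dots> = N P + 2 * ip (?c P) (?c (\<lambda>z. - 1 * Q z)) + N (\<lambda>z. - 1 * Q z)" by (rule exp[OF P Q'])
  also have "\<dots> = N P - 2 * ip (?c P) (?c Q) + N Q"
    using sym[OF P Q'] scale[OF Q P, of "- 1"] sym[OF P Q] sc[OF Q, of "- 1"] by simp
  finally show "N (\<lambda>z. P z + Q z) \<le> 2 * N P + 2 * N Q" using exp[OF P Q] by simp
qed

section \<open>Coordinates adapted to three maps in general position\<close>

lemma linear_inv_bij:
  fixes f :: "'x::real_vector \<Rightarrow> 'y::real_vector"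
  assumes f: "linear f" "bij f"
  shows "linear (inv f)"
proof (rule linearI)
  note s = surj_f_inv_f[OF bij_is_surj[OF f(2)]] and i = inv_f_f[OF bij_is_inj[OF f(2)]]
  show "inv f (x + y) = inv f x + inv f y" for x y
    using i[of "inv f x + inv f y"] by (simp add: linear_add[OF f(1)] s)
  show "inv f (c *\<^sub>R x) = c *\<^sub>R inv f x" for c x
    using i[of "c *\<^sub>R inv f x"] by (simp add: linear_scale[OF f(1)] s)
qed

text \<open>Transversality makes each pair of the maps jointly surjective, and the dimension count
  makes it bijective. In the coordinates given by the first two maps the third is a sum
  \<open>a x + b y\<close>, which reparametrizing both variables turns into
  \<open>x + y\<close>.\<close>

lemma general_position_coordinates:
  fixes \<pi> :: "nat \<Rightarrow> real ^ 'n::finite \<Rightarrow> real ^ 'k::finite"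
  assumes card: "CARD('n) = 2 * CARD('k)"
    and pi: "\<forall>j\<in>{1..3}. linear (\<pi> j) \<and> surj (\<pi> j)" and gp: "general_position \<pi>"
  obtains T A B where "linear T" "bij T" "linear A" "bij A" "linear B" "bij B"
    "\<And>z. \<pi> 1 (T z) = A (fst z)" "\<And>z. \<pi> 2 (T z) = B (snd z)" "\<And>z. \<pi> 3 (T z) = fst z + snd z"
proof -
  have lin: "linear (\<pi> 1)" "linear (\<pi> 2)" "linear (\<pi> 3)" using pi by auto
  have pair: "bij (\<lambda>z. (\<pi> i z, \<pi> j z))" "linear (\<lambda>z. (\<pi> i z, \<pi> j z))"
    if ij: "i \<in> {1..3}" "j \<in> {1..3}" "i \<noteq> j" for i j
  proof -
    have l: "linear (\<pi> i)" "linear (\<pi> j)" and s: "surj (\<pi> i)" "surj (\<pi> j)" using pi ij by auto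
    show L: "linear (\<lambda>z. (\<pi> i z, \<pi> j z))"
      by (rule linearI) (auto simp: linear_add[OF l(1)] linear_add[OF l(2)] linear_scale[OF l(1)] linear_scale[OF l(2)])
    have surj: "surj (\<lambda>z. (\<pi> i z, \<pi> j z))"
    unfolding surj_def
    proof (rule allI)
      fix v :: "(real ^ 'k) \<times> (real ^ 'k)"
      obtain a b where v: "v = (a, b)" by (cases v)
      obtain z1 where z1: "\<pi> i z1 = a" using surjD[OF s(1), of a] by blast
      obtain z2 where z2: "\<pi> j z2 = b" using surjD[OF s(2), of b] by blast
      note z = z1 z2
      \<comment> \<open>The difference of the two preimages splits along the kernels, so
        \<open>z1 - p = z2 + q\<close> is a preimage for both maps at once.\<close>
      have "z1 - z2 \<in> {u + v | u v. \<pi> i u = 0 \<and> \<pi> j v = 0}"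
        using gp ij unfolding general_position_def by blast
      then obtain p q where pq: "z1 - z2 = p + q" "\<pi> i p = 0" "\<pi> j q = 0" by blast
      have "z1 - p = z2 + q" using pq(1) by (simp add: algebra_simps)
      then have "\<pi> j (z1 - p) = b" using z pq(3) by (simp add: linear_add[OF l(2)])
      moreover have "\<pi> i (z1 - p) = a" using z pq(2) by (simp add: linear_diff[OF l(1)])
      ultimately have "\<pi> i (z1 - p) = a \<and> \<pi> j (z1 - p) = b" by simp
      then show "\<exists>z. v = (\<pi> i z, \<pi> j z)" unfolding v by blast
    qed
    have "dim (UNIV :: ((real ^ 'k) \<times> (real ^ 'k)) set) = dim (UNIV :: (real ^ 'n) set)"
      using card by (simp add: dim_UNIV)
    then have "inj (\<lambda>z. (\<pi> i z, \<pi> j z))"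
      by (intro linear_surjective_imp_injective[OF L surj])
    then show "bij (\<lambda>z. (\<pi> i z, \<pi> j z))" using surj by (simp add: bij_def)
  qed
  have zero: "z = 0" if "\<pi> i z = 0" "\<pi> j z = 0" "i \<in> {1..3}" "j \<in> {1..3}" "i \<noteq> j" for i j z
  proof -
    have "(\<pi> i z, \<pi> j z) = (\<pi> i 0, \<pi> j 0)" using that pi by (auto simp: linear_0)
    then show ?thesis using bij_is_inj[OF pair(1)[OF that(3-5)]] by (meson injD)
  qed
  define X where "X = inv (\<lambda>z. (\<pi> 1 z, \<pi> 2 z))"
  have b12: "bij (\<lambda>z. (\<pi> 1 z, \<pi> 2 z))" "linear (\<lambda>z. (\<pi> 1 z, \<pi> 2 z))" using pair[of 1 2] by auto
  have X1: "(\<pi> 1 (X v), \<pi> 2 (X v)) = v" for v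
    unfolding X_def using surj_f_inv_f[OF bij_is_surj[OF b12(1)]] .
  have X2: "X (\<pi> 1 z, \<pi> 2 z) = z" for z
    unfolding X_def using inv_f_f[OF bij_is_inj[OF b12(1)]] .
  have Xl: "linear X" unfolding X_def using linear_inv_bij[OF b12(2,1)] .
  \<comment> \<open>\<open>a\<close> and \<open>b\<close> are injective because two of the three
    maps vanish together only at 0.\<close>
  define a where "a x = \<pi> 3 (X (x, 0))" for x
  define b where "b y = \<pi> 3 (X (0, y))" for y
  have lx: "linear (\<lambda>x. X (x, 0))" "linear (\<lambda>y. X (0, y))"
    by (rule linear_compose[of _ X, unfolded o_def]; (rule Xl | auto intro!: linearI))+
  have al: "linear a" and bl: "linear b"
    unfolding a_def[abs_def] b_def[abs_def]
    using linear_compose[OF lx(1) lin(3)] linear_compose[OF lx(2) lin(3)] by (simp_all add: o_def)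
  have "inj a"
  proof (subst linear_injective_0[OF al], intro allI impI)
    fix x assume "a x = 0"
    then have "X (x, 0) = 0" using X1[of "(x, 0)"] by (intro zero[of 3 _ 2]) (auto simp: a_def)
    then show "x = 0" using X1[of "(x, 0)"] linear_0[OF lin(1)] by simp
  qed
  then have ab: "bij a" using linear_injective_imp_surjective[OF al] by (simp add: bij_def)
  have "inj b"
  proof (subst linear_injective_0[OF bl], intro allI impI)
    fix y assume "b y = 0"
    then have "X (0, y) = 0" using X1[of "(0, y)"] by (intro zero[of 3 _ 1]) (auto simp: b_def)
    then show "y = 0" using X1[of "(0, y)"] linear_0[OF lin(2)] by simp
  qed
  then have bb: "bij b" using linear_injective_imp_surjective[OF bl] by (simp add: bij_def)
  define T where "T z = X (inv a (fst z), inv b (snd z))" for z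
  have ai: "linear (inv a)" "linear (inv b)" using linear_inv_bij al ab bl bb by auto
  show thesis
  proof (rule that[of T "inv a" "inv b"])
    show "linear T"
      unfolding T_def
      by (rule linear_compose[of _ X, unfolded o_def])
        (auto intro!: linearI Xl simp: linear_add[OF ai(1)] linear_add[OF ai(2)] linear_scale[OF ai(1)] linear_scale[OF ai(2)])
    show "bij T"
    proof (rule bij_betw_byWitness[of _ "\<lambda>z. (a (\<pi> 1 z), b (\<pi> 2 z))"])
      show "\<forall>z\<in>UNIV. (a (\<pi> 1 (T z)), b (\<pi> 2 (T z))) = z"
        using X1 surj_f_inv_f[OF bij_is_surj[OF ab]] surj_f_inv_f[OF bij_is_surj[OF bb]] by (auto simp: T_def)
      show "\<forall>z\<in>UNIV. T (a (\<pi> 1 z), b (\<pi> 2 z)) = z"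
        using X2 inv_f_f[OF bij_is_inj[OF ab]] inv_f_f[OF bij_is_inj[OF bb]] by (auto simp: T_def)
    qed auto
    show "linear (inv a)" "linear (inv b)" by (rule ai)+
    show "bij (inv a)" "bij (inv b)" using ab bb by (simp_all add: bij_imp_bij_inv)
    show "\<pi> 1 (T z) = inv a (fst z)" for z using X1[of "(inv a (fst z), inv b (snd z))"] by (simp add: T_def)
    show "\<pi> 2 (T z) = inv b (snd z)" for z using X1[of "(inv a (fst z), inv b (snd z))"] by (simp add: T_def)
    show "\<pi> 3 (T z) = fst z + snd z" for z
    proof -
      have "T z = X (inv a (fst z), 0) + X (0, inv b (snd z))"
        by (simp add: T_def flip: linear_add[OF Xl])
      then have "\<pi> 3 (T z) = a (inv a (fst z)) + b (inv b (snd z))"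
        by (simp add: linear_add[OF lin(3)] a_def b_def)
      then show ?thesis using surj_f_inv_f[OF bij_is_surj[OF ab]] surj_f_inv_f[OF bij_is_surj[OF bb]] by simp
    qed
  qed
qed

section \<open>The trilinear estimate\<close>

abbreviation slopes_le :: "('a::euclidean_space \<times> 'a \<Rightarrow> real) \<Rightarrow> real \<Rightarrow> bool" where
  "slopes_le P M \<equiv> \<forall>e\<in>Basis. \<forall>z\<in>cball 0 1. \<bar>phase_slope P e z\<bar> \<le> M"

text \<open>Stated only for \<open>1 \<le> M\<close>, since for smaller \<open>M\<close> the trivial
  bound by the size and support of the amplitude is enough.\<close>

abbreviation slope_attains :: "('a::euclidean_space \<times> 'a \<Rightarrow> real) \<Rightarrow> real \<Rightarrow> bool" where
  "slope_attains P M \<equiv> 1 \<le> M \<longrightarrow> (\<exists>e\<in>Basis. \<exists>z\<in>cball 0 1. M / 2 \<le> \<bar>phase_slope P e z\<bar>)"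

text \<open>The functions are divided by \<open>a\<close>, \<open>b\<close>, \<open>c\<close> to
  reduce to norms at most 1. These are arbitrary positive upper bounds rather than the norms
  themselves, because a norm may be zero.\<close>

lemma trilinear_L2_decay:
  fixes \<eta> :: "'a::euclidean_space \<times> 'a \<Rightarrow> complex"
  assumes d: "d \<ge> 1" and eta: "bdd_lip H L \<eta>" "\<And>z. norm z > R \<Longrightarrow> \<eta> z = 0" and R: "R > 0"
  shows "\<exists>C\<ge>0. \<forall>P (f :: 'a \<Rightarrow> complex) (g :: 'a \<Rightarrow> complex) (h :: 'a \<Rightarrow> complex) a b c M.
    line_poly d P \<longrightarrow> continuous_on UNIV P \<longrightarrow>
    f \<in> borel_measurable borel \<longrightarrow> g \<in> borel_measurable borel \<longrightarrow> h \<in> borel_measurable borel \<longrightarrow>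
    0 < a \<longrightarrow> 0 < b \<longrightarrow> 0 < c \<longrightarrow>
    sq_integral f \<le> ennreal (a\<^sup>2) \<longrightarrow>
    sq_integral g \<le> ennreal (b\<^sup>2) \<longrightarrow>
    sq_integral h \<le> ennreal (c\<^sup>2) \<longrightarrow>
    slopes_le P M \<longrightarrow>
    slope_attains P M \<longrightarrow>
    cmod (trilinear_integral \<eta> P f g h)
      \<le> C * max 1 M powr (- 1 / (96 * d)) * (a * b * c)"
proof -
  have H: "H \<ge> 0" and etab: "\<And>z. cmod (\<eta> z) \<le> H" using eta(1) by (auto simp: bdd_lip_def)
  have etam: "\<eta> \<in> borel_measurable borel"
    using bdd_lip_continuous[OF eta(1)] by (rule borel_measurable_continuous_onI)
  obtain C1 where C1: "C1 \<ge> 0" "\<And>P (f :: 'a \<Rightarrow> complex) (g :: 'a \<Rightarrow> complex) (h :: 'a \<Rightarrow> complex) e M.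
    line_poly d P \<Longrightarrow> continuous_on UNIV P \<Longrightarrow>
    f \<in> borel_measurable borel \<Longrightarrow> g \<in> borel_measurable borel \<Longrightarrow> h \<in> borel_measurable borel \<Longrightarrow>
    (\<forall>x. cmod (f x) \<le> 1) \<Longrightarrow> (\<forall>x. cmod (g x) \<le> 1) \<Longrightarrow> (\<forall>x. cmod (h x) \<le> 1) \<Longrightarrow> norm e \<le> 1 \<Longrightarrow>
    1 \<le> M \<Longrightarrow> (\<forall>z\<in>cball 0 1. \<bar>phase_slope P e z\<bar> \<le> M) \<Longrightarrow>
    (\<exists>z\<in>cball 0 1. M / 2 \<le> \<bar>phase_slope P e z\<bar>) \<Longrightarrow>
    cmod (trilinear_integral \<eta> P f g h)
      \<le> C1 * M powr (- 1 / (24 * d))"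
    using bounded_trilinear_decay[OF d eta R] by auto
  define V where "V = measure lborel (cball (0::'a \<times> 'a) R)"
  define C where "C = max C1 (H * V) + 3 * H"
  have C0: "C \<ge> 0" unfolding C_def using C1(1) H by auto
  have unit: "cmod (trilinear_integral \<eta> P f g h)
      \<le> C * max 1 M powr (- 1 / (96 * d))"
    if P: "line_poly d P" "continuous_on UNIV P"
      and fm: "f \<in> borel_measurable borel" "g \<in> borel_measurable borel" "h \<in> borel_measurable borel"
      and L2: "sq_integral f \<le> 1" "sq_integral g \<le> 1"
        "sq_integral h \<le> 1"
      and M: "slopes_le P M"
        "slope_attains P M"
    for P and f g h :: "'a \<Rightarrow> complex" and M
  proof -
    define m where "m = max 1 M"
    define W where "W z = exp (\<i> * of_real (P z))" for z
    have [measurable]: "P \<in> borel_measurable borel" using P(2) by (rule borel_measurable_continuous_onI)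
    have Wm: "W \<in> borel_measurable borel" unfolding W_def[abs_def] by measurable
    have Wb: "cmod (W z) \<le> 1" for z by (simp add: W_def)
    let ?J = "\<lambda>f g h :: 'a \<Rightarrow> complex. LINT z|lborel. W z * (f (fst z) * g (snd z) * h (fst z + snd z)) * \<eta> z"
    have bd: "cmod (?J f g h) \<le> max C1 (H * V) * m powr (- 1 / (24 * d))"
      if fm: "f \<in> borel_measurable borel" "g \<in> borel_measurable borel" "h \<in> borel_measurable borel"
        and fb: "\<forall>x. cmod (f x) \<le> 1" "\<forall>x. cmod (g x) \<le> 1" "\<forall>x. cmod (h x) \<le> 1" for f g h :: "'a \<Rightarrow> complex"
    proof (cases "1 \<le> M")
      case True
      then obtain e where e: "e \<in> Basis" "\<exists>z\<in>cball 0 1. M / 2 \<le> \<bar>phase_slope P e z\<bar>"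
        using M(2) by blast
      have "cmod (?J f g h) \<le> C1 * M powr (- 1 / (24 * d))"
        unfolding W_def by (rule C1(2)[OF P fm fb _ True _ e(2)]) (use e(1) M(1) in auto)
      also have "\<dots> \<le> max C1 (H * V) * m powr (- 1 / (24 * d))"
        using True by (intro mult_mono) (auto simp: m_def C1(1) le_max_iff_disj)
      finally show ?thesis .
    next
      case False
      have "cmod (?J f g h) \<le> (LINT z|lborel. H * indicator (cball (0::'a \<times> 'a) R) z)"
      proof (rule Bochner_Integration.integral_norm_bound_integral)
        let ?X = "\<lambda>z. W z * (f (fst z) * g (snd z) * h (fst z + snd z)) * \<eta> z"
        have b: "cmod (?X z) \<le> 1 * (1 * 1 * 1) * H" for z
          unfolding norm_mult using Wb fb etab by (intro mult_mono) auto
        show "integrable lborel ?X"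
        proof (rule integrable_bounded_support[of _ H R])
          show "?X \<in> borel_measurable borel"
            by (intro borel_measurable_times Wm etam borel_measurable_compose_continuous[OF fm(1)]
                borel_measurable_compose_continuous[OF fm(2)] borel_measurable_compose_continuous[OF fm(3)] continuous_intros)
          show "cmod (?X z) \<le> H" for z using b[of z] by simp
        qed (simp add: eta)
        show "integrable lborel (\<lambda>z :: 'a \<times> 'a. H * indicator (cball 0 R) z)"
          by (intro integrable_mult_right integrable_real_indicator emeasure_compact_finite) auto
        show "cmod (?X z) \<le> H * indicator (cball 0 R) z" for z
          using b[of z] eta(2)[of z] by (auto simp: indicator_def)
      qed
      also have "\<dots> = H * V" by (simp add: V_def)
      also have "\<dots> \<le> max C1 (H * V) * m powr (- 1 / (24 * d))" using False by (simp add: m_def)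
      finally show ?thesis .
    qed
    \<comment> \<open>This height balances \<open>lam ^ 3 * m powr (- 1 / (24 * d))\<close> against
      \<open>1 / lam\<close>.\<close>
    define lam where "lam = m powr (1 / (96 * d))"
    have m1: "m \<ge> 1" by (simp add: m_def)
    have lam: "lam > 0" using m1 by (simp add: lam_def)
    have "cmod (?J f g h)
       \<le> lam ^ 3 * (max C1 (H * V) * m powr (- 1 / (24 * d))) + 3 * H / lam"
      by (rule trilinear_truncation[OF etam Wm fm etab eta(2) Wb L2 lam bd])
    also have "lam ^ 3 * (max C1 (H * V) * m powr (- 1 / (24 * d))) = max C1 (H * V) * m powr (- 1 / (96 * d))"
    proof -
      have l3: "lam ^ 3 = m powr (3 / (96 * d))" unfolding lam_def using m1 by (simp add: powr_powr flip: powr_realpow)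
      have ex: "3 / real (96 * d) + - 1 / real (24 * d) = - 1 / real (96 * d)" using d by (simp add: field_simps)
      have "lam ^ 3 * (max C1 (H * V) * m powr (- 1 / (24 * d))) = max C1 (H * V) * (m powr (3 / (96 * d)) * m powr (- 1 / (24 * d)))"
        unfolding l3 by simp
      also have "m powr (3 / (96 * d)) * m powr (- 1 / (24 * d)) = m powr (- 1 / (96 * d))"
        unfolding ex[symmetric] by (rule powr_add[symmetric])
      finally show ?thesis .
    qed
    also have "3 * H / lam = 3 * H * m powr (- 1 / (96 * d))" by (simp add: lam_def powr_minus_divide)
    finally show ?thesis by (simp add: W_def C_def m_def distrib_right)
  qed
  have scale: "(\<integral>\<^sup>+x. ennreal ((cmod (f x / of_real a))\<^sup>2) \<partial>lborel) \<le> 1"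
    if [measurable]: "f \<in> borel_measurable borel" and a: "0 < a"
      and L2: "sq_integral f \<le> ennreal (a\<^sup>2)" for f :: "'a \<Rightarrow> complex" and a
  proof -
    have "(\<integral>\<^sup>+x. ennreal ((cmod (f x / of_real a))\<^sup>2) \<partial>lborel) = (\<integral>\<^sup>+x. ennreal (1 / a\<^sup>2) * ennreal ((cmod (f x))\<^sup>2) \<partial>lborel)"
      by (intro nn_integral_cong) (simp add: norm_divide power_divide flip: ennreal_mult)
    also have "\<dots> = ennreal (1 / a\<^sup>2) * sq_integral f" by (rule nn_integral_cmult) measurable
    also have "\<dots> \<le> ennreal (1 / a\<^sup>2) * ennreal (a\<^sup>2)" using L2 by (intro mult_left_mono) auto
    also have "\<dots> = 1" using a by (simp flip: ennreal_mult)
    finally show ?thesis .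
  qed
  have "cmod (trilinear_integral \<eta> P f g h)
      \<le> C * max 1 M powr (- 1 / (96 * d)) * (a * b * c)"
    if P: "line_poly d P" "continuous_on UNIV P"
      and fm[measurable]: "f \<in> borel_measurable borel" "g \<in> borel_measurable borel" "h \<in> borel_measurable borel"
      and pos: "0 < a" "0 < b" "0 < c"
      and L2: "sq_integral f \<le> ennreal (a\<^sup>2)" "sq_integral g \<le> ennreal (b\<^sup>2)"
        "sq_integral h \<le> ennreal (c\<^sup>2)"
      and M: "slopes_le P M"
        "slope_attains P M"
    for P and f g h :: "'a \<Rightarrow> complex" and a b c M
  proof -
    let ?I = "trilinear_integral \<eta> P f g h"
    have "cmod (LINT z|lborel. exp (\<i> * of_real (P z)) * (f (fst z) / of_real a * (g (snd z) / of_real b) * (h (fst z + snd z) / of_real c)) * \<eta> z)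
      \<le> C * max 1 M powr (- 1 / (96 * d))"
      by (rule unit[OF P _ _ _ scale[OF fm(1) pos(1) L2(1)] scale[OF fm(2) pos(2) L2(2)] scale[OF fm(3) pos(3) L2(3)] M]) measurable
    also have "(LINT z|lborel. exp (\<i> * of_real (P z)) * (f (fst z) / of_real a * (g (snd z) / of_real b) * (h (fst z + snd z) / of_real c)) * \<eta> z)
       = (LINT z|lborel. exp (\<i> * of_real (P z)) * (f (fst z) * g (snd z) * h (fst z + snd z)) * \<eta> z / of_real (a * b * c))"
      by (rule Bochner_Integration.integral_cong) auto
    also have "\<dots> = ?I / of_real (a * b * c)" by (rule integral_divide_zero)
    finally have "cmod ?I / (a * b * c) \<le> C * max 1 M powr (- 1 / (96 * d))"
      using pos by (simp add: norm_divide norm_mult)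
    then show ?thesis using pos by (simp add: divide_le_eq)
  qed
  then show ?thesis using C0 by (intro exI[of _ C]) auto
qed

section \<open>Null sets, Borel representatives and the regularity of the amplitude\<close>

text \<open>The integral over \<open>z\<close> of the indicator of \<open>N\<close> at
  \<open>p z + x\<close> is independent of \<open>x\<close>, because a shift by \<open>x\<close>
  lifts to a translation of \<open>z\<close>. Averaging over \<open>x\<close> in a ball and
  exchanging the integrals shows that it is 0. Changing a function on a null set thus changes its
  composition with \<open>p\<close> on a null set only.\<close>

lemma AE_lborel_linear_surj:
  fixes p :: "'m::euclidean_space \<Rightarrow> 'k::euclidean_space"
  assumes p: "linear p" "surj p" and ae: "AE x in lborel. Q x"
  shows "AE z in lborel. Q (p z)"
proof -
  from ae obtain N where N: "{x \<in> space lborel. \<not> Q x} \<subseteq> N" "emeasure lborel N = 0" "N \<in> sets lborel"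
    by (rule AE_E)
  have [measurable]: "N \<in> sets borel" and N0: "emeasure lborel N = 0" using N by auto
  have [measurable]: "p \<in> borel_measurable borel"
    using p(1) by (intro borel_measurable_continuous_onI linear_continuous_on) (simp add: linear_conv_bounded_linear)
  define X :: "'k set" where "X = cball 0 1"
  have Xm[measurable]: "X \<in> sets borel" by (simp add: X_def)
  have X: "emeasure lborel X \<noteq> 0"
    using content_cball_pos[of 1 "0 :: 'k"] by (auto simp: X_def measure_def)
  let ?I = "\<integral>\<^sup>+z. indicator N (p z) \<partial>(lborel :: 'm measure)"
  have inv: "(\<integral>\<^sup>+z. indicator N (p z + x) \<partial>(lborel :: 'm measure)) = ?I" for x
  proof -
    obtain w where w: "p w = x" using surjD[OF p(2), of x] by metis
    show ?thesis using nn_integral_lborel_translate[of "\<lambda>z. indicator N (p z)" w]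
      by (simp add: linear_add[OF p(1)] w add.commute)
  qed
  have "?I * emeasure lborel X = (\<integral>\<^sup>+x. ?I * indicator X x \<partial>lborel)"
    by (simp add: nn_integral_cmult_indicator)
  also have "\<dots> = (\<integral>\<^sup>+x. \<integral>\<^sup>+z. indicator N (p z + x) * indicator X x \<partial>(lborel :: 'm measure) \<partial>lborel)"
    by (intro nn_integral_cong) (simp add: nn_integral_multc inv)
  also have "\<dots> = (\<integral>\<^sup>+z. \<integral>\<^sup>+x. indicator N (p z + x) * indicator X x \<partial>lborel \<partial>(lborel :: 'm measure))"
    by (subst lborel_pair.Fubini') auto
  also have "\<dots> \<le> (\<integral>\<^sup>+z. \<integral>\<^sup>+x. indicator N (p z + x) \<partial>lborel \<partial>(lborel :: 'm measure))"
    by (intro nn_integral_mono) (auto simp: indicator_def)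
  also have "\<dots> = 0"
  proof -
    have "(\<integral>\<^sup>+x. indicator N (p z + x) \<partial>lborel) = 0" for z
      using nn_integral_lborel_translate[of "indicator N" "p z"] N0 by simp
    then show ?thesis by simp
  qed
  finally have "?I = 0" using X by simp
  then have "AE z in lborel. indicator N (p z) = (0 :: ennreal)" by (subst (asm) nn_integral_0_iff_AE) auto
  then show ?thesis by (rule AE_mp) (use N(1) in \<open>auto simp: indicator_def\<close>)
qed

lemma lebesgue_measurable_complex_ex_borel:
  fixes f :: "'a::euclidean_space \<Rightarrow> complex"
  assumes [measurable]: "f \<in> borel_measurable lebesgue"
  obtains g where "g \<in> borel_measurable borel" "AE x in lborel. f x = g x"
proof -
  have "(\<lambda>x. Re (f x)) \<in> borel_measurable lebesgue" "(\<lambda>x. Im (f x)) \<in> borel_measurable lebesgue"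
    by measurable
  from this[THEN completion_ex_borel_measurable_real]
  obtain u v where u: "u \<in> borel_measurable lborel" "AE x in lborel. Re (f x) = u x"
    and v: "v \<in> borel_measurable lborel" "AE x in lborel. Im (f x) = v x" by blast
  show thesis
  proof (rule that)
    show "(\<lambda>x. of_real (u x) + \<i> * of_real (v x)) \<in> borel_measurable borel" using u(1) v(1) by simp
    show "AE x in lborel. f x = of_real (u x) + \<i> * of_real (v x)"
      using u(2) v(2) by eventually_elim (simp add: complex_eq_iff)
  qed
qed

text \<open>The mean value theorem applies on the convex ball of radius \<open>R + 1\<close>. A
  point outside it has distance at least 1 from the ball of radius \<open>R\<close>, and there the
  sup bound serves as a Lipschitz bound.\<close>

lemma C1_compact_support_bdd_lip:
  fixes \<eta> :: "'a::euclidean_space \<Rightarrow> complex"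
  assumes "C1_compact_support \<eta>"
  obtains H L R where "bdd_lip H L \<eta>" "R > 0" "\<And>z. norm z > R \<Longrightarrow> \<eta> z = 0"
proof -
  obtain \<eta>' :: "'a \<Rightarrow> 'a \<Rightarrow>\<^sub>L complex" where cs: "compact (closure {z. \<eta> z \<noteq> 0})"
    and der: "\<And>z. (\<eta> has_derivative blinfun_apply (\<eta>' z)) (at z)" and cont: "continuous_on UNIV \<eta>'"
    using assms unfolding C1_compact_support_def by blast
  obtain R where R: "R > 0" "\<And>z. z \<in> closure {z. \<eta> z \<noteq> 0} \<Longrightarrow> norm z \<le> R"
    using compact_imp_bounded[OF cs] bounded_pos by blast
  have supp: "\<eta> z = 0" if "norm z > R" for z
  proof (rule ccontr)
    assume "\<eta> z \<noteq> 0"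
    then have "z \<in> {z. \<eta> z \<noteq> 0}" by simp
    then have "z \<in> closure {z. \<eta> z \<noteq> 0}" by (rule subsetD[OF closure_subset])
    then have "norm z \<le> R" by (rule R(2))
    then show False using that by simp
  qed
  have "continuous_on UNIV \<eta>" 
    using has_derivative_continuous[OF der] by (simp add: continuous_at_imp_continuous_on)
  then have "bounded (\<eta> ` cball 0 R)"
    by (intro compact_imp_bounded compact_continuous_image) (auto intro: continuous_on_subset)
  then obtain H0 where "H0 > 0" "\<forall>v\<in>\<eta> ` cball 0 R. cmod v \<le> H0"
    unfolding bounded_pos by blast
  then have H0: "H0 > 0" "\<And>z. norm z \<le> R \<Longrightarrow> cmod (\<eta> z) \<le> H0" by auto
  have H: "cmod (\<eta> z) \<le> H0" for z using H0 supp[of z] by (cases "norm z \<le> R") auto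
  have "bounded (\<eta>' ` cball 0 (R + 1))"
    by (intro compact_imp_bounded compact_continuous_image) (auto intro: continuous_on_subset[OF cont])
  then obtain L0 where "L0 > 0" "\<forall>v\<in>\<eta>' ` cball 0 (R + 1). norm v \<le> L0"
    unfolding bounded_pos by blast
  then have L0: "L0 > 0" "\<And>z. norm z \<le> R + 1 \<Longrightarrow> norm (\<eta>' z) \<le> L0" by auto
  have near: "cmod (\<eta> z - \<eta> z') \<le> (L0 + H0) * dist z z'" if z: "norm z \<le> R" for z z'
  proof (cases "norm z' \<le> R + 1")
    case True
    have "norm (\<eta> z - \<eta> z') \<le> L0 * norm (z - z')"
    proof (rule differentiable_bound[where S = "cball 0 (R + 1)" and f' = "\<lambda>z. blinfun_apply (\<eta>' z)"])
      show "onorm (blinfun_apply (\<eta>' x)) \<le> L0" if "x \<in> cball 0 (R + 1)" for x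
        using L0(2)[of x] that by (simp add: norm_blinfun.rep_eq)
    qed (use z True der in \<open>auto intro: has_derivative_at_withinI\<close>)
    also have "\<dots> \<le> (L0 + H0) * norm (z - z')" using H0(1) by (intro mult_right_mono) auto
    finally show ?thesis by (simp add: dist_norm)
  next
    case False
    then have "\<eta> z' = 0" by (intro supp) simp
    have "1 \<le> dist z z'" using z False norm_triangle_ineq2[of z' z] by (simp add: dist_norm norm_minus_commute)
    then have "H0 * 1 \<le> (L0 + H0) * dist z z'" using H0(1) L0(1) by (intro mult_mono) auto
    then show ?thesis using H[of z] \<open>\<eta> z' = 0\<close> by simp
  qed
  have "cmod (\<eta> z - \<eta> z') \<le> (L0 + H0) * dist z z'" for z z'
  proof -
    consider "norm z \<le> R" | "norm z' \<le> R" | "norm z > R" "norm z' > R" by linarith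
    then show ?thesis
    proof cases
      case 1
      then show ?thesis by (rule near)
    next
      case 2
      then show ?thesis using near[of z' z] by (simp add: norm_minus_commute dist_commute)
    next
      case 3
      then show ?thesis using supp H0(1) L0(1) by simp
    qed
  qed
  then have "bdd_lip H0 (L0 + H0) \<eta>" using H H0(1) L0(1) by (auto simp: bdd_lip_def)
  then show thesis using R(1) supp by (rule that)
qed

lemma ex_dominating_sup:
  fixes q :: "'b \<Rightarrow> 'a::euclidean_space \<Rightarrow> real"
  assumes "finite B" "B \<noteq> {}" and q: "\<And>b. b \<in> B \<Longrightarrow> continuous_on UNIV (q b)"
  obtains M where "0 \<le> M" "\<forall>b\<in>B. \<forall>z\<in>cball 0 1. \<bar>q b z\<bar> \<le> M" "\<exists>b\<in>B. \<exists>z\<in>cball 0 1. \<bar>q b z\<bar> = M"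
proof -
  have "\<exists>z\<in>cball 0 1. \<forall>y\<in>cball 0 1. \<bar>q b y\<bar> \<le> \<bar>q b z\<bar>" if "b \<in> B" for b
    by (rule continuous_attains_sup) (auto intro!: continuous_intros continuous_on_subset[OF q[OF that]])
  then obtain y where y: "\<And>b. b \<in> B \<Longrightarrow> y b \<in> cball 0 1" "\<And>b z. b \<in> B \<Longrightarrow> z \<in> cball 0 1 \<Longrightarrow> \<bar>q b z\<bar> \<le> \<bar>q b (y b)\<bar>"
    by metis
  define M where "M = Max ((\<lambda>b. \<bar>q b (y b)\<bar>) ` B)"
  have "M \<in> (\<lambda>b. \<bar>q b (y b)\<bar>) ` B" unfolding M_def using assms(1,2) by (intro Max_in) auto
  then obtain b where b: "b \<in> B" "M = \<bar>q b (y b)\<bar>" by blast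
  show thesis
  proof (rule that[of M])
    show "\<forall>b\<in>B. \<forall>z\<in>cball 0 1. \<bar>q b z\<bar> \<le> M"
    proof (intro ballI)
      fix b z assume bz: "b \<in> B" "z \<in> cball (0::'a) 1"
      have "\<bar>q b z\<bar> \<le> \<bar>q b (y b)\<bar>" by (rule y(2)[OF bz])
      also have "\<dots> \<le> M" unfolding M_def using assms(1) bz(1) by (intro Max_ge) auto
      finally show "\<bar>q b z\<bar> \<le> M" .
    qed
    show "\<exists>b\<in>B. \<exists>z\<in>cball 0 1. \<bar>q b z\<bar> = M" using b y(1)[OF b(1)]
      by (intro bexI[of _ b] bexI[of _ "y b"]) simp_all
  qed (use b in auto)
qed

text \<open>The slope in direction \<open>e\<close> at the point \<open>z\<close> is a linear
  functional of the coefficients of \<open>P\<close>, indexed by \<open>(e, z)\<close>. If all of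
  them vanish, \<open>P\<close> is degenerate and its class has norm 0, so
  \<open>finite_functional_bound\<close> applies.\<close>

lemma nd_norm_bound:
  fixes \<pi> :: "nat \<Rightarrow> real ^ 'n::finite \<Rightarrow> real ^ 'k::finite"
  assumes ip: "nd_inner_product d \<pi> ip"
    and lin: "linear T" "linear A" "linear B" "\<And>j. j \<in> {1..3} \<Longrightarrow> linear (\<pi> j)" and bij: "bij T" "bij A" "bij B"
    and co: "\<And>z. \<pi> 1 (T z) = A (fst z)" "\<And>z. \<pi> 2 (T z) = B (snd z)" "\<And>z. \<pi> 3 (T z) = fst z + snd z"
  shows "\<exists>C\<ge>0. \<forall>P\<in>polys_upto d. \<forall>M. slopes_le (\<lambda>v. P (T v)) M \<longrightarrow> (nd_norm d \<pi> ip P)\<^sup>2 \<le> C * M\<^sup>2"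
proof -
  define V where "V c x = (\<Sum>\<alpha>\<in>multi_indices d. c \<alpha> * monomial \<alpha> x)" for c :: "('n \<Rightarrow> nat) \<Rightarrow> real" and x
  define N where "N P = ip (nd_class d \<pi> P) (nd_class d \<pi> P)" for P
  define l where "l \<alpha> \<theta> = phase_slope (\<lambda>v. monomial \<alpha> (T v)) (fst \<theta>) (snd \<theta>)"
    for \<alpha> :: "'n \<Rightarrow> nat" and \<theta> :: "(real ^ 'k) \<times> ((real ^ 'k) \<times> (real ^ 'k)) \<times> ((real ^ 'k) \<times> (real ^ 'k))"
  let ?\<Theta> = "Basis \<times> cball 0 1 :: ((real ^ 'k) \<times> ((real ^ 'k) \<times> (real ^ 'k)) \<times> ((real ^ 'k) \<times> (real ^ 'k))) set"
  have Vp: "V c \<in> polys_upto d" for c unfolding polys_upto_def V_def[abs_def] by blast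
  have mT: "line_poly d (\<lambda>v. monomial \<alpha> (T v))" if "\<alpha> \<in> multi_indices d" for \<alpha>
    by (rule line_poly_compose_linear[OF line_poly_monomial[OF that] lin(1)])
  have VT: "line_poly d (\<lambda>v. V c (T v))" for c
    unfolding V_def by (intro line_poly_sum line_poly_cmult mT)
  have Tc: "continuous_on UNIV T" using lin(1) by (intro linear_continuous_on) (simp add: linear_conv_bounded_linear)
  have lsum: "phase_slope (\<lambda>v. V c (T v)) b z = (\<Sum>\<alpha>\<in>multi_indices d. c \<alpha> * l \<alpha> (b, z))" for c b z
  proof -
    have "paired_phase (\<lambda>v. V c (T v)) = (\<lambda>z. \<Sum>\<alpha>\<in>multi_indices d. c \<alpha> * paired_phase (\<lambda>v. monomial \<alpha> (T v)) z)"
      by (rule ext) (simp add: paired_phase_def V_def algebra_simps sum.distrib sum_subtractf)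
    then show ?thesis unfolding l_def using ddir_sum[OF line_poly_paired_phase[OF mT]] by simp
  qed
  have "\<exists>C\<ge>0. \<forall>c M. (\<forall>i. i \<notin> multi_indices d \<longrightarrow> c i = 0) \<longrightarrow>
     (\<forall>\<theta>\<in>?\<Theta>. \<bar>\<Sum>i\<in>multi_indices d. c i * l i \<theta>\<bar> \<le> M) \<longrightarrow> N (V c) \<le> C * M\<^sup>2"
  proof (rule finite_functional_bound)
    show "finite (multi_indices d :: ('n \<Rightarrow> nat) set)" by (rule finite_multi_indices)
    show "N (V (\<lambda>i. c i + c' i)) \<le> 2 * N (V c) + 2 * N (V c')" for c c'
    proof -
      have "V (\<lambda>i. c i + c' i) = (\<lambda>z. V c z + V c' z)" by (rule ext) (simp add: V_def distrib_right sum.distrib)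
      then show ?thesis unfolding N_def using nd_quadratic(1)[OF ip Vp[of c] Vp[of c']] by simp
    qed
    show "N (V (\<lambda>i. t * c i)) = t\<^sup>2 * N (V c)" for t c
    proof -
      have "V (\<lambda>i. t * c i) = (\<lambda>z. t * V c z)" by (rule ext) (simp add: V_def sum_distrib_left mult.assoc)
      then show ?thesis unfolding N_def using nd_quadratic(2)[OF ip Vp[of c] Vp[of c], of t] by simp
    qed
    show "\<exists>B. \<forall>\<theta>\<in>?\<Theta>. \<bar>l i \<theta>\<bar> \<le> B" if i: "i \<in> multi_indices d" for i
    proof -
      have c: "continuous_on UNIV (phase_slope (\<lambda>v. monomial i (T v)) b)" for b :: "real ^ 'k"
        by (intro continuous_on_ddir[OF line_poly_paired_phase[OF mT[OF i]]] continuous_on_paired_phase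
            continuous_on_compose2[OF continuous_on_monomial Tc]) simp
      obtain M where "\<forall>b\<in>Basis. \<forall>z\<in>cball 0 1. \<bar>phase_slope (\<lambda>v. monomial i (T v)) b z\<bar> \<le> M"
        by (rule ex_dominating_sup[OF finite_Basis nonempty_Basis c])
      then show ?thesis unfolding l_def by (intro exI[of _ M]) auto
    qed
    show "N (V c) \<le> 0" if "\<forall>\<theta>\<in>?\<Theta>. (\<Sum>i\<in>multi_indices d. c i * l i \<theta>) = 0" for c
    proof -
      have "\<forall>b\<in>Basis. \<forall>z\<in>cball 0 1. phase_slope (\<lambda>v. V c (T v)) b z = 0"
        unfolding lsum using that by simp
      then have ind: "paired_phase (\<lambda>v. V c (T v)) ((w, x), v) = paired_phase (\<lambda>v. V c (T v)) ((w, y), v)" for w x y v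
        by (rule paired_phase_indep[OF VT])
      have "real_polynomial_function (V c)" using Vp real_polynomial_function_iff_polys_upto by blast
      then have "real_polynomial_function (\<lambda>v. V c (T v))"
        by (rule real_polynomial_function_compose_linear[OF _ lin(1)])
      from paired_phase_indep_imp_degenerate[OF this ind] obtain p1 p2 p3 where
        p: "real_polynomial_function p1" "real_polynomial_function p2" "real_polynomial_function p3"
          "\<And>x y. V c (T (x, y)) = p1 x + p2 y + p3 (x + y)" by blast
      have Ai: "inv A (A x) = x" and Bi: "inv B (B x) = x" for x
        using bij by (simp_all add: bij_is_inj)
      have "linear (inv A)" "linear (inv B)"
        using linear_inv_bij lin(2,3) bij(2,3) by auto
      then have q: "real_polynomial_function (\<lambda>x. p1 (inv A x))" "real_polynomial_function (\<lambda>x. p2 (inv B x))"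
        using p by (auto intro: real_polynomial_function_compose_linear)
      \<comment> \<open>In the coordinates \<open>T\<close> the first two maps read \<open>A\<close>
        and \<open>B\<close>, which \<open>inv A\<close> and \<open>inv B\<close> undo; the third is
        already the sum.\<close>
      define r where "r j = (if j = 1 then (\<lambda>x. p1 (inv A x)) else if j = 2 then (\<lambda>x. p2 (inv B x)) else p3)" for j :: nat
      have "degenerate \<pi> (V c)"
        unfolding degenerate_def
      proof (intro exI[of _ r] conjI ballI ext)
        show "real_polynomial_function (r j)" for j using q p(3) by (simp add: r_def)
        fix z
        obtain v where v: "z = T v" using bij_is_surj[OF bij(1)] by blast
        have "(\<Sum>j=1..3. r j (\<pi> j z)) = r 1 (\<pi> 1 z) + r 2 (\<pi> 2 z) + r 3 (\<pi> 3 z)"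
          by (simp add: numeral_eq_Suc atLeastAtMostSuc_conv)
        also have "\<dots> = p1 (fst v) + p2 (snd v) + p3 (fst v + snd v)"
          unfolding v co by (simp add: r_def Ai Bi)
        also have "\<dots> = V c z" unfolding v using p(4)[of "fst v" "snd v"] by simp
        finally show "V c z = (\<Sum>j=1..3. r j (\<pi> j z))" by simp
      qed
      then have "nd_class d \<pi> (V c) = nd_class d \<pi> (\<lambda>_. 0)" by (rule nd_class_degenerate)
      then show ?thesis unfolding N_def using nd_quadratic(4)[OF ip Vp[of c] Vp[of c]] by simp
    qed
  qed
  then obtain C where C: "C \<ge> 0" "\<And>c M. (\<forall>i. i \<notin> multi_indices d \<longrightarrow> c i = 0) \<Longrightarrow>
     (\<forall>\<theta>\<in>?\<Theta>. \<bar>\<Sum>i\<in>multi_indices d. c i * l i \<theta>\<bar> \<le> M) \<Longrightarrow> N (V c) \<le> C * M\<^sup>2" by blast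
  have "(nd_norm d \<pi> ip P)\<^sup>2 \<le> C * M\<^sup>2" if P: "P \<in> polys_upto d"
    and M: "slopes_le (\<lambda>v. P (T v)) M" for P M
  proof -
    obtain c0 where c0: "P = (\<lambda>x. \<Sum>\<alpha>\<in>multi_indices d. c0 \<alpha> * monomial \<alpha> x)"
      using P unfolding polys_upto_def by blast
    define c where "c \<alpha> = (if \<alpha> \<in> multi_indices d then c0 \<alpha> else 0)" for \<alpha>
    have PV: "P = V c" unfolding c0 V_def[abs_def] c_def by (intro ext sum.cong) auto
    have "N (V c) \<le> C * M\<^sup>2"
      by (rule C(2)) (use M in \<open>auto simp: c_def[abs_def] PV lsum\<close>)
    moreover have "(nd_norm d \<pi> ip P)\<^sup>2 = N P"
      using nd_quadratic(3)[OF ip P P] by (simp add: nd_norm_def N_def)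
    ultimately show ?thesis by (simp add: PV)
  qed
  then show ?thesis using C(1) by blast
qed

lemma nn_integral_L2_norm:
  fixes f :: "'a::euclidean_space \<Rightarrow> complex"
  assumes f: "in_L2 f" and g: "g \<in> borel_measurable borel" "AE x in lborel. f x = g x"
  shows "sq_integral g = ennreal ((L2_norm f)\<^sup>2)"
proof -
  have "sq_integral g = sq_integral f"
    by (rule nn_integral_cong_AE) (use g(2) in auto)
  also have "\<dots> = (\<integral>\<^sup>+x. ennreal ((cmod (f x))\<^sup>2) \<partial>lebesgue)" by (simp add: nn_integral_completion)
  also have "\<dots> = ennreal (LINT x|lebesgue. (cmod (f x))\<^sup>2)"
    by (rule nn_integral_eq_integral) (use f in \<open>auto simp: in_L2_def\<close>)
  also have "(LINT x|lebesgue. (cmod (f x))\<^sup>2) = (L2_norm f)\<^sup>2"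
    by (simp add: L2_norm_def)
  finally show ?thesis .
qed

text \<open>The changes of variables and the exchanges of integrals are carried out for Borel
  functions. Each composed factor changes only on a null set, so the form may be computed with Borel
  representatives.\<close>

lemma trilinear_form_borel:
  fixes \<pi> :: "nat \<Rightarrow> real ^ 'n::finite \<Rightarrow> real ^ 'k::finite"
  assumes pi: "\<forall>j\<in>{1..3}. linear (\<pi> j) \<and> surj (\<pi> j)"
    and ae: "\<And>j. j \<in> {1..3} \<Longrightarrow> AE x in lborel. f j x = g j x"
    and g: "\<And>j. j \<in> {1..3} \<Longrightarrow> g j \<in> borel_measurable borel"
    and P: "P \<in> borel_measurable borel" and eta: "\<eta> \<in> borel_measurable borel"
  shows "trilinear_form \<eta> \<pi> P f =
    (LINT z|lborel. exp (\<i> * of_real (P z)) * (g 1 (\<pi> 1 z) * g 2 (\<pi> 2 z) * g 3 (\<pi> 3 z)) * \<eta> z)"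
    and "(\<lambda>z. exp (\<i> * of_real (P z)) * (g 1 (\<pi> 1 z) * g 2 (\<pi> 2 z) * g 3 (\<pi> 3 z)) * \<eta> z) \<in> borel_measurable borel"
proof -
  let ?X = "\<lambda>f z. exp (\<i> * of_real (P z)) * (f 1 (\<pi> 1 z) * f 2 (\<pi> 2 z) * f 3 (\<pi> 3 z)) * \<eta> z :: complex"
  have prod3: "(\<Prod>j=1..3. F j) = F 1 * F 2 * F 3" for F :: "nat \<Rightarrow> complex"
    by (simp add: numeral_eq_Suc atLeastAtMostSuc_conv mult_ac)
  have pc: "continuous_on UNIV (\<pi> j)" if "j \<in> {1..3}" for j
    using pi that by (intro linear_continuous_on) (simp add: linear_conv_bounded_linear)
  have gm: "(\<lambda>z. g j (\<pi> j z)) \<in> borel_measurable borel" if "j \<in> {1..3}" for j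
    using borel_measurable_compose_continuous[OF g[OF that] pc[OF that]] .
  have [measurable]: "(\<lambda>z. g 1 (\<pi> 1 z)) \<in> borel_measurable borel" "(\<lambda>z. g 2 (\<pi> 2 z)) \<in> borel_measurable borel"
    "(\<lambda>z. g 3 (\<pi> 3 z)) \<in> borel_measurable borel" by (rule gm; simp)+
  note [measurable] = P eta
  show Xm: "?X g \<in> borel_measurable borel" by measurable
  have ae': "AE z in lborel. f j (\<pi> j z) = g j (\<pi> j z)" if "j \<in> {1..3}" for j
    by (rule AE_lborel_linear_surj[OF _ _ ae[OF that]]) (use pi that in auto)
  have eq: "AE z in lborel. ?X f z = ?X g z"
  proof -
    have "AE z in lborel. f 1 (\<pi> 1 z) = g 1 (\<pi> 1 z)" "AE z in lborel. f 2 (\<pi> 2 z) = g 2 (\<pi> 2 z)"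
      "AE z in lborel. f 3 (\<pi> 3 z) = g 3 (\<pi> 3 z)" by (rule ae'; simp)+
    then show ?thesis by eventually_elim simp
  qed
  have eql: "AE z in lebesgue. ?X g z = ?X f z"
    using AE_completion[OF eq] by eventually_elim (rule sym)
  have gl: "?X g \<in> borel_measurable lebesgue" using Xm by (intro measurable_completion) simp
  have fl: "?X f \<in> borel_measurable lebesgue"
    by (rule borel_measurable_AE[OF gl eql])
  have "trilinear_form \<eta> \<pi> P f = (LINT z|lebesgue. ?X f z)"
    unfolding trilinear_form_def prod3 ..
  also have "\<dots> = (LINT z|lebesgue. ?X g z)"
    by (rule integral_cong_AE[OF fl gl]) (use eql in auto)
  also have "\<dots> = (LINT z|lborel. ?X g z)" by (rule integral_completion) (use Xm in simp)
  finally show "trilinear_form \<eta> \<pi> P f = (LINT z|lborel. ?X g z)" .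
qed

lemma japanese_bracket_powr_bound:
  assumes "t\<^sup>2 \<le> C * M\<^sup>2" and C: "C \<ge> 0" and M: "M \<ge> 0" and e: "\<epsilon> \<ge> 0"
  shows "max 1 M powr (- \<epsilon>) \<le> sqrt (1 + C) powr \<epsilon> * japanese_bracket t powr (- \<epsilon>)"
proof -
  define m where "m = max 1 M"
  have jb: "japanese_bracket t = sqrt (1 + t\<^sup>2)" unfolding japanese_bracket_def by (simp add: powr_half_sqrt)
  have "C * M\<^sup>2 \<le> C * m\<^sup>2" using C M by (intro mult_left_mono power_mono) (auto simp: m_def)
  moreover have "1 \<le> m\<^sup>2" by (simp add: m_def)
  ultimately have "1 + t\<^sup>2 \<le> (1 + C) * m\<^sup>2" using assms(1) by (simp add: distrib_right)
  then have "japanese_bracket t \<le> sqrt ((1 + C) * m\<^sup>2)" unfolding jb by (rule real_sqrt_le_mono)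
  also have "\<dots> = sqrt (1 + C) * m" by (simp add: real_sqrt_mult m_def)
  finally have le: "japanese_bracket t \<le> sqrt (1 + C) * m" .
  have "0 < japanese_bracket t" unfolding jb by (simp add: add_pos_nonneg)
  then have "(sqrt (1 + C) * m) powr (- \<epsilon>) \<le> japanese_bracket t powr (- \<epsilon>)"
    using le e by (intro powr_mono2') auto
  then have "sqrt (1 + C) powr \<epsilon> * (sqrt (1 + C) * m) powr (- \<epsilon>) \<le> sqrt (1 + C) powr \<epsilon> * japanese_bracket t powr (- \<epsilon>)"
    by (intro mult_left_mono) auto
  also have "sqrt (1 + C) powr \<epsilon> * (sqrt (1 + C) * m) powr (- \<epsilon>) = m powr (- \<epsilon>)"
    using C by (simp add: powr_mult powr_minus m_def field_simps)
  finally show ?thesis by (simp add: m_def)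
qed

text \<open>The estimate is available only for strictly positive bounds on the norms; the norms
  themselves are reached by letting the excess tend to 0.\<close>

lemma le_product_limit:
  fixes x y z :: real
  assumes "\<And>\<delta>. \<delta> > 0 \<Longrightarrow> a \<le> C * ((x + \<delta>) * (y + \<delta>) * (z + \<delta>))"
  shows "a \<le> C * (x * y * z)"
proof (rule tendsto_lowerbound)
  have "((\<lambda>\<delta>. C * ((x + \<delta>) * (y + \<delta>) * (z + \<delta>))) \<longlongrightarrow> C * ((x + 0) * (y + 0) * (z + 0))) (at_right 0)"
    by (intro tendsto_intros)
  then show "((\<lambda>\<delta>. C * ((x + \<delta>) * (y + \<delta>) * (z + \<delta>))) \<longlongrightarrow> C * (x * y * z)) (at_right 0)" by simp
  show "\<forall>\<^sub>F \<delta> in at_right 0. a \<le> C * ((x + \<delta>) * (y + \<delta>) * (z + \<delta>))"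
    unfolding eventually_at_right_field using assms by (intro exI[of _ 1]) auto
qed simp

theorem theorem3:
  fixes d :: nat
    and \<eta> :: "real ^ 'n::finite \<Rightarrow> complex"
  assumes "CARD('n) = 2 * CARD('k::finite)"
    and "d \<ge> 1"
    and "C1_compact_support \<eta>"
  shows "\<exists>\<epsilon>::real. \<epsilon> > 0 \<and>
    (\<forall>\<pi> :: nat \<Rightarrow> real ^ 'n \<Rightarrow> real ^ 'k. \<forall>ip.
      (\<forall>j\<in>{1..3}. linear (\<pi> j) \<and> surj (\<pi> j)) \<and> general_position \<pi> \<and> nd_inner_product d \<pi> ip \<longrightarrow>
      (\<exists>C::real. C > 0 \<and>
        (\<forall>P\<in>polys_upto d. \<forall>f. (\<forall>j\<in>{1..3}. in_L2 (f j)) \<longrightarrow>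
          cmod (trilinear_form \<eta> \<pi> P f)
            \<le> C * japanese_bracket (nd_norm d \<pi> ip P) powr (- \<epsilon>) * (\<Prod>j=1..3. L2_norm (f j)))))"
proof -
  obtain H L R where eta: "bdd_lip H L \<eta>" "R > 0" "\<And>z. norm z > R \<Longrightarrow> \<eta> z = 0"
    using C1_compact_support_bdd_lip[OF assms(3)] by blast
  \<comment> \<open>The exponent depends on \<open>d\<close> alone and is fixed before the maps and
    the inner product are.\<close>
  define \<epsilon> where "\<epsilon> = 1 / (96 * real d)"
  have e: "\<epsilon> > 0" using assms(2) by (simp add: \<epsilon>_def)
  have "\<exists>C>0. \<forall>P\<in>polys_upto d. \<forall>f. (\<forall>j\<in>{1..3}. in_L2 (f j)) \<longrightarrow>
          cmod (trilinear_form \<eta> \<pi> P f)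
            \<le> C * japanese_bracket (nd_norm d \<pi> ip P) powr (- \<epsilon>) * (\<Prod>j=1..3. L2_norm (f j))"
    if pi: "\<forall>j\<in>{1..3}. linear (\<pi> j) \<and> surj (\<pi> j)" and gp: "general_position \<pi>" and ip: "nd_inner_product d \<pi> ip"
    for \<pi> :: "nat \<Rightarrow> real ^ 'n \<Rightarrow> real ^ 'k" and ip
  proof -
    obtain T :: "(real ^ 'k) \<times> (real ^ 'k) \<Rightarrow> real ^ 'n" and A B :: "real ^ 'k \<Rightarrow> real ^ 'k" where
      lb: "linear T" "bij T" "linear A" "bij A" "linear B" "bij B"
      and co: "\<And>z. \<pi> 1 (T z) = A (fst z)" "\<And>z. \<pi> 2 (T z) = B (snd z)" "\<And>z. \<pi> 3 (T z) = fst z + snd z"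
    proof (rule general_position_coordinates[OF assms(1) pi gp])
      fix T :: "(real ^ 'k) \<times> (real ^ 'k) \<Rightarrow> real ^ 'n" and A B :: "real ^ 'k \<Rightarrow> real ^ 'k"
      assume a: "linear T" "bij T" "linear A" "bij A" "linear B" "bij B"
        "\<And>z. \<pi> 1 (T z) = A (fst z)" "\<And>z. \<pi> 2 (T z) = B (snd z)" "\<And>z. \<pi> 3 (T z) = fst z + snd z"
      show thesis by (rule that[OF a])
    qed
    note lin = lb(1,3,5) and bij = lb(2,4,6)
    have cont: "continuous_on UNIV T" "continuous_on UNIV A" "continuous_on UNIV B"
      using lin by (auto intro!: linear_continuous_on simp: linear_conv_bounded_linear)
    obtain L' where lip: "bdd_lip H L' (\<lambda>v. \<eta> (T v))"
      by (rule bdd_lip_compose_linear[OF eta(1) lin(1)])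
    obtain K where K: "K > 0" "\<And>z. norm (inv T z) \<le> norm z * K"
      using bounded_linear.pos_bounded linear_inv_bij[OF lin(1) bij(1)] unfolding linear_conv_bounded_linear by blast
    have supp: "\<eta> (T v) = 0" if "norm v > R * K" for v
    proof (rule eta(3), rule ccontr)
      assume "\<not> R < norm (T v)"
      then have "norm (T v) * K \<le> R * K" using K(1) by (intro mult_right_mono) auto
      then show False using K(2)[of "T v"] that bij(1) by (simp add: bij_is_inj)
    qed
    have RK: "R * K > 0" using eta(2) K(1) by simp
    obtain C2 where C2: "C2 \<ge> 0" "\<And>P (f :: real ^ 'k \<Rightarrow> complex) (g :: real ^ 'k \<Rightarrow> complex) (h :: real ^ 'k \<Rightarrow> complex) a b c M.
      line_poly d P \<Longrightarrow> continuous_on UNIV P \<Longrightarrow>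
      f \<in> borel_measurable borel \<Longrightarrow> g \<in> borel_measurable borel \<Longrightarrow> h \<in> borel_measurable borel \<Longrightarrow>
      0 < a \<Longrightarrow> 0 < b \<Longrightarrow> 0 < c \<Longrightarrow>
      sq_integral f \<le> ennreal (a\<^sup>2) \<Longrightarrow>
      sq_integral g \<le> ennreal (b\<^sup>2) \<Longrightarrow>
      sq_integral h \<le> ennreal (c\<^sup>2) \<Longrightarrow>
      slopes_le P M \<Longrightarrow>
      slope_attains P M \<Longrightarrow>
      cmod (trilinear_integral (\<lambda>v. \<eta> (T v)) P f g h)
        \<le> C2 * max 1 M powr (- 1 / (96 * d)) * (a * b * c)"
      using trilinear_L2_decay[OF assms(2) lip supp RK] by auto
    obtain C1 where C1: "C1 \<ge> 0" "\<And>P M. P \<in> polys_upto d \<Longrightarrow> slopes_le (\<lambda>v. P (T v)) M \<Longrightarrow> (nd_norm d \<pi> ip P)\<^sup>2 \<le> C1 * M\<^sup>2"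
      using nd_norm_bound[OF ip lin _ bij co] pi by blast
    obtain cT :: real where cT: "cT > 0"
      "\<And>f :: _ \<Rightarrow> complex. f \<in> borel_measurable borel \<Longrightarrow> (LINT x|lborel. f (T x)) = of_real cT * (LINT x|lborel. f x)"
      using linear_change_of_variables_complex[OF lin(1) bij(1)] by blast
    obtain cA where cA: "cA > 0" "\<And>f :: _ \<Rightarrow> ennreal. f \<in> borel_measurable borel \<Longrightarrow> (\<integral>\<^sup>+x. f (A x) \<partial>lborel) = ennreal cA * (\<integral>\<^sup>+x. f x \<partial>lborel)"
      by (rule linear_change_of_variables[OF lin(2) bij(2)]) auto
    obtain cB where cB: "cB > 0" "\<And>f :: _ \<Rightarrow> ennreal. f \<in> borel_measurable borel \<Longrightarrow> (\<integral>\<^sup>+x. f (B x) \<partial>lborel) = ennreal cB * (\<integral>\<^sup>+x. f x \<partial>lborel)"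
      by (rule linear_change_of_variables[OF lin(3) bij(3)]) auto
    \<comment> \<open>\<open>sqrt cA\<close> and \<open>sqrt cB\<close> are the factors by which
      composing with \<open>A\<close> and \<open>B\<close> scales the \<open>L2\<close> norms;
      \<open>cT\<close> is the volume factor of the coordinates.\<close>
    define D where "D = C2 * sqrt cA * sqrt cB / cT"
    have D0: "D \<ge> 0" unfolding D_def using C2(1) cA(1) cB(1) cT(1) by simp
    \<comment> \<open>Adding 1 makes the constant strictly positive even when \<open>D\<close> is
      0.\<close>
    define C where "C = D * sqrt (1 + C1) powr \<epsilon> + 1"
    have C0: "C > 0" unfolding C_def using D0 by (intro add_nonneg_pos) auto
    have "cmod (trilinear_form \<eta> \<pi> P f)
            \<le> C * japanese_bracket (nd_norm d \<pi> ip P) powr (- \<epsilon>) * (\<Prod>j=1..3. L2_norm (f j))"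
      if P: "P \<in> polys_upto d" and f: "\<forall>j\<in>{1..3}. in_L2 (f j)" for P and f :: "nat \<Rightarrow> real ^ 'k \<Rightarrow> complex"
    proof -
      have "\<exists>g. g \<in> borel_measurable borel \<and> (AE x in lborel. f j x = g x)" if "j \<in> {1..3}" for j
        using lebesgue_measurable_complex_ex_borel[of "f j"] f that unfolding in_L2_def by blast
      then obtain g where g: "\<And>j. j \<in> {1..3} \<Longrightarrow> g j \<in> borel_measurable borel"
        "\<And>j. j \<in> {1..3} \<Longrightarrow> AE x in lborel. f j x = g j x" by metis
      have g13: "g 1 \<in> borel_measurable borel" "g 2 \<in> borel_measurable borel" "g 3 \<in> borel_measurable borel"
        by (rule g(1); simp)+
      have L2: "(\<integral>\<^sup>+x. ennreal ((cmod (g j x))\<^sup>2) \<partial>lborel) = ennreal ((L2_norm (f j))\<^sup>2)" if "j \<in> {1..3}" for j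
        using nn_integral_L2_norm[OF _ g(1)[OF that] g(2)[OF that]] f that by blast
      have n0: "L2_norm (f j) \<ge> 0" for j by (simp add: L2_norm_def)
      obtain coef where coef: "P = (\<lambda>x. \<Sum>\<alpha>\<in>multi_indices d. coef \<alpha> * monomial \<alpha> x)"
        using P unfolding polys_upto_def by blast
      have Pl: "line_poly d P" unfolding coef by (intro line_poly_sum line_poly_cmult line_poly_monomial)
      have Pc: "continuous_on UNIV P" unfolding coef
        by (intro continuous_intros continuous_on_monomial)
      have PTl: "line_poly d (\<lambda>v. P (T v))" by (rule line_poly_compose_linear[OF Pl lin(1)])
      have PTc: "continuous_on UNIV (\<lambda>v. P (T v))" by (rule continuous_on_compose2[OF Pc cont(1)]) simp
      obtain M where M: "0 \<le> M" "slopes_le (\<lambda>v. P (T v)) M"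
        "\<exists>b\<in>Basis. \<exists>z\<in>cball 0 1. \<bar>phase_slope (\<lambda>v. P (T v)) b z\<bar> = M"
        by (rule ex_dominating_sup[OF finite_Basis nonempty_Basis
              continuous_on_ddir[OF line_poly_paired_phase[OF PTl] continuous_on_paired_phase[OF PTc]]])
      have M2: "1 \<le> M \<longrightarrow> (\<exists>e\<in>Basis. \<exists>z\<in>cball 0 1. M / 2 \<le> \<bar>phase_slope (\<lambda>v. P (T v)) e z\<bar>)"
      proof -
        from M(3) obtain b z where bz: "b \<in> Basis" "z \<in> cball 0 1" "\<bar>phase_slope (\<lambda>v. P (T v)) b z\<bar> = M" by blast
        show ?thesis using M(1) bz(3) by (intro impI bexI[OF _ bz(1)] bexI[OF _ bz(2)]) simp
      qed
      have Pm: "P \<in> borel_measurable borel" using Pc by (rule borel_measurable_continuous_onI)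
      have em: "\<eta> \<in> borel_measurable borel" using bdd_lip_continuous[OF eta(1)] by (rule borel_measurable_continuous_onI)
      let ?X = "\<lambda>z. exp (\<i> * of_real (P z)) * (g 1 (\<pi> 1 z) * g 2 (\<pi> 2 z) * g 3 (\<pi> 3 z)) * \<eta> z"
      have form: "trilinear_form \<eta> \<pi> P f = (LINT z|lborel. ?X z)"
        by (rule trilinear_form_borel(1)[OF pi _ _ Pm em]; (erule g(1) | erule g(2)))
      have Xm: "?X \<in> borel_measurable borel"
        by (rule trilinear_form_borel(2)[OF pi _ _ Pm em]; (erule g(1) | erule g(2)))
      have "of_real cT * trilinear_form \<eta> \<pi> P f = (LINT v|lborel. ?X (T v))"
        unfolding form by (rule cT(2)[OF Xm, symmetric])
      also have "\<dots> = trilinear_integral (\<lambda>v. \<eta> (T v)) (\<lambda>v. P (T v)) (\<lambda>x. g 1 (A x)) (\<lambda>x. g 2 (B x)) (g 3)"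
        unfolding co ..
      finally have form_eq: "cT * cmod (trilinear_form \<eta> \<pi> P f) = cmod \<dots>"
        using cT(1) by (metis abs_of_pos norm_mult norm_of_real)
      define m where "m = max 1 M powr (- 1 / (96 * d))"
      have bound: "cT * cmod (trilinear_form \<eta> \<pi> P f) \<le> (C2 * m * sqrt cA * sqrt cB) *
         ((L2_norm (f 1) + \<delta>) * (L2_norm (f 2) + \<delta>) * (L2_norm (f 3) + \<delta>))" if \<delta>: "\<delta> > 0" for \<delta>
      proof -
        have sq: "(L2_norm (f j))\<^sup>2 \<le> (L2_norm (f j) + \<delta>)\<^sup>2" for j
          using n0[of j] \<delta> by (intro power_mono) auto
        have pos: "0 < L2_norm (f j) + \<delta>" for j using n0[of j] \<delta> by simp
        have scaled: "(\<integral>\<^sup>+x. ennreal ((cmod (g j (S x)))\<^sup>2) \<partial>lborel) \<le> ennreal ((sqrt k * (L2_norm (f j) + \<delta>))\<^sup>2)"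
          if k: "k > 0" "(\<integral>\<^sup>+x. ennreal ((cmod (g j (S x)))\<^sup>2) \<partial>lborel) = ennreal k * (\<integral>\<^sup>+x. ennreal ((cmod (g j x))\<^sup>2) \<partial>lborel)"
            and j: "j \<in> {1..3}" for S :: "real ^ 'k \<Rightarrow> real ^ 'k" and k j
        proof -
          have "(\<integral>\<^sup>+x. ennreal ((cmod (g j (S x)))\<^sup>2) \<partial>lborel) = ennreal (k * (L2_norm (f j))\<^sup>2)"
            unfolding k(2) L2[OF j] using k(1) by (simp add: ennreal_mult)
          also have "\<dots> \<le> ennreal ((sqrt k * (L2_norm (f j) + \<delta>))\<^sup>2)"
            using k(1) sq[of j] by (intro ennreal_leI) (simp add: power_mult_distrib)
          finally show ?thesis .
        qed
        have "cmod (trilinear_integral (\<lambda>v. \<eta> (T v)) (\<lambda>v. P (T v)) (\<lambda>x. g 1 (A x)) (\<lambda>x. g 2 (B x)) (g 3))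
          \<le> C2 * m * (sqrt cA * (L2_norm (f 1) + \<delta>) * (sqrt cB * (L2_norm (f 2) + \<delta>)) * (L2_norm (f 3) + \<delta>))"
          unfolding m_def
        proof (rule C2(2)[OF PTl PTc _ _ _ _ _ _ _ _ _ M(2) M2])
          show "(\<lambda>x. g 1 (A x)) \<in> borel_measurable borel" by (rule borel_measurable_compose_continuous[OF g13(1) cont(2)])
          show "(\<lambda>x. g 2 (B x)) \<in> borel_measurable borel" by (rule borel_measurable_compose_continuous[OF g13(2) cont(3)])
          show "g 3 \<in> borel_measurable borel" by (rule g13)
          show "0 < sqrt cA * (L2_norm (f 1) + \<delta>)" "0 < sqrt cB * (L2_norm (f 2) + \<delta>)" "0 < L2_norm (f 3) + \<delta>"
            using cA(1) cB(1) pos by auto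
          show "(\<integral>\<^sup>+x. ennreal ((cmod (g 1 (A x)))\<^sup>2) \<partial>lborel) \<le> ennreal ((sqrt cA * (L2_norm (f 1) + \<delta>))\<^sup>2)"
            by (rule scaled[OF cA(1)]; (rule cA(2))?; use g13(1) in measurable)
          show "(\<integral>\<^sup>+x. ennreal ((cmod (g 2 (B x)))\<^sup>2) \<partial>lborel) \<le> ennreal ((sqrt cB * (L2_norm (f 2) + \<delta>))\<^sup>2)"
            by (rule scaled[OF cB(1)]; (rule cB(2))?; use g13(2) in measurable)
          show "(\<integral>\<^sup>+x. ennreal ((cmod (g 3 x))\<^sup>2) \<partial>lborel) \<le> ennreal ((L2_norm (f 3) + \<delta>)\<^sup>2)"
            using L2[of 3] sq[of 3] by (simp add: ennreal_leI)
        qed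
        then show ?thesis unfolding form_eq by (simp add: mult_ac)
      qed
      let ?n = "L2_norm (f 1) * L2_norm (f 2) * L2_norm (f 3)"
      have n3: "(\<Prod>j=1..3. L2_norm (f j)) = ?n"
        by (simp add: numeral_eq_Suc atLeastAtMostSuc_conv mult_ac)
      have nn: "?n \<ge> 0" using n0 by simp
      have "cT * cmod (trilinear_form \<eta> \<pi> P f) \<le> (C2 * m * sqrt cA * sqrt cB) * ?n"
        by (rule le_product_limit) (rule bound)
      then have "cmod (trilinear_form \<eta> \<pi> P f) \<le> D * m * ?n"
        using cT(1) by (simp add: D_def field_simps)
      also have "\<dots> \<le> C * japanese_bracket (nd_norm d \<pi> ip P) powr (- \<epsilon>) * ?n"
      proof (rule mult_right_mono[OF _ nn])
        have "m \<le> sqrt (1 + C1) powr \<epsilon> * japanese_bracket (nd_norm d \<pi> ip P) powr (- \<epsilon>)"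
          using japanese_bracket_powr_bound[OF C1(2)[OF P M(2)] C1(1) M(1), of \<epsilon>] e by (simp add: m_def \<epsilon>_def)
        then have "D * m \<le> D * (sqrt (1 + C1) powr \<epsilon> * japanese_bracket (nd_norm d \<pi> ip P) powr (- \<epsilon>))"
          using D0 by (rule mult_left_mono)
        also have "\<dots> \<le> C * japanese_bracket (nd_norm d \<pi> ip P) powr (- \<epsilon>)"
          by (simp add: C_def distrib_right)
        finally show "D * m \<le> C * japanese_bracket (nd_norm d \<pi> ip P) powr (- \<epsilon>)" .
      qed
      finally show ?thesis unfolding n3 .
    qed
    then show ?thesis using C0 by blast
  qed
  then show ?thesis using e by blast
qed

end
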